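(* Let $D>0$, $f_0>0$, $L_0>0$ and let $a,b,\gamma_1\in\mathbb{R}$. Suppose that $L(t)>0$ and $A(t)$ satisfy $$L(t)^2=at^2+2bt+L_0^2,\qquad \ddot A(t)=\frac{\gamma_1}{(at^2+2bt+L_0^2)^{3/2}},$$ for $t\ge 0$ in the (finite or infinite) time interval starting at $0$ on which $at^2+2bt+L_0^2>0$. Put $\gamma_0=aL_0^2-b^2$ and let $(\sigma_n,g_n)_{n\ge1}$ be the eigenvalues and eigenfunctions of the Sturm–Liouville problem $$\sigma g(\xi)=Dg''(\xi)+\Big(\frac{\gamma_0\xi^2}{4DL_0^4}+\frac{\gamma_1\xi}{2DL_0^3}\Big)g(\xi)\ \text{ in } 0<\xi<L_0,\qquad g(0)=g(L_0)=0 .$$ Then for any initial condition $u(\cdot,0)\in L^2([0,L_0])$, the solution $u(\xi,t)$ of the transformed problem (see context) is given exactly by a sum $u(\xi,t)=\sum_{n\ge1}p_n u_n(\xi,t)$, with constants $p_n$ depending only on the initial condition, where $$u_n(\xi,t)=\exp\Big(\sigma_n\int_0^t\frac{L_0^2}{L(\zeta)^2}d\zeta\Big)g_n(\xi)\Big(\frac{L_0}{L(t)}\Big)^{1/2}\exp\Big(f_0t-\int_0^t\frac{\dot A(\zeta)^2}{4D}d\zeta-\frac{\xi^2\dot L(t)L(t)}{4DL_0^2}-\frac{\xi\dot A(t)L(t)}{2DL_0}\Big).$$ Explicitly, with constants $c,d\in\mathbb{R}$: (i) If $a=b=0$, so $L(t)=L_0$ and $A(t)=\frac{\gamma_1}{2L_0^3}t^2+ct+d$,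 then $$u_n(\xi,t)=e^{\sigma_nt}g_n(\xi)\exp\Big(f_0t-\frac1{4D}\Big(\frac{\gamma_1^2}{3L_0^6}t^3+\frac{c\gamma_1}{L_0^3}t^2+c^2t\Big)-\frac{\xi}{2DL_0}\Big(\frac{\gamma_1}{L_0^2}t+cL_0\Big)\Big).$$ (ii) If $a\ne0$ and $aL_0^2-b^2=0$, so $L(t)=L_0+\alpha t$ with $\alpha\neq0$ and $A(t)=\frac{\gamma_1}{2\alpha^2(L_0+\alpha t)}+ct+d$, then $$u_n(\xi,t)=\exp\Big(\frac{\sigma_nL_0t}{L_0+\alpha t}\Big)g_n(\xi)\Big(\frac{L_0}{L_0+\alpha t}\Big)^{1/2}e^{f_0t}\exp\Big(-\frac1{4D}\Big(c^2t-\frac{c\gamma_1t}{\alpha L_0(L_0+\alpha t)}-\frac{\gamma_1^2}{12\alpha^3}\Big(\frac1{(L_0+\alpha t)^3}-\frac1{L_0^3}\Big)\Big)\Big)$$ $$\times\exp\Big(-\frac{\xi^2\alpha(L_0+\alpha t)}{4DL_0^2}-\frac{\xi c(L_0+\alpha t)}{2DL_0}+\frac{\xi\gamma_1}{4DL_0\alpha(L_0+\alpha t)}\Big).$$ (iii) If $a=0$ and $b=\rho\ne0$, so $L(t)=\sqrt{L_0^2+2\rho t}$ and $A(t)=-\frac{\gamma_1}{\rho^2}\sqrt{L_0^2+2\rho t}+ct+d$, then $$u_n(\xi,t)=\Big(\frac{L_0^2+2\rho t}{L_0^2}\Big)^{\frac{\sigma_nL_0^2}{2\rho}-\frac14-\frac{\gamma_1^2}{8\rho^3D}}g_n(\xi)\exp\Big(f_0t-\frac{c^2}{4D}t+\frac{c\gamma_1}{2\rho^2D}\big(\sqrt{L_0^2+2\rho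 t}-L_0\big)\Big)$$ $$\times\exp\Big(-\frac{\xi^2\rho}{4DL_0^2}+\frac{\xi\gamma_1}{2DL_0\rho}-\frac{\xi c\sqrt{L_0^2+2\rho t}}{2DL_0}\Big).$$ (iv) If $a\ne0$ and $aL_0^2-b^2\neq0$, so $L(t)=\sqrt{at^2+2bt+L_0^2}$ and $A(t)=-\frac{\gamma_1}{b^2-aL_0^2}L(t)+ct+d$, then $$u_n(\xi,t)=\Theta_n(t)g_n(\xi)\Big(\frac{L_0^2}{at^2+2bt+L_0^2}\Big)^{1/4}\exp\Big(f_0t-\frac1{4D}\Big(\frac{\gamma_1^2a}{(b^2-aL_0^2)^2}+c^2\Big)t+\frac{c\gamma_1}{2D(b^2-aL_0^2)}\big(L(t)-L_0\big)\Big)$$ $$\times\exp\Big(-\frac{\xi^2(at+b)}{4DL_0^2}+\frac{\xi\gamma_1(at+b)}{2DL_0(b^2-aL_0^2)}-\frac{\xi c}{2DL_0}L(t)\Big),$$ where, if $aL_0^2-b^2<0$, $$\Theta_n(t)=\left(\frac{\big(at+b-\sqrt{b^2-aL_0^2}\big)\big(b+\sqrt{b^2-aL_0^2}\big)}{\big(b-\sqrt{b^2-aL_0^2}\big)\big(at+b+\sqrt{b^2-aL_0^2}\big)}\right)^{\frac{\sigma_nL_0^2}{2\sqrt{b^2-aL_0^2}}-\frac{\gamma_1^2}{8D(b^2-aL_0^2)^{3/2}}},$$ and, if $aL_0^2-b^2>0$, $$\Theta_n(t)=\exp\left(\Big(\frac{\sigma_nL_0^2}{\sqrt{aL_0^2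-b^2}}+\frac{\gamma_1^2}{4D(aL_0^2-b^2)^{3/2}}\Big)\Big(\arctan\frac{at+b}{\sqrt{aL_0^2-b^2}}-\arctan\frac{b}{\sqrt{aL_0^2-b^2}}\Big)\right).$$
   Context: Consider the linear growth-diffusion problem on a time-dependent interval $$\psi_t=D\psi_{xx}+f_0\psi\ \text{ in } A(t)<x<A(t)+L(t),\qquad \psi=0\ \text{ at } x=A(t),\ x=A(t)+L(t),$$ where $D,f_0>0$ are constants and $A$, $L>0$ are prescribed twice continuously differentiable functions of $t$, with $L_0=L(0)$. With $\xi=\frac{x-A(t)}{L(t)}L_0$ and $u(\xi,t)=\psi(x,t)$, this becomes the transformed problem $$u_t=D\frac{L_0^2}{L(t)^2}u_{\xi\xi}+\frac{\dot A(t)L_0+\xi\dot L(t)}{L(t)}u_\xi+f_0u\ \text{ in } 0<\xi<L_0,\qquad u=0\ \text{ at }\xi=0,\ \xi=L_0.$$ The sum $\sum_n p_nu_n$ is an eigenfunction expansion (Sturm–Liouville expansion); its convergence is understood in $L^2([0,L_0])$ for each $t$. Dots denote derivatives with respect to $t$. *)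

theory Defs
  imports "HOL-Analysis.Analysis"
begin

definition L2_on :: "real set \<Rightarrow> (real \<Rightarrow> real) \<Rightarrow> bool" where
  "L2_on S f \<longleftrightarrow> f \<in> borel_measurable (lebesgue_on S) \<and> integrable (lebesgue_on S) (\<lambda>x. (f x)\<^sup>2)"

text \<open>Since the Bochner integral of a non-integrable function is \<open>0\<close>, square integrability
  of the differences is required explicitly.\<close>

definition L2_tendsto :: "real set \<Rightarrow> ('i \<Rightarrow> real \<Rightarrow> real) \<Rightarrow> (real \<Rightarrow> real) \<Rightarrow> 'i filter \<Rightarrow> bool" where
  "L2_tendsto S F f net \<longleftrightarrow>
     (\<forall>\<^sub>F i in net. L2_on S (\<lambda>x. F i x - f x)) \<and>
     ((\<lambda>i. LINT x|lebesgue_on S. (F i x - f x)\<^sup>2) \<longlongrightarrow> 0) net"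

text \<open>The maximal time interval starting at \<open>0\<close> on which \<open>a t\<^sup>2 + 2 b t + L0\<^sup>2\<close> is positive.\<close>

definition time_interval :: "real \<Rightarrow> real \<Rightarrow> real \<Rightarrow> real set" where
  "time_interval a b L0 = {t. 0 \<le> t \<and> (\<forall>s\<in>{0..t}. 0 < a * s\<^sup>2 + 2 * b * s + L0\<^sup>2)}"

definition sl_eigenpair ::
  "real \<Rightarrow> (real \<Rightarrow> real) \<Rightarrow> real \<Rightarrow> real \<Rightarrow> (real \<Rightarrow> real) \<Rightarrow> bool" where
  "sl_eigenpair D q L0 s h \<longleftrightarrow>
     continuous_on {0..L0} h \<and> h 0 = 0 \<and> h L0 = 0 \<and> (\<exists>\<xi>\<in>{0..L0}. h \<xi> \<noteq> 0) \<and>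
     (\<exists>h' h''. \<forall>\<xi>\<in>{0<..<L0}.
        (h has_real_derivative h' \<xi>) (at \<xi>) \<and>
        (h' has_real_derivative h'' \<xi>) (at \<xi>) \<and>
        s * h \<xi> = D * h'' \<xi> + q \<xi> * h \<xi>)"

text \<open>\<open>(\<sigma> n, g n)\<close>, \<open>n \<ge> 1\<close>, lists every eigenvalue exactly once (the eigenvalues of this
  regular problem are simple) together with an eigenfunction. No normalisation of the
  eigenfunctions and no ordering of the eigenvalues is imposed.\<close>

definition sl_eigensystem ::
  "real \<Rightarrow> (real \<Rightarrow> real) \<Rightarrow> real \<Rightarrow> (nat \<Rightarrow> real) \<Rightarrow> (nat \<Rightarrow> real \<Rightarrow> real) \<Rightarrow> bool" where
  "sl_eigensystem D q L0 \<sigma> g \<longleftrightarrow>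
     (\<forall>n\<ge>1. sl_eigenpair D q L0 (\<sigma> n) (g n)) \<and>
     inj_on \<sigma> {1..} \<and>
     (\<forall>s. (\<exists>h. sl_eigenpair D q L0 s h) \<longrightarrow> s \<in> \<sigma> ` {1..})"

text \<open>Solutions with \<open>L\<^sup>2\<close> initial data: classical (\<open>C\<^sup>2\<close> in \<open>\<xi>\<close>, \<open>C\<^sup>1\<close> in \<open>t\<close>, continuous up to the
  lateral boundary) for positive times, the initial datum being attained in \<open>L\<^sup>2\<close> as
  \<open>t\<close> decreases to \<open>0\<close>. \<open>J\<close> is an interval of times containing \<open>0\<close> as its least element;
  \<open>L'\<close> and \<open>A'\<close> stand for the time derivatives of \<open>L\<close> and \<open>A\<close>.\<close>

definition transformed_solution ::
  "real \<Rightarrow> real \<Rightarrow> real \<Rightarrow> real set \<Rightarrow> (real \<Rightarrow> real) \<Rightarrow> (real \<Rightarrow> real) \<Rightarrow> (real \<Rightarrow> real)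
    \<Rightarrow> (real \<Rightarrow> real) \<Rightarrow> (real \<Rightarrow> real \<Rightarrow> real) \<Rightarrow> bool" where
  "transformed_solution D f0 L0 J L L' A' u0 u \<longleftrightarrow>
     continuous_on ({0..L0} \<times> (J - {0})) (\<lambda>(\<xi>, t). u \<xi> t) \<and>
     (\<exists>ut ux uxx.
        continuous_on ({0<..<L0} \<times> (J - {0})) (\<lambda>(\<xi>, t). ut \<xi> t) \<and>
        continuous_on ({0<..<L0} \<times> (J - {0})) (\<lambda>(\<xi>, t). ux \<xi> t) \<and>
        continuous_on ({0<..<L0} \<times> (J - {0})) (\<lambda>(\<xi>, t). uxx \<xi> t) \<and>
        (\<forall>\<xi>\<in>{0<..<L0}. \<forall>t\<in>J - {0}.
           ((\<lambda>s. u \<xi> s) has_real_derivative ut \<xi> t) (at t) \<and>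
           ((\<lambda>x. u x t) has_real_derivative ux \<xi> t) (at \<xi>) \<and>
           ((\<lambda>x. ux x t) has_real_derivative uxx \<xi> t) (at \<xi>) \<and>
           ut \<xi> t = D * (L0\<^sup>2 / (L t)\<^sup>2) * uxx \<xi> t
                    + (A' t * L0 + \<xi> * L' t) / L t * ux \<xi> t + f0 * u \<xi> t)) \<and>
     (\<forall>t\<in>J - {0}. u 0 t = 0 \<and> u L0 t = 0) \<and>
     (AE \<xi> in lebesgue_on {0..L0}. u \<xi> 0 = u0 \<xi>) \<and>
     L2_tendsto {0..L0} (\<lambda>t \<xi>. u \<xi> t) u0 (at 0 within J)"

definition mode ::
  "real \<Rightarrow> real \<Rightarrow> real \<Rightarrow> (real \<Rightarrow> real) \<Rightarrow> (real \<Rightarrow> real) \<Rightarrow> (real \<Rightarrow> real)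
    \<Rightarrow> real \<Rightarrow> (real \<Rightarrow> real) \<Rightarrow> real \<Rightarrow> real \<Rightarrow> real" where
  "mode D f0 L0 L L' A' s h \<xi> t =
     exp (s * integral {0..t} (\<lambda>\<zeta>. L0\<^sup>2 / (L \<zeta>)\<^sup>2)) * h \<xi> * (L0 / L t) powr (1/2) *
     exp (f0 * t - integral {0..t} (\<lambda>\<zeta>. (A' \<zeta>)\<^sup>2 / (4 * D))
          - \<xi>\<^sup>2 * L' t * L t / (4 * D * L0\<^sup>2) - \<xi> * A' t * L t / (2 * D * L0))"

end

theory Submission
  imports Defs "HOL-Complex_Analysis.Great_Picard"
begin

text \<open>
  Dividing by \<open>exp \<Phi>\<close>, where \<open>\<Phi>\<close> is quadratic in \<open>\<xi>\<close>, removes the drift term and turns the transformed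
  problem into \<open>v\<^sub>t = L0\<^sup>2 / L\<^sup>2 (D v\<^sub>\<xi>\<^sub>\<xi> + q v)\<close>. The potential \<open>q\<close> does not depend on time because \<open>L\<^sup>3 L''\<close> and
  \<open>L\<^sup>3 A''\<close> are constant, so in the time variable \<open>\<tau> = \<integral> L0\<^sup>2 / L\<^sup>2\<close> this is the heat equation of a regular
  Sturm-Liouville operator.

  For \<open>\<mu>\<close> above the maximum of \<open>q\<close>, the Dirichlet solution operator of \<open>\<mu> - q - D d\<^sup>2/d\<xi>\<^sup>2\<close> is symmetric,
  positive and, by the Arzela-Ascoli theorem, compact. If the eigenfunctions were not complete, it would have a
  further eigenfunction in their orthogonal complement. Its boundedness from \<open>L\<^sup>2\<close> to the supremum norm
  gives \<open>\<Sum>\<^sub>n (\<mu> - \<sigma>\<^sub>n)\<^sup>-\<^sup>2 < \<infinity>\<close>, and with it convergence of the heat series and of its derivatives at positive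
  times. For uniqueness, the \<open>n\<close>-th coefficient of a solution is shown to be a multiple of \<open>exp (\<sigma>\<^sub>n \<tau>)\<close>. As
  the derivatives of a solution are controlled only in the open interval, one integrates over
  \<open>[\<epsilon>, l - \<epsilon>]\<close> against the eigenfunction minus the affine interpolant of its end values and lets \<open>\<epsilon>\<close> tend to \<open>0\<close>.
\<close>

section \<open>Square-integrable functions and linear equations of second order\<close>

text \<open>The hypotheses give the eigenvalues without order or asymptotics, so all growth
  information must come from the solution operator K itself. The bound |K f (x)|^2 <= (l / D) |f|^2,
  applied to finite sums of eigenfunctions, yields a Bessel inequality for the Green's function at
  each x; integrating it over x bounds the sum of the (\<mu> - \<sigma>)^-2 by l^2 / D, whatever the
  enumeration.

  K is kept as a relation between continuous functions. Limits are therefore uniform limits, with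
  continuous limit functions, supplied by a Hoelder bound of exponent 1/2 or by the sup bound above;
  general square-integrable functions are reached through density of the range of K. The pairing
  acts on functions rather than on classes, so vanishing of the norm gives vanishing of the function
  only under continuity.\<close>

definition inner_on :: "real set \<Rightarrow> (real \<Rightarrow> real) \<Rightarrow> (real \<Rightarrow> real) \<Rightarrow> real" where
  "inner_on S f g = (LINT x|lebesgue_on S. f x * g x)"

abbreviation norm2_on :: "real set \<Rightarrow> (real \<Rightarrow> real) \<Rightarrow> real" where
  "norm2_on S f \<equiv> inner_on S f f"

lemma L2_onD:
  assumes "L2_on S f"
  shows "f \<in> borel_measurable (lebesgue_on S)" "integrable (lebesgue_on S) (\<lambda>x. (f x)\<^sup>2)"
  using assms by (auto simp: L2_on_def)

lemma integrable_mult_L2_on: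
  assumes "L2_on S f" "L2_on S g"
  shows "integrable (lebesgue_on S) (\<lambda>x. f x * g x)"
proof (rule Bochner_Integration.integrable_bound)
  show "integrable (lebesgue_on S) (\<lambda>x. (f x)\<^sup>2 + (g x)\<^sup>2)"
    using L2_onD[OF assms(1)] L2_onD[OF assms(2)] by auto
  show "(\<lambda>x. f x * g x) \<in> borel_measurable (lebesgue_on S)"
    using L2_onD[OF assms(1)] L2_onD[OF assms(2)] by auto
  have "\<bar>y * z\<bar> \<le> y\<^sup>2 + z\<^sup>2" for y z :: real
  proof -
    have "2 * \<bar>y\<bar> * \<bar>z\<bar> \<le> y\<^sup>2 + z\<^sup>2" "0 \<le> \<bar>y\<bar> * \<bar>z\<bar>"
      using sum_squares_bound[of "\<bar>y\<bar>" "\<bar>z\<bar>"] by auto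
    then show ?thesis by (simp only: abs_mult mult.assoc)
  qed
  then show "AE x in lebesgue_on S. norm (f x * g x) \<le> norm ((f x)\<^sup>2 + (g x)\<^sup>2)"
    by (intro AE_I2) (auto simp: abs_mult intro: order_trans)
qed

lemma L2_on_add:
  assumes "L2_on S f" "L2_on S g"
  shows "L2_on S (\<lambda>x. f x + g x)"
proof -
  have "integrable (lebesgue_on S) (\<lambda>x. (f x)\<^sup>2 + 2 * (f x * g x) + (g x)\<^sup>2)"
    using L2_onD[OF assms(1)] L2_onD[OF assms(2)] integrable_mult_L2_on[OF assms] by simp
  then show ?thesis
    using L2_onD[OF assms(1)] L2_onD[OF assms(2)]
    by (simp add: L2_on_def power2_sum algebra_simps)
qed

lemma L2_on_cmult: "L2_on S f \<Longrightarrow> L2_on S (\<lambda>x. c * f x)"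
  by (auto simp: L2_on_def power_mult_distrib)

lemma L2_on_diff: "L2_on S f \<Longrightarrow> L2_on S g \<Longrightarrow> L2_on S (\<lambda>x. f x - g x)"
  using L2_on_add[of S f "\<lambda>x. -1 * g x"] L2_on_cmult[of S g "-1"] by simp

lemma L2_on_zero: "L2_on S (\<lambda>x. 0)"
  by (simp add: L2_on_def)

lemma L2_on_sum: "(\<And>i. i \<in> I \<Longrightarrow> L2_on S (f i)) \<Longrightarrow> L2_on S (\<lambda>x. \<Sum>i\<in>I. f i x)"
  by (induction I rule: infinite_finite_induct) (auto simp: L2_on_zero L2_on_add)

lemma L2_on_continuous: "continuous_on {a..b} f \<Longrightarrow> L2_on {a..b} f"
  unfolding L2_on_def
  by (auto intro!: continuous_imp_integrable_real continuous_intros continuous_imp_measurable_on_sets_lebesgue)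

lemma integral_lebesgue_on_cong:
  "(\<And>x. x \<in> S \<Longrightarrow> f x = g x) \<Longrightarrow> (LINT x|lebesgue_on S. f x) = (LINT x|lebesgue_on S. g x)"
  by (rule Bochner_Integration.integral_cong) auto

lemma L2_on_mult_continuous:
  assumes "L2_on {a..b} f" "continuous_on {a..b} w"
  shows "L2_on {a..b} (\<lambda>x. w x * f x)"
proof -
  obtain M where M: "\<And>x. x \<in> {a..b} \<Longrightarrow> \<bar>w x\<bar> \<le> M"
    using compact_continuous_image[OF assms(2) compact_Icc] compact_imp_bounded bounded_iff
    by (metis imageI real_norm_def)
  have m: "(\<lambda>x. w x * f x) \<in> borel_measurable (lebesgue_on {a..b})"
    using L2_onD[OF assms(1)] L2_onD[OF L2_on_continuous[OF assms(2)]] by auto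
  have "integrable (lebesgue_on {a..b}) (\<lambda>x. (w x * f x)\<^sup>2)"
  proof (rule Bochner_Integration.integrable_bound)
    show "integrable (lebesgue_on {a..b}) (\<lambda>x. M\<^sup>2 * (f x)\<^sup>2)"
      using L2_onD[OF assms(1)] by simp
    have "(w x * f x)\<^sup>2 \<le> M\<^sup>2 * (f x)\<^sup>2" if "x \<in> {a..b}" for x
      using power_mono[OF M[OF that], of 2] by (simp add: power_mult_distrib mult_right_mono)
    then show "AE x in lebesgue_on {a..b}. norm ((w x * f x)\<^sup>2) \<le> norm (M\<^sup>2 * (f x)\<^sup>2)"
      by (intro AE_I2) auto
  qed (use m in auto)
  with m show ?thesis by (auto simp: L2_on_def)
qed

lemma inner_on_cong:
  "(\<And>x. x \<in> S \<Longrightarrow> f x = f' x) \<Longrightarrow> (\<And>x. x \<in> S \<Longrightarrow> g x = g' x) \<Longrightarrow> inner_on S f g = inner_on S f' g'"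
  unfolding inner_on_def by (rule integral_lebesgue_on_cong) auto

lemma inner_on_commute: "inner_on S f g = inner_on S g f"
  by (simp add: inner_on_def mult.commute)

lemma inner_on_self: "inner_on S f f = (LINT x|lebesgue_on S. (f x)\<^sup>2)"
  by (simp add: inner_on_def power2_eq_square)

lemma inner_on_self_nonneg: "0 \<le> inner_on S f f"
  by (simp add: inner_on_self)

lemma inner_on_add_left:
  "L2_on S f \<Longrightarrow> L2_on S g \<Longrightarrow> L2_on S h \<Longrightarrow>
   inner_on S (\<lambda>x. f x + g x) h = inner_on S f h + inner_on S g h"
  by (simp add: inner_on_def distrib_right integrable_mult_L2_on)

lemma inner_on_diff_left:
  "L2_on S f \<Longrightarrow> L2_on S g \<Longrightarrow> L2_on S h \<Longrightarrow>
   inner_on S (\<lambda>x. f x - g x) h = inner_on S f h - inner_on S g h"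
  by (simp add: inner_on_def left_diff_distrib integrable_mult_L2_on)

lemma inner_on_cmult_left: "inner_on S (\<lambda>x. c * f x) h = c * inner_on S f h"
  by (simp add: inner_on_def mult.assoc)

lemma inner_on_cmult_right: "inner_on S f (\<lambda>x. c * h x) = c * inner_on S f h"
  by (simp add: inner_on_commute[of S f] inner_on_cmult_left)

lemma inner_on_diff_right:
  "L2_on S f \<Longrightarrow> L2_on S g \<Longrightarrow> L2_on S h \<Longrightarrow>
   inner_on S h (\<lambda>x. f x - g x) = inner_on S h f - inner_on S h g"
  by (simp add: inner_on_commute[of S h] inner_on_diff_left)

lemma inner_on_add_right:
  "L2_on S f \<Longrightarrow> L2_on S g \<Longrightarrow> L2_on S h \<Longrightarrow>
   inner_on S h (\<lambda>x. f x + g x) = inner_on S h f + inner_on S h g"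
  by (simp add: inner_on_commute[of S h] inner_on_add_left)

lemma inner_on_sum_left:
  assumes "L2_on S h" "\<And>i. i \<in> I \<Longrightarrow> L2_on S (f i)"
  shows "inner_on S (\<lambda>x. \<Sum>i\<in>I. f i x) h = (\<Sum>i\<in>I. inner_on S (f i) h)"
  using assms(2)
proof (induction I rule: infinite_finite_induct)
  case (insert i I)
  then show ?case
    by (simp add: inner_on_add_left L2_on_sum assms(1))
qed (simp_all add: inner_on_def)

lemma inner_on_lincomb_left:
  assumes "L2_on S h" "\<And>i. i \<in> I \<Longrightarrow> L2_on S (f i)"
  shows "inner_on S (\<lambda>x. \<Sum>i\<in>I. c i * f i x) h = (\<Sum>i\<in>I. c i * inner_on S (f i) h)"
  using inner_on_sum_left[of S h I "\<lambda>i x. c i * f i x"] assms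
  by (simp add: L2_on_cmult inner_on_cmult_left)

lemma inner_on_self_add:
  assumes "L2_on S f" "L2_on S g"
  shows "norm2_on S (\<lambda>x. f x + g x) = inner_on S f f + 2 * inner_on S f g + inner_on S g g"
  using assms by (simp add: inner_on_add_left inner_on_add_right L2_on_add inner_on_commute[of S g f])

lemma inner_on_self_diff:
  assumes "L2_on S f" "L2_on S g"
  shows "norm2_on S (\<lambda>x. f x - g x) = inner_on S f f - 2 * inner_on S f g + inner_on S g g"
  using assms by (simp add: inner_on_diff_left inner_on_diff_right L2_on_diff inner_on_commute[of S g f])

text \<open>The parallelogram law with one square dropped. It serves as the triangle inequality for
  squared norms.\<close>

lemma inner_on_self_add_le:
  assumes "L2_on S f" "L2_on S g"
  shows "norm2_on S (\<lambda>x. f x + g x) \<le> 2 * inner_on S f f + 2 * inner_on S g g"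
  using inner_on_self_add[OF assms] inner_on_self_diff[OF assms]
    inner_on_self_nonneg[of S "\<lambda>x. f x - g x"] by linarith

lemma inner_on_Cauchy_Schwarz:
  assumes "L2_on S f" "L2_on S g"
  shows "(inner_on S f g)\<^sup>2 \<le> inner_on S f f * inner_on S g g"
proof -
  let ?a = "inner_on S f f" and ?b = "inner_on S f g" and ?c = "inner_on S g g"
  have q: "0 \<le> ?a - 2 * (s * ?b) + s\<^sup>2 * ?c" for s
    using inner_on_self_nonneg[of S "\<lambda>x. f x - s * g x"] inner_on_self_diff[of S f "\<lambda>x. s * g x"] assms
    by (simp add: L2_on_cmult inner_on_cmult_left inner_on_cmult_right power2_eq_square mult.assoc)
  show ?thesis
  proof (cases "?c = 0")
    case True
    have "?b = 0"
    proof (rule ccontr)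
      assume "?b \<noteq> 0"
      \<comment> \<open>With \<open>?c = 0\<close> the quadratic is affine in \<open>s\<close>, and
        this value of \<open>s\<close> makes it equal to -1.\<close>
      with q[of "(?a + 1) / (2 * ?b)"] True show False by (simp add: field_simps)
    qed
    with True show ?thesis by simp
  next
    case False
    then have c: "?c > 0" using inner_on_self_nonneg[of S g] by linarith
    have "0 \<le> (?a - 2 * (?b / ?c * ?b) + (?b / ?c)\<^sup>2 * ?c) * ?c"
      using q[of "?b / ?c"] c by (intro mult_nonneg_nonneg) auto
    also have "\<dots> = ?a * ?c - ?b\<^sup>2" using c by (simp add: field_simps power2_eq_square)
    finally show ?thesis by simp
  qed
qed

lemma inner_on_abs_le:
  assumes "L2_on S f" "L2_on S g"
  shows "\<bar>inner_on S f g\<bar> \<le> sqrt (inner_on S f f) * sqrt (inner_on S g g)"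
  using real_sqrt_le_mono[OF inner_on_Cauchy_Schwarz[OF assms]] by (simp add: real_sqrt_mult)

lemma inner_on_self_mono:
  assumes "L2_on S f" "L2_on S g" "\<And>x. x \<in> S \<Longrightarrow> \<bar>f x\<bar> \<le> \<bar>g x\<bar>"
  shows "inner_on S f f \<le> inner_on S g g"
  unfolding inner_on_self using assms L2_onD
  by (intro Bochner_Integration.integral_mono) (auto simp: abs_le_square_iff)

lemma inner_on_self_le_const:
  assumes "0 \<le> l" "L2_on {0..l} f" "\<And>x. x \<in> {0..l} \<Longrightarrow> \<bar>f x\<bar> \<le> M"
  shows "inner_on {0..l} f f \<le> M\<^sup>2 * l"
proof -
  have "inner_on {0..l} f f \<le> norm2_on {0..l} (\<lambda>_. M)"
    using assms(3) by (intro inner_on_self_mono[OF assms(2) L2_on_continuous]) fastforce+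
  also have "\<dots> = M\<^sup>2 * l"
    using assms(1) by (simp add: inner_on_def power2_eq_square measure_restrict_space)
  finally show ?thesis .
qed

lemma inner_on_mult_le:
  assumes "L2_on {a..b} f" "continuous_on {a..b} w" "\<And>x. x \<in> {a..b} \<Longrightarrow> \<bar>w x\<bar> \<le> M"
  shows "norm2_on {a..b} (\<lambda>x. w x * f x) \<le> M\<^sup>2 * inner_on {a..b} f f"
proof -
  have "norm2_on {a..b} (\<lambda>x. w x * f x)
      \<le> norm2_on {a..b} (\<lambda>x. M * f x)"
    using assms
    by (intro inner_on_self_mono L2_on_mult_continuous L2_on_cmult)
       (auto simp: abs_mult intro!: mult_right_mono, fastforce)
  then show ?thesis
    by (simp add: inner_on_cmult_left inner_on_cmult_right power2_eq_square mult.assoc)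
qed

lemma inner_on_eq_integral:
  assumes "continuous_on {a..b} f" "continuous_on {a..b} g"
  shows "inner_on {a..b} f g = integral {a..b} (\<lambda>x. f x * g x)"
  unfolding inner_on_def using assms
  by (intro lebesgue_integral_eq_integral continuous_imp_integrable_real) (auto intro!: continuous_intros)

lemma has_integral_inner_on:
  assumes "continuous_on {a..b} f" "continuous_on {a..b} g"
  shows "((\<lambda>x. f x * g x) has_integral inner_on {a..b} f g) {a..b}"
  unfolding inner_on_eq_integral[OF assms]
  by (intro integrable_integral integrable_continuous_real continuous_on_mult assms)

lemma inner_on_self_eq_0D:
  assumes "continuous_on {a..b} f" "a < b" "inner_on {a..b} f f = 0" "x \<in> {a..b}"
  shows "f x = 0"
proof -
  have "((\<lambda>x. f x * f x) has_integral 0) {a..b}"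
    using inner_on_eq_integral[OF assms(1,1)] assms(1,3)
    by (metis continuous_on_mult integrable_continuous_real has_integral_iff)
  then have "f x * f x = 0"
    using has_integral_0_cbox_imp_0[of a b "\<lambda>x. f x * f x" x] assms
    by (auto intro!: continuous_intros)
  then show ?thesis by simp
qed

section \<open>One-variable calculus on closed intervals and Picard iteration\<close>

lemma has_field_derivative_transform:
  assumes "x \<in> S" "\<And>x. x \<in> S \<Longrightarrow> g x = f x" "(f has_field_derivative d) (at x within S)"
  shows "(g has_field_derivative d) (at x within S)"
  using assms unfolding has_field_derivative_def by (rule has_derivative_transform)

lemma derivative_continuous_on:
  "(\<And>x. x \<in> S \<Longrightarrow> (f has_real_derivative f' x) (at x within S)) \<Longrightarrow> continuous_on S f"
  by (meson DERIV_continuous continuous_on_eq_continuous_within)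

lemma integral_derivative:
  assumes "a \<le> b" "\<And>x. x \<in> {a..b} \<Longrightarrow> (F has_real_derivative f x) (at x within {a..b})"
  shows "(f has_integral (F b - F a)) {a..b}"
  using assms by (intro fundamental_theorem_of_calculus)
    (auto simp: has_real_derivative_iff_has_vector_derivative[symmetric])

lemma indefinite_integral_derivative:
  assumes "continuous_on {a..b} f" "x \<in> {a..b}"
  shows "((\<lambda>x. integral {a..x} f) has_real_derivative f x) (at x within {a..b::real})"
  using integral_has_real_derivative[OF assms] .

lemma bounded_continuous_Icc:
  assumes "continuous_on {a..b::real} f"
  obtains M :: real where "M \<ge> 0" "\<And>x. x \<in> {a..b} \<Longrightarrow> \<bar>f x\<bar> \<le> M"
proof -
  have "bounded (f ` {a..b})"
    using compact_continuous_image[OF assms compact_Icc] compact_imp_bounded by blast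
  then have "\<exists>M. \<forall>x\<in>{a..b}. \<bar>f x\<bar> \<le> M" by (auto simp: bounded_iff)
  then obtain M where "\<forall>x\<in>{a..b}. \<bar>f x\<bar> \<le> M" by blast
  then show ?thesis using that[of "max M 0"] by fastforce
qed

text \<open>Picard iteration for the system (y, y')' = (y', P y + F), written as a series of
  increments \<open>u k\<close>, \<open>v k\<close>. The increments decay like (C x)^k / k!, so the
  series may be differentiated term by term; differentiation lowers the index by one.\<close>

lemma ode2_exists:
  fixes P F :: "real \<Rightarrow> real"
  assumes P: "continuous_on {0..l} P" and F: "continuous_on {0..l} F" and l: "0 \<le> l"
  obtains y y' where "\<And>x. x \<in> {0..l} \<Longrightarrow> (y has_real_derivative y' x) (at x within {0..l})"
    "\<And>x. x \<in> {0..l} \<Longrightarrow> (y' has_real_derivative P x * y x + F x) (at x within {0..l})"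
    "y 0 = 0" "y' 0 = \<beta>"
proof -
  let ?I = "{0..l}"
  \<comment> \<open>Initial slope and inhomogeneity enter only the increment of index 0; each later
    increment integrates the homogeneous system applied to the preceding one.\<close>
  define h where "h = rec_nat ((\<lambda>x. 0), (\<lambda>x. \<beta> + integral {0..x} F))
     (\<lambda>k (u, v). ((\<lambda>x. integral {0..x} v), (\<lambda>x. integral {0..x} (\<lambda>y. P y * u y))))"
  define u where "u k = fst (h k)" for k
  define v where "v k = snd (h k)" for k
  have u0: "u 0 = (\<lambda>x. 0)" and v0: "v 0 = (\<lambda>x. \<beta> + integral {0..x} F)"
    and uS: "u (Suc k) = (\<lambda>x. integral {0..x} (v k))"
    and vS: "v (Suc k) = (\<lambda>x. integral {0..x} (\<lambda>y. P y * u k y))" for k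
    by (simp_all add: u_def v_def h_def split: prod.splits)
  have cont: "continuous_on ?I (u k) \<and> continuous_on ?I (v k)" for k
  proof (induction k)
    case 0
    show ?case using F by (auto simp: u0 v0 intro!: continuous_intros indefinite_integral_continuous_1 integrable_continuous_real)
  next
    case (Suc k)
    then show ?case using P
      by (auto simp: uS vS intro!: continuous_intros indefinite_integral_continuous_1 integrable_continuous_real)
  qed
  define u' where "u' k = (case k of 0 \<Rightarrow> (\<lambda>x. 0) | Suc j \<Rightarrow> v j)" for k
  define v' where "v' k = (case k of 0 \<Rightarrow> F | Suc j \<Rightarrow> (\<lambda>x. P x * u j x))" for k
  have du: "(u k has_real_derivative u' k x) (at x within ?I)" if "x \<in> ?I" for k x
    using that cont by (cases k) (auto simp: u0 uS u'_def intro!: indefinite_integral_derivative)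
  have dv: "(v k has_real_derivative v' k x) (at x within ?I)" if x: "x \<in> ?I" for k x
  proof (cases k)
    case 0
    show ?thesis unfolding 0 v0 v'_def using indefinite_integral_derivative[OF F x]
      by (auto intro!: derivative_eq_intros)
  next
    case (Suc j)
    show ?thesis unfolding Suc vS v'_def using cont[of j] P
      by (auto intro!: indefinite_integral_derivative[OF _ x] continuous_intros)
  qed
  obtain MP where MP: "MP \<ge> 0" "\<And>x. x \<in> ?I \<Longrightarrow> \<bar>P x\<bar> \<le> MP" using bounded_continuous_Icc[OF P] by blast
  obtain MF where MF: "MF \<ge> 0" "\<And>x. x \<in> ?I \<Longrightarrow> \<bar>F x\<bar> \<le> MF" using bounded_continuous_Icc[OF F] by blast
  obtain B where B: "B \<ge> 0" "\<And>x. x \<in> ?I \<Longrightarrow> \<bar>v 0 x\<bar> \<le> B"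
    using bounded_continuous_Icc[of 0 l "v 0"] cont by blast
  \<comment> \<open>The maximum with 1 lets one constant serve both integrations: the
    \<open>u\<close>-step has coefficient 1, the \<open>v\<close>-step has coefficient
    \<open>P\<close>.\<close>
  define C where "C = max 1 MP"
  have C: "C \<ge> 1" "MP \<le> C" by (auto simp: C_def)
  have int_bound: "\<bar>integral {0..x} f\<bar> \<le> B * (C * x) ^ Suc k / fact (Suc k)"
    if x: "x \<in> ?I" and f: "continuous_on {0..x} f"
      and fb: "\<And>y. y \<in> {0..x} \<Longrightarrow> \<bar>f y\<bar> \<le> C * (B * (C * y) ^ k / fact k)" for x f k
  proof -
    have "((\<lambda>y. B * (C * y) ^ Suc k / fact (Suc k)) has_real_derivative C * (B * (C * y) ^ k / fact k)) (at y within {0..x})" for y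
    proof -
      have "((\<lambda>y. B * C ^ Suc k / fact (Suc k) * y ^ Suc k) has_real_derivative
          B * C ^ Suc k / fact (Suc k) * (real (Suc k) * y ^ k)) (at y within {0..x})"
        using DERIV_cmult[OF DERIV_pow[of "Suc k" y "{0..x}"], of "B * C ^ Suc k / fact (Suc k)"] by simp
      moreover have "B * C ^ Suc k / fact (Suc k) * (real (Suc k) * y ^ k) = C * (B * (C * y) ^ k / fact k)"
        by (simp add: power_mult_distrib divide_simps del: of_nat_Suc)
      ultimately show ?thesis by (simp add: power_mult_distrib mult_ac)
    qed
    from integral_derivative[OF _ this] x
    have "((\<lambda>y. C * (B * (C * y) ^ k / fact k)) has_integral B * (C * x) ^ Suc k / fact (Suc k)) {0..x}"
      by simp
    then show ?thesis
      using integral_norm_bound_integral[of f "{0..x}" "\<lambda>y. C * (B * (C * y) ^ k / fact k)"] f fb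
      by (auto simp: has_integral_iff integrable_continuous_real)
  qed
  have bound: "\<forall>x\<in>?I. \<bar>u k x\<bar> \<le> B * (C * x) ^ k / fact k \<and> \<bar>v k x\<bar> \<le> B * (C * x) ^ k / fact k" for k
  proof (induction k)
    case 0
    show ?case using B by (auto simp: u0)
  next
    case (Suc k)
    show ?case
    proof (intro ballI conjI)
      fix x assume x: "x \<in> ?I"
      have sub: "{0..x} \<subseteq> ?I" using x by auto
      show "\<bar>u (Suc k) x\<bar> \<le> B * (C * x) ^ Suc k / fact (Suc k)"
        unfolding uS
      proof (rule int_bound[OF x])
        show "continuous_on {0..x} (v k)" using cont sub continuous_on_subset by blast
        fix y assume y: "y \<in> {0..x}"
        then have "\<bar>v k y\<bar> \<le> B * (C * y) ^ k / fact k" using Suc sub by blast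
        also have "\<dots> \<le> C * (B * (C * y) ^ k / fact k)"
          using C B y mult_right_mono[of 1 C "B * (C * y) ^ k / fact k"] by auto
        finally show "\<bar>v k y\<bar> \<le> C * (B * (C * y) ^ k / fact k)" .
      qed
      show "\<bar>v (Suc k) x\<bar> \<le> B * (C * x) ^ Suc k / fact (Suc k)"
        unfolding vS
      proof (rule int_bound[OF x])
        show "continuous_on {0..x} (\<lambda>y. P y * u k y)"
          using cont[of k] P continuous_on_subset[OF _ sub] by (auto intro!: continuous_intros)
        fix y assume y: "y \<in> {0..x}"
        then have "\<bar>u k y\<bar> \<le> B * (C * y) ^ k / fact k" "\<bar>P y\<bar> \<le> C"
          using Suc sub MP(2)[of y] C by fastforce+
        then show "\<bar>P y * u k y\<bar> \<le> C * (B * (C * y) ^ k / fact k)"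
          unfolding abs_mult using C by (intro mult_mono) auto
      qed
    qed
  qed
  define M where "M k = B * (C * l) ^ k / fact k" for k
  have M0: "M k \<ge> 0" for k using B C l by (auto simp: M_def)
  have ub: "\<bar>u k x\<bar> \<le> M k" and vb: "\<bar>v k x\<bar> \<le> M k" if x: "x \<in> ?I" for x k
  proof -
    have "B * (C * x) ^ k / fact k \<le> M k"
      using x B C by (auto simp: M_def intro!: divide_right_mono mult_left_mono power_mono)
    moreover have "\<bar>u k x\<bar> \<le> B * (C * x) ^ k / fact k \<and> \<bar>v k x\<bar> \<le> B * (C * x) ^ k / fact k"
      using bound x by blast
    ultimately show "\<bar>u k x\<bar> \<le> M k" "\<bar>v k x\<bar> \<le> M k" by linarith+
  qed
  have Msum: "summable M"
    unfolding M_def using summable_mult[OF summable_exp[of "C * l"], of B]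
    by (simp add: divide_inverse mult_ac)
  \<comment> \<open>Majorant of the derivatives: index 0 contributes \<open>F\<close>, index
    \<open>Suc j\<close> the increment of index \<open>j\<close>, possibly multiplied by
    \<open>P\<close>.\<close>
  define N where "N k = (case k of 0 \<Rightarrow> MF | Suc j \<Rightarrow> C * M j)" for k
  have Nsum: "summable N"
    using Msum by (subst summable_Suc_iff[symmetric]) (simp add: N_def summable_mult)
  have MC: "M j \<le> C * M j" for j using mult_right_mono[of 1 C "M j"] C M0 by simp
  have u'b: "\<bar>u' k x\<bar> \<le> N k" and v'b: "\<bar>v' k x\<bar> \<le> N k" if x: "x \<in> ?I" for x k
  proof -
    show "\<bar>u' k x\<bar> \<le> N k"
      using vb[OF x] MC MF(1) by (auto simp: u'_def N_def split: nat.split intro: order_trans)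
    have "\<bar>P x\<bar> * \<bar>u j x\<bar> \<le> C * M j" for j
      using MP(2)[OF x] C ub[OF x] by (intro mult_mono) auto
    then show "\<bar>v' k x\<bar> \<le> N k"
      using MF(2)[OF x] by (auto simp: v'_def N_def abs_mult split: nat.split)
  qed
  define y where "y x = (\<Sum>k. u k x)" for x
  define z where "z x = (\<Sum>k. v k x)" for x
  define y' where "y' x = (\<Sum>k. u' k x)" for x
  define z' where "z' x = (\<Sum>k. v' k x)" for x
  have su: "summable (\<lambda>k. u k x)" and sv: "summable (\<lambda>k. v k x)" if "x \<in> ?I" for x
    using ub[OF that] vb[OF that] by (auto intro!: summable_comparison_test'[OF Msum, of 0])
  have su': "summable (\<lambda>k. u' k x)" and sv': "summable (\<lambda>k. v' k x)" if "x \<in> ?I" for x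
    using u'b[OF that] v'b[OF that] by (auto intro!: summable_comparison_test'[OF Nsum, of 0])
  have lim_u: "uniform_limit ?I (\<lambda>n x. \<Sum>i<n. u' i x) y' sequentially"
    unfolding y'_def by (rule Weierstrass_m_test[OF _ Nsum]) (use u'b in auto)
  have lim_v: "uniform_limit ?I (\<lambda>n x. \<Sum>i<n. v' i x) z' sequentially"
    unfolding z'_def by (rule Weierstrass_m_test[OF _ Nsum]) (use v'b in auto)
  have 0: "0 \<in> ?I" using l by simp
  have dy: "(y has_real_derivative y' x) (at x within ?I)" if x: "x \<in> ?I" for x
  proof -
    obtain G where G: "\<And>x. x \<in> ?I \<Longrightarrow> (\<lambda>n. u n x) sums G x"
      "\<And>x. x \<in> ?I \<Longrightarrow> (G has_real_derivative y' x) (at x within ?I)"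
      using has_field_derivative_series[OF convex_real_interval(5) du lim_u 0 su[OF 0]] by blast
    then show ?thesis
      using x by (intro has_field_derivative_transform[OF x _ G(2)[OF x]]) (auto simp: y_def sums_iff)
  qed
  have dz: "(z has_real_derivative z' x) (at x within ?I)" if x: "x \<in> ?I" for x
  proof -
    obtain G where G: "\<And>x. x \<in> ?I \<Longrightarrow> (\<lambda>n. v n x) sums G x"
      "\<And>x. x \<in> ?I \<Longrightarrow> (G has_real_derivative z' x) (at x within ?I)"
      using has_field_derivative_series[OF convex_real_interval(5) dv lim_v 0 sv[OF 0]] by blast
    then show ?thesis
      using x by (intro has_field_derivative_transform[OF x _ G(2)[OF x]]) (auto simp: z_def sums_iff)
  qed
  have y'z: "y' x = z x" if x: "x \<in> ?I" for x
    using suminf_split_head[OF su'[OF x]] unfolding y'_def z_def by (simp add: u'_def)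
  have z'y: "z' x = P x * y x + F x" if x: "x \<in> ?I" for x
    using suminf_split_head[OF sv'[OF x]] suminf_mult[OF su[OF x], of "P x"] unfolding z'_def y_def
    by (simp add: v'_def)
  have uv0: "u k 0 = 0" "v k 0 = (if k = 0 then \<beta> else 0)" for k
    by (cases k; simp add: u0 v0 uS vS)+
  have "y 0 = 0" by (simp add: y_def uv0)
  moreover have "z 0 = \<beta>"
    unfolding z_def uv0 using suminf_finite[of "{0}" "\<lambda>k. if k = 0 then \<beta> else 0"] by simp
  ultimately show thesis
    using that[of y z] dy dz y'z z'y by auto
qed

section \<open>The Dirichlet problem\<close>

text \<open>Gronwall's inequality with the weight built in: |2 y y' (1 + P)| is at most (1 + M) (y^2
  + y'^2), so y^2 + y'^2 times exp (- (1 + M) x) cannot increase from its initial value 0.\<close>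

lemma ode2_zero:
  assumes y: "\<And>x. x \<in> {0..l} \<Longrightarrow> (y has_real_derivative y' x) (at x within {0..l})"
    and y': "\<And>x. x \<in> {0..l} \<Longrightarrow> (y' has_real_derivative P x * y x) (at x within {0..l})"
    and P: "continuous_on {0..l} P" and 0: "y 0 = 0" "y' 0 = 0" and x: "x \<in> {0..l}"
  shows "y x = 0"
proof -
  obtain M where M: "\<And>x. x \<in> {0..l} \<Longrightarrow> \<bar>P x\<bar> \<le> M" using bounded_continuous_Icc[OF P] by blast
  define E where "E x = exp (- (1 + M) * x) * ((y x)\<^sup>2 + (y' x)\<^sup>2)" for x
  define E' where "E' x = exp (- (1 + M) * x) *
    (2 * y x * y' x + 2 * y' x * (P x * y x) - (1 + M) * ((y x)\<^sup>2 + (y' x)\<^sup>2))" for x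
  have dE: "(E has_real_derivative E' t) (at t within {0..x})" if "t \<in> {0..x}" for t
  proof -
    have t: "t \<in> {0..l}" and sub: "{0..x} \<subseteq> {0..l}" using that x by auto
    note [derivative_intros] = DERIV_subset[OF y[OF t] sub] DERIV_subset[OF y'[OF t] sub]
    show ?thesis unfolding E_def E'_def
      by (rule derivative_eq_intros refl)+ (simp add: algebra_simps power2_eq_square)
  qed
  have "E' t \<le> 0" if "t \<in> {0..x}" for t
  proof -
    have "2 * y t * y' t * (1 + P t) \<le> (1 + M) * ((y t)\<^sup>2 + (y' t)\<^sup>2)"
    proof -
      have "2 * y t * y' t * (1 + P t) \<le> \<bar>2 * y t * y' t\<bar> * \<bar>1 + P t\<bar>"
        by (metis abs_ge_self abs_mult)
      also have "\<dots> \<le> ((y t)\<^sup>2 + (y' t)\<^sup>2) * (1 + M)"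
        using sum_squares_bound[of "\<bar>y t\<bar>" "\<bar>y' t\<bar>"] M[of t] that x
        by (intro mult_mono) (auto simp: abs_mult)
      finally show ?thesis by (simp add: mult.commute)
    qed
    then have "2 * y t * y' t + 2 * y' t * (P t * y t) - (1 + M) * ((y t)\<^sup>2 + (y' t)\<^sup>2) \<le> 0"
      by (simp add: algebra_simps)
    then show ?thesis unfolding E'_def by (intro mult_nonneg_nonpos) auto
  qed
  moreover have "(E' has_integral E x - E 0) {0..x}"
    using x dE by (intro integral_derivative) auto
  ultimately have "E x - E 0 \<le> 0"
    using has_integral_nonneg[OF has_integral_neg, of E' "E x - E 0" "{0..x}"] by auto
  moreover have "E 0 = 0" using 0 by (simp add: E_def)
  ultimately have "(y x)\<^sup>2 + (y' x)\<^sup>2 \<le> 0"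
    by (simp add: E_def mult_le_0_iff)
  then show ?thesis by (metis add_nonneg_eq_0_iff antisym power_eq_0_iff sum_power2_ge_zero zero_le_power2)
qed

text \<open>\<open>p\<close> is later \<open>\<mu> - q\<close>. The lower bound 1 gives coercivity
  with constant 1, hence a solution operator of L2 norm at most 1, and it excludes 0 as an
  eigenvalue.\<close>

locale dirichlet_bvp =
  fixes D l :: real and p :: "real \<Rightarrow> real"
  assumes D: "D > 0" and l: "l > 0" and cont_p: "continuous_on {0..l} p"
    and p_ge_1: "\<And>x. x \<in> {0..l} \<Longrightarrow> p x \<ge> 1"
begin

abbreviation ip where "ip \<equiv> inner_on {0..l}"

abbreviation nsq where "nsq f \<equiv> ip f f"

text \<open>\<open>y'\<close> is an argument because the energy estimates bound it. Derivatives are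
  taken within the closed interval, so that initial-value arguments at 0 apply to
  \<open>y' 0\<close>.\<close>

definition bvp :: "(real \<Rightarrow> real) \<Rightarrow> (real \<Rightarrow> real) \<Rightarrow> (real \<Rightarrow> real) \<Rightarrow> bool" where
  "bvp f y y' \<longleftrightarrow> continuous_on {0..l} f \<and> y 0 = 0 \<and> y l = 0 \<and>
     (\<forall>x\<in>{0..l}. (y has_real_derivative y' x) (at x within {0..l}) \<and>
        (y' has_real_derivative (p x * y x - f x) / D) (at x within {0..l}))"

text \<open>\<open>sol f y\<close> is the graph of the solution operator \<open>(p - D d\<^sup>2/dx\<^sup>2)\<^sup>-\<^sup>1\<close> with Dirichlet conditions.\<close>

definition sol :: "(real \<Rightarrow> real) \<Rightarrow> (real \<Rightarrow> real) \<Rightarrow> bool" where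
  "sol f y \<longleftrightarrow> (\<exists>y'. bvp f y y')"

lemma bvp_continuous:
  assumes "bvp f y y'"
  shows "continuous_on {0..l} f" "continuous_on {0..l} y" "continuous_on {0..l} y'"
  using assms derivative_continuous_on[of "{0..l}" y y']
    derivative_continuous_on[of "{0..l}" y' "\<lambda>x. (p x * y x - f x) / D"]
  unfolding bvp_def by blast+

lemma sol_continuous: "sol f y \<Longrightarrow> continuous_on {0..l} f" "sol f y \<Longrightarrow> continuous_on {0..l} y"
  unfolding sol_def using bvp_continuous by blast+

lemma sol_L2: "sol f y \<Longrightarrow> L2_on {0..l} f" "sol f y \<Longrightarrow> L2_on {0..l} y"
  using sol_continuous L2_on_continuous by blast+

text \<open>Integrate the derivative of y' z over the interval; the boundary term vanishes together
  with \<open>z\<close>.\<close>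

lemma bvp_weak:
  assumes y: "bvp f y y'" and z: "bvp g z z'"
  shows "ip f z = D * ip y' z' + ip (\<lambda>x. p x * y x) z"
proof -
  note c = bvp_continuous[OF y] bvp_continuous[OF z] cont_p
  have "((\<lambda>x. y' x * z x) has_real_derivative (p x * y x - f x) / D * z x + y' x * z' x) (at x within {0..l})"
    if "x \<in> {0..l}" for x
    using that y z by (auto simp: bvp_def intro!: derivative_eq_intros)
  then have "((\<lambda>x. (p x * y x - f x) / D * z x + y' x * z' x) has_integral y' l * z l - y' 0 * z 0) {0..l}"
    using l by (intro integral_derivative) auto
  then have "((\<lambda>x. D * ((p x * y x - f x) / D * z x + y' x * z' x)) has_integral D * 0) {0..l}"
    using z by (intro has_integral_mult_right) (simp add: bvp_def)
  moreover have "D * ((p x * y x - f x) / D * z x + y' x * z' x) = p x * y x * z x - f x * z x + D * (y' x * z' x)" for x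
    using D by (simp add: distrib_left left_diff_distrib)
  ultimately have "((\<lambda>x. p x * y x * z x - f x * z x + D * (y' x * z' x)) has_integral 0) {0..l}"
    by simp
  moreover have "((\<lambda>x. p x * y x * z x - f x * z x + D * (y' x * z' x)) has_integral
      ip (\<lambda>x. p x * y x) z - ip f z + D * ip y' z') {0..l}"
    by (rule has_integral_add[OF has_integral_diff[OF has_integral_inner_on[OF continuous_on_mult[OF c(7,2)] c(5)]
          has_integral_inner_on[OF c(1,5)]] has_integral_mult_right[OF has_integral_inner_on[OF c(3,6)]]])
  ultimately have "ip (\<lambda>x. p x * y x) z - ip f z + D * ip y' z' = 0"
    using has_integral_unique by blast
  then show ?thesis by simp
qed

text \<open>The right-hand side of \<open>bvp_weak\<close> is symmetric in \<open>y\<close> and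
  \<open>z\<close>.\<close>

lemma sol_sym: "sol f y \<Longrightarrow> sol g z \<Longrightarrow> ip f z = ip y g"
proof -
  assume "sol f y" "sol g z"
  then obtain y' z' where b: "bvp f y y'" "bvp g z z'" by (auto simp: sol_def)
  have "ip (\<lambda>x. p x * y x) z = ip (\<lambda>x. p x * z x) y"
    by (simp add: inner_on_def mult_ac)
  then show ?thesis
    using bvp_weak[OF b] bvp_weak[OF b(2,1)]
    by (simp only: inner_on_commute[of _ z' y'] inner_on_commute[of _ y g])
qed

text \<open>\<open>bvp_weak\<close> tested with \<open>y\<close> itself, together with p >= 1, gives
  the bounds by \<open>ip f y\<close>; the Cauchy-Schwarz inequality then trades
  \<open>ip f y\<close> for \<open>ip f f\<close>.\<close>

lemma bvp_energy:
  assumes "bvp f y y'"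
  shows "ip y y \<le> ip f y" "D * ip y' y' \<le> ip f y" "ip y y \<le> ip f f" "D * ip y' y' \<le> ip f f"
proof -
  note c = bvp_continuous[OF assms] cont_p
  have w: "ip f y = D * ip y' y' + ip (\<lambda>x. p x * y x) y" by (rule bvp_weak[OF assms assms])
  have "y x * y x \<le> p x * y x * y x" if "x \<in> {0..l}" for x
    using mult_right_mono[OF p_ge_1[OF that], of "y x * y x"] by (simp add: mult.assoc)
  then have p: "ip y y \<le> ip (\<lambda>x. p x * y x) y"
    using c by (auto simp: inner_on_eq_integral continuous_intros intro!: integral_le integrable_continuous_real continuous_intros)
  have "0 \<le> D * ip y' y'" using D inner_on_self_nonneg by simp
  with w p show 1: "ip y y \<le> ip f y" by simp
  show 2: "D * ip y' y' \<le> ip f y" using w p inner_on_self_nonneg[of "{0..l}" y] by simp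
  have cs: "(ip f y)\<^sup>2 \<le> ip f f * ip y y" using c by (intro inner_on_Cauchy_Schwarz L2_on_continuous)
  have "(ip y y)\<^sup>2 \<le> (ip f y)\<^sup>2" using 1 inner_on_self_nonneg by (intro power_mono)
  with cs have *: "ip y y * ip y y \<le> ip f f * ip y y" by (simp add: power2_eq_square)
  show 3: "ip y y \<le> ip f f"
  proof (cases "ip y y = 0")
    case False
    with inner_on_self_nonneg[of "{0..l}" y] * show ?thesis by simp
  qed (simp add: inner_on_self_nonneg)
  have "(ip f y)\<^sup>2 \<le> (ip f f)\<^sup>2"
    using cs mult_left_mono[OF 3 inner_on_self_nonneg[of "{0..l}" f]] by (simp add: power2_eq_square)
  then have "ip f y \<le> ip f f" using inner_on_self_nonneg power2_le_imp_le by blast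
  with 2 show "D * ip y' y' \<le> ip f f" by simp
qed

text \<open>The form in which the energy estimate yields injectivity: it is applied with f = 0 in
  \<open>sol_exists\<close> and with y = 0 in \<open>sol_inj\<close>.\<close>

lemma bvp_derivative_zero:
  assumes "bvp f y y'" "ip f y \<le> 0" "x \<in> {0..l}"
  shows "y' x = 0"
proof -
  have "D * ip y' y' \<le> 0" using bvp_energy(2)[OF assms(1)] assms(2) by linarith
  then have "ip y' y' = 0"
    using D inner_on_self_nonneg[of "{0..l}" y'] by (simp add: mult_le_0_iff)
  then show ?thesis
    using inner_on_self_eq_0D[of 0 l y' x] bvp_continuous[OF assms(1)] l assms(3) by blast
qed

lemma sol_norm: "sol f y \<Longrightarrow> ip y y \<le> ip f f"
  unfolding sol_def using bvp_energy by blast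

lemma sol_pos: "sol f y \<Longrightarrow> ip y y \<le> ip f y"
  unfolding sol_def using bvp_energy by blast

text \<open>The increment of \<open>y\<close> is the integral of 1 times y', so Cauchy-Schwarz and
  the energy bound on y' apply. This is the equicontinuity behind compactness.\<close>

lemma sol_holder:
  assumes "sol f y" "u \<in> {0..l}" "v \<in> {0..l}"
  shows "(y u - y v)\<^sup>2 \<le> \<bar>u - v\<bar> * (ip f f / D)"
  using assms(2,3)
proof (induction u v rule: linorder_wlog)
  case (le u v)
  obtain y' where b: "bvp f y y'" using assms(1) by (auto simp: sol_def)
  note c = bvp_continuous[OF b]
  have sub: "{u..v} \<subseteq> {0..l}" using le by auto
  have cy': "continuous_on {u..v} y'" using c sub continuous_on_subset by blast
  have "(y has_real_derivative y' t) (at t within {u..v})" if "t \<in> {u..v}" for t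
    using b that sub DERIV_subset[OF _ sub] by (auto simp: bvp_def)
  then have "(y' has_integral y v - y u) {u..v}" using le by (intro integral_derivative) auto
  then have 1: "inner_on {u..v} (\<lambda>_. 1) y' = y v - y u"
    using cy' by (subst inner_on_eq_integral) (auto simp: has_integral_iff)
  have "inner_on {u..v} y' y' \<le> ip y' y'"
    using sub c cy'
    by (subst (1 2) inner_on_eq_integral)
       (auto intro!: integral_subset_le integrable_continuous_real continuous_intros)
  also have "\<dots> \<le> ip f f / D" using bvp_energy(4)[OF b] D by (simp add: field_simps)
  finally have 2: "inner_on {u..v} y' y' \<le> ip f f / D" .
  have "(y v - y u)\<^sup>2 \<le> inner_on {u..v} (\<lambda>_. 1) (\<lambda>_. 1) * inner_on {u..v} y' y'"
    unfolding 1[symmetric] using cy' by (intro inner_on_Cauchy_Schwarz L2_on_continuous) auto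
  also have "\<dots> = (v - u) * inner_on {u..v} y' y'"
    using le by (simp add: inner_on_eq_integral)
  also have "\<dots> \<le> (v - u) * (ip f f / D)" using 2 le by (intro mult_left_mono) auto
  finally show ?case using le by (simp add: power2_commute)
next
  case (sym u v)
  then show ?case by (simp add: power2_commute abs_minus_commute)
qed

text \<open>The Hoelder bound measured from the endpoint 0, where \<open>y\<close> vanishes.\<close>

lemma sol_sup:
  assumes "sol f y" "x \<in> {0..l}"
  shows "(y x)\<^sup>2 \<le> l / D * ip f f"
proof -
  have "(y x - y 0)\<^sup>2 \<le> \<bar>x - 0\<bar> * (ip f f / D)" using assms l by (intro sol_holder) auto
  also have "\<dots> \<le> l * (ip f f / D)"
    using assms D inner_on_self_nonneg[of "{0..l}" f] by (intro mult_right_mono) auto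
  finally show ?thesis using assms by (auto simp: sol_def bvp_def)
qed

lemma sol_lincomb:
  assumes "sol f y" "sol g z"
  shows "sol (\<lambda>x. a * f x + b * g x) (\<lambda>x. a * y x + b * z x)"
proof -
  obtain y' z' where *: "bvp f y y'" "bvp g z z'" using assms by (auto simp: sol_def)
  have "bvp (\<lambda>x. a * f x + b * g x) (\<lambda>x. a * y x + b * z x) (\<lambda>x. a * y' x + b * z' x)"
    unfolding bvp_def
  proof (intro conjI ballI)
    fix x assume "x \<in> {0..l}"
    with * have y: "(y has_real_derivative y' x) (at x within {0..l})" "(z has_real_derivative z' x) (at x within {0..l})"
      "(y' has_real_derivative (p x * y x - f x) / D) (at x within {0..l})"
      "(z' has_real_derivative (p x * z x - g x) / D) (at x within {0..l})"
      by (auto simp: bvp_def)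
    note [derivative_intros] = y
    show "((\<lambda>x. a * y x + b * z x) has_real_derivative a * y' x + b * z' x) (at x within {0..l})"
      by (rule derivative_eq_intros refl)+ simp
    show "((\<lambda>x. a * y' x + b * z' x) has_real_derivative
       (p x * (a * y x + b * z x) - (a * f x + b * g x)) / D) (at x within {0..l})"
      using D by (auto intro!: derivative_eq_intros simp: field_simps)
  qed (use * in \<open>auto simp: bvp_def intro!: continuous_intros\<close>)
  then show ?thesis by (auto simp: sol_def)
qed

lemma sol_cmult: "sol f y \<Longrightarrow> sol (\<lambda>x. a * f x) (\<lambda>x. a * y x)"
  using sol_lincomb[of f y f y a 0] by simp

lemma sol_diff: "sol f y \<Longrightarrow> sol g z \<Longrightarrow> sol (\<lambda>x. f x - g x) (\<lambda>x. y x - z x)"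
  using sol_lincomb[of f y g z 1 "-1"] by simp

lemma sol_add: "sol f y \<Longrightarrow> sol g z \<Longrightarrow> sol (\<lambda>x. f x + g x) (\<lambda>x. y x + z x)"
  using sol_lincomb[of f y g z 1 1] by simp

lemma sol_zero: "sol (\<lambda>x. 0) (\<lambda>x. 0)"
  unfolding sol_def bvp_def by (intro exI[of _ "\<lambda>_. 0"]) auto

lemma sol_sum: "finite I \<Longrightarrow> (\<And>i. i \<in> I \<Longrightarrow> sol (f i) (y i)) \<Longrightarrow> sol (\<lambda>x. \<Sum>i\<in>I. f i x) (\<lambda>x. \<Sum>i\<in>I. y i x)"
  by (induction I rule: finite_induct) (auto simp: sol_zero sol_add)

lemma sol_cong:
  assumes "sol f y" "\<And>x. x \<in> {0..l} \<Longrightarrow> f x = g x" "\<And>x. x \<in> {0..l} \<Longrightarrow> y x = z x"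
  shows "sol g z"
proof -
  obtain y' where b: "bvp f y y'" using assms by (auto simp: sol_def)
  have "continuous_on {0..l} g" using b continuous_on_cong[of "{0..l}" "{0..l}" f g] assms(2) by (auto simp: bvp_def)
  moreover have "(z has_real_derivative y' x) (at x within {0..l})"
    "(y' has_real_derivative (p x * z x - g x) / D) (at x within {0..l})" if "x \<in> {0..l}" for x
    using b that has_field_derivative_transform[OF that, of z y] assms(2,3) by (auto simp: bvp_def)
  ultimately have "bvp g z y'" using b assms(3)[of 0] assms(3)[of l] l by (auto simp: bvp_def)
  then show ?thesis by (auto simp: sol_def)
qed

text \<open>Shooting: \<open>u\<close> solves the homogeneous equation and \<open>w\<close> the
  inhomogeneous one, both vanish at 0, and a multiple of \<open>u\<close> corrects the value of
  \<open>w\<close> at \<open>l\<close>.\<close>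

lemma sol_exists:
  assumes f: "continuous_on {0..l} f"
  shows "\<exists>y. sol f y"
proof -
  let ?I = "{0..l}"
  have cP: "continuous_on ?I (\<lambda>x. p x / D)" using cont_p D by (auto intro!: continuous_intros)
  obtain u u' where u: "\<And>x. x \<in> ?I \<Longrightarrow> (u has_real_derivative u' x) (at x within ?I)"
    "\<And>x. x \<in> ?I \<Longrightarrow> (u' has_real_derivative p x / D * u x + 0) (at x within ?I)" "u 0 = 0" "u' 0 = 1"
    by (rule ode2_exists[OF cP continuous_on_const less_imp_le[OF l], of 0 1]) (rule that)
  have cf: "continuous_on ?I (\<lambda>x. - f x / D)" using f D by (auto intro!: continuous_intros)
  obtain w w' where w: "\<And>x. x \<in> ?I \<Longrightarrow> (w has_real_derivative w' x) (at x within ?I)"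
    "\<And>x. x \<in> ?I \<Longrightarrow> (w' has_real_derivative p x / D * w x + - f x / D) (at x within ?I)" "w 0 = 0"
    by (rule ode2_exists[OF cP cf less_imp_le[OF l], of 0]) (rule that)
  \<comment> \<open>If \<open>u l\<close> vanished, \<open>u\<close> would solve the homogeneous
    Dirichlet problem, against \<open>u' 0 = 1\<close>.\<close>
  have ul: "u l \<noteq> 0"
  proof
    assume "u l = 0"
    then have b: "bvp (\<lambda>_. 0) u u'" using u by (auto simp: bvp_def)
    have "u' 0 = 0" using bvp_derivative_zero[OF b, of 0] l by (simp add: inner_on_def)
    with u show False by simp
  qed
  define c where "c = w l / u l"
  have "bvp f (\<lambda>x. w x - c * u x) (\<lambda>x. w' x - c * u' x)"
    unfolding bvp_def
  proof (intro conjI ballI)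
    fix x assume x: "x \<in> ?I"
    note [derivative_intros] = u(1)[OF x] u(2)[OF x] w(1)[OF x] w(2)[OF x]
    show "((\<lambda>x. w x - c * u x) has_real_derivative w' x - c * u' x) (at x within ?I)"
      by (rule derivative_eq_intros refl)+ simp
    show "((\<lambda>x. w' x - c * u' x) has_real_derivative (p x * (w x - c * u x) - f x) / D) (at x within ?I)"
      using D by (auto intro!: derivative_eq_intros simp: field_simps)
  qed (use f u w ul in \<open>auto simp: c_def\<close>)
  then show ?thesis by (auto simp: sol_def)
qed

text \<open>The energy estimate forces y' = 0 on the whole interval, and - f / D is the derivative
  of y'.\<close>

lemma sol_inj:
  assumes "sol f y" "\<And>x. x \<in> {0..l} \<Longrightarrow> y x = 0" "x \<in> {0..l}"
  shows "f x = 0"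
proof -
  obtain y' where b: "bvp f y y'" using assms by (auto simp: sol_def)
  have "ip f y = ip f (\<lambda>_. 0)" by (rule inner_on_cong) (use assms in auto)
  then have y'0: "y' t = 0" if "t \<in> {0..l}" for t
    using bvp_derivative_zero[OF b _ that] by (simp add: inner_on_def)
  have "(y' has_real_derivative - f x / D) (at x within {0..l})"
    using b assms by (auto simp: bvp_def)
  moreover have "(y' has_real_derivative 0) (at x within {0..l})"
    by (rule has_field_derivative_transform[OF assms(3) y'0 DERIV_const])
  ultimately have "- f x / D = 0"
    using vector_derivative_unique_within_closed_interval[OF l] assms(3)
    unfolding has_real_derivative_iff_has_vector_derivative by fastforce
  then show ?thesis using D by simp
qed

text \<open>Simplicity of the eigenvalues: the combination h'(0) g - g'(0) h has zero value and zero
  slope at 0 and solves the same linear equation.\<close>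

lemma sol_eigenfunction_unique:
  assumes "sol (\<lambda>x. \<kappa> * g x) g" "sol (\<lambda>x. \<kappa> * h x) h" "\<exists>x\<in>{0..l}. g x \<noteq> 0"
  shows "\<exists>c. \<forall>x\<in>{0..l}. h x = c * g x"
proof -
  obtain g' h' where b: "bvp (\<lambda>x. \<kappa> * g x) g g'" "bvp (\<lambda>x. \<kappa> * h x) h h'"
    using assms by (auto simp: sol_def)
  let ?P = "\<lambda>x. (p x - \<kappa>) / D"
  have P: "continuous_on {0..l} ?P" using cont_p D by (auto intro!: continuous_intros)
  have "g' 0 \<noteq> 0"
  proof
    assume 0: "g' 0 = 0"
    have "g x = 0" if "x \<in> {0..l}" for x
      using b 0 D by (intro ode2_zero[OF _ _ P _ _ that, of g g']) (auto simp: bvp_def left_diff_distrib)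
    with assms(3) show False by blast
  qed
  have z: "h' 0 * g x - g' 0 * h x = 0" if x: "x \<in> {0..l}" for x
  proof (rule ode2_zero[OF _ _ P _ _ x])
    fix x assume x: "x \<in> {0..l}"
    have d: "(g has_real_derivative g' x) (at x within {0..l})" "(h has_real_derivative h' x) (at x within {0..l})"
      "(g' has_real_derivative (p x * g x - \<kappa> * g x) / D) (at x within {0..l})"
      "(h' has_real_derivative (p x * h x - \<kappa> * h x) / D) (at x within {0..l})"
      using b x by (auto simp: bvp_def)
    note [derivative_intros] = d
    show "((\<lambda>x. h' 0 * g x - g' 0 * h x) has_real_derivative h' 0 * g' x - g' 0 * h' x) (at x within {0..l})"
      by (rule derivative_eq_intros refl)+ simp
    show "((\<lambda>x. h' 0 * g' x - g' 0 * h' x) has_real_derivative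
        (p x - \<kappa>) / D * (h' 0 * g x - g' 0 * h x)) (at x within {0..l})"
      using D by (auto intro!: derivative_eq_intros simp: field_simps)
  qed (use b in \<open>auto simp: bvp_def\<close>)
  then show ?thesis using \<open>g' 0 \<noteq> 0\<close>
    by (intro exI[of _ "h' 0 / g' 0"]) (auto simp: field_simps)
qed

end

section \<open>Existence of eigenfunctions\<close>

lemma inner_on_uniform_limit:
  assumes "0 \<le> l" "uniform_limit {0..l} F f G" "\<forall>\<^sub>F i in G. L2_on {0..l} (\<lambda>x. F i x - f x)"
  shows "((\<lambda>i. norm2_on {0..l} (\<lambda>x. F i x - f x)) \<longlongrightarrow> 0) G"
proof (rule tendstoI)
  fix e :: real assume e: "e > 0"
  define d where "d = sqrt (e / (l + 1))"
  have d: "d > 0" "d\<^sup>2 * l < e"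
    using e assms(1) by (auto simp: d_def field_simps)
  from assms(3) uniform_limitD[OF assms(2) d(1)]
  show "\<forall>\<^sub>F i in G. dist (norm2_on {0..l} (\<lambda>x. F i x - f x)) 0 < e"
  proof eventually_elim
    case (elim i)
    have "norm2_on {0..l} (\<lambda>x. F i x - f x) \<le> d\<^sup>2 * l"
      using elim by (intro inner_on_self_le_const assms(1)) (auto simp: dist_real_def intro: less_imp_le)
    with d inner_on_self_nonneg[of "{0..l}" "\<lambda>x. F i x - f x"] show ?case by simp
  qed
qed

context dirichlet_bvp
begin

definition orth :: "(real \<Rightarrow> real) set \<Rightarrow> (real \<Rightarrow> real) \<Rightarrow> bool" where
  "orth E z \<longleftrightarrow> continuous_on {0..l} z \<and> (\<forall>e\<in>E. ip z e = 0)"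

lemma orth_lincomb:
  assumes "orth E y" "orth E z" "\<And>e. e \<in> E \<Longrightarrow> continuous_on {0..l} e"
  shows "orth E (\<lambda>x. a * y x + b * z x)"
  using assms by (auto simp: orth_def inner_on_add_left L2_on_continuous L2_on_cmult inner_on_cmult_left
      intro!: continuous_intros)

text \<open>A symmetric operator that maps each element of \<open>E\<close> to a multiple of itself
  preserves the orthogonal complement of \<open>E\<close>.\<close>

lemma orth_sol:
  assumes E: "\<And>e. e \<in> E \<Longrightarrow> \<exists>\<kappa>. \<kappa> \<noteq> 0 \<and> sol (\<lambda>x. \<kappa> * e x) e" and z: "orth E z" "sol z y"
  shows "orth E y"
  unfolding orth_def
proof (intro conjI ballI)
  show "continuous_on {0..l} y" using sol_continuous z by blast
  fix e assume e: "e \<in> E"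
  then obtain \<kappa> where k: "\<kappa> \<noteq> 0" "sol (\<lambda>x. \<kappa> * e x) e" using E by blast
  have "\<kappa> * ip y e = ip z e"
    using sol_sym[OF z(2) k(2)] by (simp add: inner_on_cmult_right)
  with k z e show "ip y e = 0" by (simp add: orth_def)
qed

text \<open>\<open>\<Lambda>\<close> is the squared norm of the solution operator \<open>K\<close> on the orthogonal complement of \<open>E\<close>. The
  limit \<open>\<xi>\<close> of \<open>K\<^sup>2 z\<close> along a maximising sequence satisfies \<open>K\<^sup>2 \<xi> = \<Lambda> \<xi>\<close>, so \<open>K \<xi> + sqrt \<Lambda> \<xi>\<close> is an
  eigenfunction; it is nonzero because \<open>K\<close> is positive.\<close>

lemma exists_eigenfunction_orth:
  assumes E: "\<And>e. e \<in> E \<Longrightarrow> \<exists>\<kappa>. \<kappa> \<noteq> 0 \<and> sol (\<lambda>x. \<kappa> * e x) e"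
    and z0: "orth E z0" and x0: "x0 \<in> {0..l}" "z0 x0 \<noteq> 0"
  shows "\<exists>\<kappa> w. sol (\<lambda>x. \<kappa> * w x) w \<and> orth E w \<and> (\<exists>x\<in>{0..l}. w x \<noteq> 0)"
proof -
  let ?I = "{0..l}"
  have Ec: "continuous_on ?I e" if "e \<in> E" for e using E[OF that] sol_continuous by blast
  define S where "S = {r. \<exists>z y. r = ip y y \<and> orth E z \<and> ip z z = 1 \<and> sol z y}"
  define \<Lambda> where "\<Lambda> = Sup S"
  have bdd: "bdd_above S" using sol_norm by (force simp: S_def bdd_above_def)
  have \<Lambda>: "ip y y \<le> \<Lambda> * ip z z" if z: "orth E z" "sol z y" for z y
  proof (cases "ip z z = 0")
    case True
    with sol_norm[OF z(2)] show ?thesis by simp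
  next
    case False
    then have pos: "ip z z > 0" using inner_on_self_nonneg[of ?I z] by linarith
    define c where "c = 1 / sqrt (ip z z)"
    have c: "c * c = 1 / ip z z" using pos by (simp add: c_def)
    have "orth E (\<lambda>x. c * z x)" using z by (auto simp: orth_def inner_on_cmult_left intro!: continuous_intros)
    moreover have "nsq (\<lambda>x. c * z x) = 1"
      using c pos by (simp add: inner_on_cmult_left inner_on_cmult_right flip: mult.assoc)
    moreover have "sol (\<lambda>x. c * z x) (\<lambda>x. c * y x)" using z by (intro sol_cmult)
    ultimately have "nsq (\<lambda>x. c * y x) \<le> \<Lambda>"
      unfolding \<Lambda>_def by (intro cSup_upper bdd) (auto simp: S_def)
    then have "ip y y / ip z z \<le> \<Lambda>"
      using c by (simp add: inner_on_cmult_left inner_on_cmult_right flip: mult.assoc)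
    with pos show ?thesis by (simp add: field_simps)
  qed
  have ex: "\<exists>y. sol z y" if "continuous_on ?I z" for z using sol_exists that by blast
  have z0c: "continuous_on ?I z0" using z0 by (simp add: orth_def)
  obtain y0 where y0: "sol z0 y0" using ex z0c by blast
  have z0n: "ip z0 z0 \<noteq> 0" using inner_on_self_eq_0D[OF z0c l] x0 by blast
  then have z0p: "ip z0 z0 > 0" using inner_on_self_nonneg[of ?I z0] by linarith
  \<comment> \<open>Injectivity of the solution operator makes the supremum \<open>\<Lambda>\<close>
    positive.\<close>
  have "ip y0 y0 \<noteq> 0"
  proof
    assume "ip y0 y0 = 0"
    then have "y0 x = 0" if "x \<in> ?I" for x
      using inner_on_self_eq_0D[OF sol_continuous(2)[OF y0] l _ that] by blast
    then have "z0 x0 = 0" using sol_inj[OF y0] x0 by blast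
    with x0 show False by simp
  qed
  then have "0 < ip y0 y0" using inner_on_self_nonneg[of ?I y0] by linarith
  then have "0 < \<Lambda> * ip z0 z0" using \<Lambda>[OF z0 y0] by linarith
  with z0p have \<Lambda>0: "\<Lambda> > 0" by (simp add: zero_less_mult_iff)
  have Sne: "S \<noteq> {}"
  proof -
    define c where "c = 1 / sqrt (ip z0 z0)"
    have "c * (c * ip z0 z0) = 1" using z0p by (simp add: c_def flip: mult.assoc)
    then have "nsq (\<lambda>x. c * z0 x) = 1"
      by (simp add: inner_on_cmult_left inner_on_cmult_right)
    moreover have "orth E (\<lambda>x. c * z0 x)" using z0 by (auto simp: orth_def inner_on_cmult_left intro!: continuous_intros)
    ultimately show ?thesis using sol_cmult[OF y0, of c] by (auto simp: S_def)
  qed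
  have "\<exists>z y. orth E z \<and> ip z z = 1 \<and> sol z y \<and> \<Lambda> - 1 / real (Suc k) < ip y y" for k
  proof -
    have "\<Lambda> - 1 / real (Suc k) < Sup S" by (simp add: \<Lambda>_def)
    then obtain r where "r \<in> S" "\<Lambda> - 1 / real (Suc k) < r" using less_cSup_iff[OF Sne bdd] by blast
    then show ?thesis by (auto simp: S_def)
  qed
  \<comment> \<open>\<open>z\<close> is a maximising sequence of unit vectors; \<open>y\<close>,
    \<open>x\<close>, \<open>a\<close>, \<open>b\<close> are its images under the first four powers
    of the operator K.\<close>
  then obtain z y where zy: "\<And>k. orth E (z k)" "\<And>k. nsq (z k) = 1" "\<And>k. sol (z k) (y k)"
    "\<And>k. \<Lambda> - 1 / real (Suc k) < nsq (y k)" by metis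
  have "\<exists>x. sol (y k) x" for k using ex sol_continuous zy(3) by blast
  then obtain x where x: "\<And>k. sol (y k) (x k)" by metis
  have "\<exists>a. sol (x k) a" for k using ex sol_continuous x by blast
  then obtain a where a: "\<And>k. sol (x k) (a k)" by metis
  have "\<exists>b. sol (a k) b" for k using ex sol_continuous a by blast
  then obtain b where b: "\<And>k. sol (a k) (b k)" by metis
  have y1: "nsq (y k) \<le> 1" for k using sol_norm[OF zy(3)] zy(2) by simp
  have xz: "ip (x k) (z k) = nsq (y k)" for k
    using sol_sym[OF zy(3) x] by (simp add: inner_on_commute)
  have Lz: "L2_on ?I (z k)" "L2_on ?I (x k)" for k using sol_L2 zy(3) x by blast+
  \<comment> \<open>Expand the square: |K^2 z|^2 <= \<Lambda> |K z|^2 and <K^2 z, z> = |K z|^2 leave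
    the bound \<Lambda> (\<Lambda> - |K z|^2).\<close>
  have resid: "nsq (\<lambda>t. x k t - \<Lambda> * z k t) \<le> \<Lambda> / real (Suc k)" for k
  proof -
    have "nsq (\<lambda>t. x k t - \<Lambda> * z k t) = nsq (x k) - 2 * (\<Lambda> * nsq (y k)) + \<Lambda> * \<Lambda>"
      using inner_on_self_diff[of ?I "x k" "\<lambda>t. \<Lambda> * z k t"] Lz
      by (simp add: L2_on_cmult inner_on_cmult_left inner_on_cmult_right zy(2) xz)
    also have "\<dots> \<le> \<Lambda> * (\<Lambda> - nsq (y k))"
      using \<Lambda>[OF orth_sol[OF E zy(1,3)] x, of k] by (simp add: algebra_simps)
    also have "\<dots> \<le> \<Lambda> * (1 / real (Suc k))"
      using zy(4)[of k] \<Lambda>0 by (intro mult_left_mono) auto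
    finally show ?thesis by simp
  qed
  \<comment> \<open>The functions \<open>x k\<close> are images of the \<open>y k\<close>, whose
    norms are at most 1, so the sup bound and the Hoelder bound are uniform in
    \<open>k\<close>.\<close>
  obtain \<xi> r where \<xi>: "continuous_on ?I \<xi>" "strict_mono (r :: nat \<Rightarrow> nat)"
    "\<And>e. 0 < e \<Longrightarrow> \<exists>N. \<forall>n t. n \<ge> N \<and> t \<in> ?I \<longrightarrow> norm (x (r n) t - \<xi> t) < e"
  proof (rule Arzela_Ascoli[of ?I x "sqrt (l / D)"])
    show "norm (x n t) \<le> sqrt (l / D)" if "t \<in> ?I" for n t
    proof -
      have "(x n t)\<^sup>2 \<le> l / D * nsq (y n)" using sol_sup[OF x that] .
      also have "\<dots> \<le> l / D * 1" using y1 l D by (intro mult_left_mono) auto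
      finally show ?thesis by (simp add: real_le_rsqrt)
    qed
    show "\<exists>d>0. \<forall>n v. v \<in> ?I \<and> norm (u - v) < d \<longrightarrow> norm (x n u - x n v) < e"
      if "u \<in> ?I" "0 < e" for u e
    proof (intro exI[of _ "e\<^sup>2 * D"] conjI allI impI)
      show "0 < e\<^sup>2 * D" using that D by simp
      fix n v assume v: "v \<in> ?I \<and> norm (u - v) < e\<^sup>2 * D"
      have "(x n u - x n v)\<^sup>2 \<le> \<bar>u - v\<bar> * (nsq (y n) / D)" using sol_holder[OF x] that v by blast
      also have "\<dots> \<le> \<bar>u - v\<bar> * (1 / D)" using y1 D by (intro mult_left_mono divide_right_mono) auto
      also have "\<dots> < e\<^sup>2" using v D by (simp add: field_simps)
      finally have "\<bar>x n u - x n v\<bar>\<^sup>2 < e\<^sup>2" by simp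
      then show "norm (x n u - x n v) < e" using that power2_less_imp_less by fastforce
    qed
  qed (auto intro: that)
  have ul: "uniform_limit ?I (\<lambda>n. x (r n)) \<xi> sequentially"
    unfolding uniform_limit_iff eventually_sequentially using \<xi>(3) by (fastforce simp: dist_real_def)
  have L\<xi>: "L2_on ?I \<xi>" using \<xi>(1) by (rule L2_on_continuous)
  have lim: "(\<lambda>n. nsq (\<lambda>t. x (r n) t - \<xi> t)) \<longlonglongrightarrow> 0"
    using Lz L\<xi> l by (intro inner_on_uniform_limit ul) (auto intro!: L2_on_diff always_eventually)
  obtain \<eta> where \<eta>: "sol \<xi> \<eta>" using ex \<xi>(1) by blast
  obtain \<zeta> where \<zeta>: "sol \<eta> \<zeta>" using ex sol_continuous \<eta> by blast
  have invr: "(\<lambda>n. c / real (Suc (r n))) \<longlonglongrightarrow> 0" for c :: real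
    using LIMSEQ_subseq_LIMSEQ[OF tendsto_mult_left[OF LIMSEQ_inverse_real_of_nat, of c] \<xi>(2)]
    by (simp add: o_def divide_inverse)
  \<comment> \<open>Along the subsequence K^4 z is close to \<Lambda> K^2 z, because K^2 z -
    \<Lambda> z is small, and close to K^2 \<xi>, because K^2 z converges to \<xi>.\<close>
  have \<zeta>\<xi>: "\<zeta> t = \<Lambda> * \<xi> t" if t: "t \<in> ?I" for t
  proof -
    have 1: "(b k t - \<Lambda> * x k t)\<^sup>2 \<le> l / D * (\<Lambda> / real (Suc k))" for k
    proof -
      have s1: "sol (\<lambda>t. x k t - \<Lambda> * z k t) (\<lambda>t. a k t - \<Lambda> * y k t)"
        using a zy(3) by (intro sol_diff sol_cmult)
      have s2: "sol (\<lambda>t. a k t - \<Lambda> * y k t) (\<lambda>t. b k t - \<Lambda> * x k t)"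
        using b x by (intro sol_diff sol_cmult)
      have "(b k t - \<Lambda> * x k t)\<^sup>2 \<le> l / D * nsq (\<lambda>t. a k t - \<Lambda> * y k t)"
        using sol_sup[OF s2 t] .
      also have "\<dots> \<le> l / D * (\<Lambda> / real (Suc k))"
        using sol_norm[OF s1] resid[of k] l D by (intro mult_left_mono) auto
      finally show ?thesis .
    qed
    have "(\<lambda>n. (b (r n) t - \<Lambda> * x (r n) t)\<^sup>2) \<longlonglongrightarrow> 0"
      by (rule tendsto_sandwich[OF _ _ tendsto_const invr[of "l / D * \<Lambda>"]])
         (use 1 in \<open>auto intro!: always_eventually\<close>)
    then have A: "(\<lambda>n. b (r n) t - \<Lambda> * x (r n) t) \<longlonglongrightarrow> 0" by (simp add: power_tendsto_0_iff)
    have 2: "(b k t - \<zeta> t)\<^sup>2 \<le> l / D * nsq (\<lambda>t. x k t - \<xi> t)" for k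
    proof -
      have s1: "sol (\<lambda>t. x k t - \<xi> t) (\<lambda>t. a k t - \<eta> t)" using a \<eta> by (intro sol_diff)
      have s2: "sol (\<lambda>t. a k t - \<eta> t) (\<lambda>t. b k t - \<zeta> t)" using b \<zeta> by (intro sol_diff)
      have "(b k t - \<zeta> t)\<^sup>2 \<le> l / D * nsq (\<lambda>t. a k t - \<eta> t)"
        using sol_sup[OF s2 t] .
      also have "\<dots> \<le> l / D * nsq (\<lambda>t. x k t - \<xi> t)"
        using sol_norm[OF s1] l D by (intro mult_left_mono) auto
      finally show ?thesis .
    qed
    have "(\<lambda>n. (b (r n) t - \<zeta> t)\<^sup>2) \<longlonglongrightarrow> 0"
      by (rule tendsto_sandwich[OF _ _ tendsto_const tendsto_mult_right_zero[OF lim, of "l / D"]])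
         (use 2 in \<open>auto intro!: always_eventually\<close>)
    then have B: "(\<lambda>n. b (r n) t - \<zeta> t) \<longlonglongrightarrow> 0" by (simp add: power_tendsto_0_iff)
    have "(\<lambda>n. x (r n) t) \<longlonglongrightarrow> \<xi> t" using tendsto_uniform_limitI[OF ul t] .
    then have "(\<lambda>n. (b (r n) t - \<Lambda> * x (r n) t) - (b (r n) t - \<zeta> t) + \<Lambda> * x (r n) t) \<longlonglongrightarrow> 0 - 0 + \<Lambda> * \<xi> t"
      by (intro tendsto_intros A B)
    then have "(\<lambda>n. \<zeta> t) \<longlonglongrightarrow> \<Lambda> * \<xi> t" by simp
    then show ?thesis by (simp add: LIMSEQ_const_iff)
  qed
  have o\<xi>: "orth E \<xi>"
    unfolding orth_def
  proof (intro conjI ballI \<xi>(1))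
    fix e assume e: "e \<in> E"
    have Le: "L2_on ?I e" using Ec[OF e] by (rule L2_on_continuous)
    have "(ip \<xi> e)\<^sup>2 \<le> nsq (\<lambda>t. x (r n) t - \<xi> t) * ip e e" for n
    proof -
      have "ip (x (r n)) e = 0"
        using orth_sol[OF E orth_sol[OF E zy(1,3)] x] e by (auto simp: orth_def)
      then have "ip (\<lambda>t. x (r n) t - \<xi> t) e = - ip \<xi> e" using Lz L\<xi> Le by (simp add: inner_on_diff_left)
      then show ?thesis
        using inner_on_Cauchy_Schwarz[of ?I "\<lambda>t. x (r n) t - \<xi> t" e] Lz L\<xi> Le by (simp add: L2_on_diff)
    qed
    then have "(ip \<xi> e)\<^sup>2 \<le> 0"
      by (intro tendsto_lowerbound[OF tendsto_mult_left_zero[OF lim, of "ip e e"]]) (auto intro!: always_eventually)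
    then show "ip \<xi> e = 0" by simp
  qed
  \<comment> \<open>The limit is not zero: <K^2 z, z> = |K z|^2 tends to \<Lambda> > 0, which bounds
    |K^2 z| from below.\<close>
  have \<xi>0: "ip \<xi> \<xi> \<noteq> 0"
  proof
    assume 0: "ip \<xi> \<xi> = 0"
    have "nsq (x (r n)) \<le> nsq (\<lambda>t. x (r n) t - \<xi> t)" for n
    proof -
      have "(ip (x (r n)) \<xi>)\<^sup>2 \<le> 0" using inner_on_Cauchy_Schwarz[OF Lz(2) L\<xi>, of "r n"] 0 by simp
      then show ?thesis using inner_on_self_diff[OF Lz(2) L\<xi>, of "r n"] 0 by simp
    qed
    moreover have "(\<Lambda> - 1 / real (Suc (r n)))\<^sup>2 \<le> nsq (x (r n))" if "1 / real (Suc (r n)) < \<Lambda>" for n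
    proof -
      have "(\<Lambda> - 1 / real (Suc (r n)))\<^sup>2 \<le> (ip (x (r n)) (z (r n)))\<^sup>2"
        using that zy(4)[of "r n"] by (intro power_mono) (auto simp: xz)
      also have "\<dots> \<le> nsq (x (r n))"
        using inner_on_Cauchy_Schwarz[OF Lz(2,1), of "r n" "r n"] zy(2) by simp
      finally show ?thesis .
    qed
    moreover have "\<forall>\<^sub>F n in sequentially. 1 / real (Suc (r n)) < \<Lambda>"
      using order_tendstoD(2)[OF invr \<Lambda>0] .
    ultimately have ev: "\<forall>\<^sub>F n in sequentially. (\<Lambda> - 1 / real (Suc (r n)))\<^sup>2 \<le> nsq (\<lambda>t. x (r n) t - \<xi> t)"
      by (auto elim!: eventually_mono intro: order_trans)
    have "(\<lambda>n. (\<Lambda> - 1 / real (Suc (r n)))\<^sup>2) \<longlonglongrightarrow> (\<Lambda> - 0)\<^sup>2"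
      by (intro tendsto_intros invr)
    from tendsto_le[OF sequentially_bot lim this ev] have "(\<Lambda> - 0)\<^sup>2 \<le> 0" .
    with \<Lambda>0 show False by simp
  qed
  define m where "m = sqrt \<Lambda>"
  have m: "m > 0" "m * m = \<Lambda>" using \<Lambda>0 by (auto simp: m_def)
  define w where "w t = \<eta> t + m * \<xi> t" for t
  \<comment> \<open>K \<eta> = \<Lambda> \<xi> with \<Lambda> = m^2, so K w = m w; in terms of
    \<open>sol\<close> the factor becomes 1 / m.\<close>
  have "sol \<eta> (\<lambda>t. \<Lambda> * \<xi> t)" using sol_cong[OF \<zeta> refl] \<zeta>\<xi> by simp
  from sol_add[OF this sol_cmult[OF \<eta>, of m]]
  have "sol w (\<lambda>t. m * w t)"
    unfolding w_def by (simp add: m(2)[symmetric] distrib_left mult.assoc add.commute)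
  from sol_cong[OF sol_cmult[OF this, of "1 / m"] refl] m(1)
  have solw: "sol (\<lambda>t. 1 / m * w t) w" by simp
  have "orth E w"
    unfolding w_def using orth_lincomb[OF orth_sol[OF E o\<xi> \<eta>] o\<xi> Ec, of 1 m] by simp
  moreover have "\<exists>t\<in>?I. w t \<noteq> 0"
  proof (rule ccontr)
    assume "\<not> ?thesis"
    then have "ip w \<xi> = ip (\<lambda>_. 0) \<xi>" by (intro inner_on_cong) auto
    then have "ip w \<xi> = 0" by (simp add: inner_on_def)
    moreover have "ip w \<xi> = ip \<eta> \<xi> + m * ip \<xi> \<xi>"
      unfolding w_def using L\<xi> sol_L2[OF \<eta>] by (simp add: inner_on_add_left L2_on_cmult inner_on_cmult_left)
    moreover have "0 \<le> ip \<eta> \<xi>"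
      using sol_pos[OF \<eta>] inner_on_self_nonneg[of ?I \<eta>] inner_on_commute[of ?I \<eta> \<xi>] by simp
    moreover have "m * ip \<xi> \<xi> > 0"
      using \<xi>0 inner_on_self_nonneg[of ?I \<xi>] m(1) by (intro mult_pos_pos) auto
    ultimately show False by linarith
  qed
  ultimately show ?thesis using solw by blast
qed

end

section \<open>Density of the range of the solution operator\<close>

lemma L2_tendsto_zero_dominated:
  assumes f: "L2_on S w" and F: "\<And>n::nat. F n \<in> borel_measurable (lebesgue_on S)"
    and lim: "AE x in lebesgue_on S. (\<lambda>n. F n x) \<longlonglongrightarrow> 0"
    and b: "\<And>n x. x \<in> S \<Longrightarrow> \<bar>F n x\<bar> \<le> \<bar>w x\<bar>"
  shows "(\<lambda>n. norm2_on S (F n)) \<longlonglongrightarrow> 0"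
proof -
  have "(\<lambda>n. LINT x|lebesgue_on S. (F n x)\<^sup>2) \<longlonglongrightarrow> (LINT x|lebesgue_on S. 0)"
  proof (rule integral_dominated_convergence[where w="\<lambda>x. (w x)\<^sup>2"])
    show "AE x in lebesgue_on S. (\<lambda>n. (F n x)\<^sup>2) \<longlonglongrightarrow> 0"
      using lim by eventually_elim (auto intro: tendsto_eq_intros)
    show "AE x in lebesgue_on S. norm ((F n x)\<^sup>2) \<le> (w x)\<^sup>2" for n
      using b by (intro AE_I2) (auto simp: abs_le_square_iff[symmetric])
  qed (use F L2_onD[OF f] in auto)
  then show ?thesis by (simp add: inner_on_self)
qed

text \<open>The approximant carries the factor x (l - x), so that the zero boundary values survive
  when \<open>v\<close> is replaced by a polynomial. Truncating \<open>f\<close> first supplies a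
  constant dominating function for the continuous approximations \<open>g n\<close>, of which only
  almost everywhere convergence is known.\<close>

lemma L2_approx_vanishing_at_ends:
  assumes f: "L2_on {0..l} f" and e: "e > 0" and l: "0 < l"
  obtains v where "continuous_on UNIV v"
    "norm2_on {0..l} (\<lambda>x. f x - x * (l - x) * v x) < e"
proof -
  let ?I = "{0..l}"
  define cl where "cl k y = max (- real k) (min (real k) y)" for k :: nat and y :: real
  have cl_le: "\<bar>cl k y\<bar> \<le> real k" for k y by (auto simp: cl_def)
  have cl_diff: "\<bar>y - cl k y\<bar> \<le> \<bar>y\<bar>" for k y by (auto simp: cl_def)
  have cl_eq: "cl k y = y" if "\<bar>y\<bar> \<le> real k" for k y using that by (auto simp: cl_def)
  have fm: "f \<in> borel_measurable (lebesgue_on ?I)" using L2_onD f by blast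
  have clm: "(\<lambda>x. cl k (f x)) \<in> borel_measurable (lebesgue_on ?I)" for k
    unfolding cl_def using fm by measurable
  have "(\<lambda>k. norm2_on ?I (\<lambda>x. f x - cl k (f x))) \<longlonglongrightarrow> 0"
  proof (rule L2_tendsto_zero_dominated[OF f])
    show "AE x in lebesgue_on ?I. (\<lambda>k. f x - cl k (f x)) \<longlonglongrightarrow> 0"
    proof (intro AE_I2 tendsto_eventually)
      fix x
      obtain k0 :: nat where k0: "\<bar>f x\<bar> \<le> real k0" using real_arch_simple by blast
      then have "\<forall>k\<ge>k0. \<bar>f x\<bar> \<le> real k" by auto
      then show "\<forall>\<^sub>F k in sequentially. f x - cl k (f x) = 0"
        unfolding eventually_sequentially using cl_eq by (intro exI[of _ k0]) auto
    qed
  qed (use fm clm cl_diff in auto)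
  then have "\<forall>\<^sub>F k in sequentially. norm2_on ?I (\<lambda>x. f x - cl k (f x)) < e / 4"
    using e by (intro order_tendstoD) auto
  then obtain k where k: "norm2_on ?I (\<lambda>x. f x - cl k (f x)) < e / 4"
    by (auto simp: eventually_sequentially)
  have "f measurable_on ?I" using fm by (simp add: measurable_on_iff_borel_measurable)
  then obtain N g where N: "negligible N" and gc: "\<And>n. continuous_on UNIV (g n)"
    and g: "\<And>x. x \<notin> N \<Longrightarrow> (\<lambda>n. g n x) \<longlonglongrightarrow> (if x \<in> ?I then f x else 0)"
    unfolding measurable_on_def by blast
  \<comment> \<open>x (l - x) times \<open>v n\<close> is the truncated \<open>g n\<close> times min
    (1, n x (l - x)), a cut-off that equals 1 away from the endpoints; the maximum keeps the
    denominator at least 1, hence \<open>v n\<close> continuous everywhere.\<close>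
  define v where "v n x = cl k (g n x) * real n / max 1 (real n * (x * (l - x)))" for n x
  have vc: "continuous_on UNIV (v n)" for n
    unfolding v_def cl_def using gc[of n]
    by (intro continuous_intros continuous_on_subset[OF gc[of n]]) auto
  have vm: "(\<lambda>x. cl k (f x) - x * (l - x) * v n x) \<in> borel_measurable (lebesgue_on ?I)" for n
  proof -
    have "continuous_on ?I (\<lambda>x. x * (l - x) * v n x)"
      using continuous_on_subset[OF vc subset_UNIV] by (intro continuous_intros)
    from L2_onD(1)[OF L2_on_continuous[OF this]] show ?thesis using clm by simp
  qed
  have frac: "\<bar>y * real n / max 1 (real n * y)\<bar> \<le> 1" if "0 \<le> y" for y n
    using that by (auto simp: field_simps max_def)
  have vb: "\<bar>x * (l - x) * v n x\<bar> \<le> real k" if "x \<in> ?I" for x n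
  proof -
    have "\<bar>x * (l - x) * v n x\<bar> = \<bar>cl k (g n x)\<bar> * \<bar>(x * (l - x)) * real n / max 1 (real n * (x * (l - x)))\<bar>"
      by (simp add: v_def abs_mult)
    also have "\<dots> \<le> real k * 1" using that by (intro mult_mono cl_le frac) auto
    finally show ?thesis by simp
  qed
  have "(\<lambda>n. norm2_on ?I (\<lambda>x. cl k (f x) - x * (l - x) * v n x)) \<longlonglongrightarrow> 0"
  proof (rule L2_tendsto_zero_dominated[of _ "\<lambda>_. 2 * real k"])
    have "AE x in lebesgue. x \<notin> N \<union> {0, l}"
      using N by (intro AE_not_in) (simp add: negligible_iff_null_sets[symmetric])
    then have "AE x in lebesgue_on ?I. x \<notin> N \<union> {0, l}"
      by (auto simp: AE_restrict_space_iff elim: eventually_mono)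
    moreover have "AE x in lebesgue_on ?I. x \<in> ?I" by (intro AE_I2) auto
    ultimately show "AE x in lebesgue_on ?I. (\<lambda>n. cl k (f x) - x * (l - x) * v n x) \<longlonglongrightarrow> 0"
    proof eventually_elim
      case (elim x)
      then have y: "x * (l - x) > 0" by auto
      have "(\<lambda>n. cl k (f x) - cl k (g n x)) \<longlonglongrightarrow> cl k (f x) - cl k (f x)"
        unfolding cl_def using g[of x] elim by (intro tendsto_intros) auto
      moreover have "\<forall>\<^sub>F n in sequentially. cl k (f x) - cl k (g n x) = cl k (f x) - x * (l - x) * v n x"
      proof -
        obtain n0 :: nat where n0: "1 / (x * (l - x)) \<le> real n0" using real_arch_simple by blast
        have "cl k (f x) - cl k (g n x) = cl k (f x) - x * (l - x) * v n x" if "n \<ge> n0" for n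
        proof -
          have "1 / (x * (l - x)) \<le> real n" using n0 that by (meson of_nat_mono order_trans)
          then have 1: "1 \<le> real n * (x * (l - x))" using y by (simp add: pos_divide_le_eq)
          then have "real n * (x * (l - x)) \<noteq> 0" by linarith
          then have "x * (l - x) * (c * real n / (real n * (x * (l - x)))) = c" for c
            by (simp add: field_simps)
          then show ?thesis using 1 by (simp add: v_def max_def)
        qed
        then show ?thesis unfolding eventually_sequentially by blast
      qed
      ultimately show ?case by (simp add: filterlim_cong[OF refl refl])
    qed
    show "\<bar>cl k (f x) - x * (l - x) * v n x\<bar> \<le> \<bar>2 * real k\<bar>" if "x \<in> ?I" for n x
      using vb[OF that, of n] cl_le[of k "f x"] by linarith
  qed (use vm in \<open>auto intro!: L2_on_continuous\<close>)
  then have "\<forall>\<^sub>F n in sequentially. norm2_on ?I (\<lambda>x. cl k (f x) - x * (l - x) * v n x) < e / 4"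
    using e by (intro order_tendstoD) auto
  then obtain n where n: "norm2_on ?I (\<lambda>x. cl k (f x) - x * (l - x) * v n x) < e / 4"
    by (auto simp: eventually_sequentially)
  have Lv: "L2_on ?I (\<lambda>x. x * (l - x) * v n x)"
    using continuous_on_subset[OF vc] by (intro L2_on_continuous continuous_intros) auto
  have Lcl: "L2_on ?I (\<lambda>x. cl k (f x))"
    unfolding L2_on_def
  proof (intro conjI clm)
    show "integrable (lebesgue_on ?I) (\<lambda>x. (cl k (f x))\<^sup>2)"
    proof (rule Bochner_Integration.integrable_bound)
      show "integrable (lebesgue_on ?I) (\<lambda>x. (real k)\<^sup>2)" by (auto intro: continuous_imp_integrable_real)
      show "AE x in lebesgue_on ?I. norm ((cl k (f x))\<^sup>2) \<le> norm ((real k)\<^sup>2)"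
        using cl_le by (intro AE_I2) (auto simp: abs_le_square_iff[symmetric])
    qed (use clm in auto)
  qed
  have "norm2_on ?I (\<lambda>x. f x - x * (l - x) * v n x)
      = norm2_on ?I (\<lambda>x. (f x - cl k (f x)) + (cl k (f x) - x * (l - x) * v n x))" by simp
  also have "\<dots> \<le> 2 * norm2_on ?I (\<lambda>x. f x - cl k (f x))
      + 2 * norm2_on ?I (\<lambda>x. cl k (f x) - x * (l - x) * v n x)"
    using f Lcl Lv by (intro inner_on_self_add_le L2_on_diff)
  also have "\<dots> < e" using k n by simp
  finally show thesis using that vc by blast
qed

text \<open>For a polynomial \<open>r\<close> close to \<open>v\<close>, h = x (l - x) r is smooth
  and vanishes at both ends, hence is the solution for the right-hand side p h - D h''.\<close>

lemma (in dirichlet_bvp) sol_dense: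
  assumes f: "L2_on {0..l} f" and e: "e > 0"
  obtains \<phi> h where "sol \<phi> h" "nsq (\<lambda>x. f x - h x) < e"
proof -
  let ?I = "{0..l}"
  have e4: "e / 4 > 0" using e by simp
  obtain v where v: "continuous_on UNIV v"
    "nsq (\<lambda>x. f x - x * (l - x) * v x) < e / 4"
    using L2_approx_vanishing_at_ends[OF f e4 l] by blast
  \<comment> \<open>Chosen so that (l^2 d)^2 l is less than e / 4, where l^2 d bounds x (l - x) |v -
    r|.\<close>
  define d where "d = sqrt (e / (8 * (l + 1))) / (l * l)"
  have d: "d > 0" using e l by (simp add: d_def)
  have d2: "(l * l * d)\<^sup>2 * l < e / 4"
  proof -
    have "(l * l * d)\<^sup>2 * l = e / 8 * (l / (l + 1))" using e l by (simp add: d_def)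
    also have "\<dots> \<le> e / 8 * 1" using e l by (intro mult_left_mono) auto
    also have "\<dots> < e / 4" using e by simp
    finally show ?thesis .
  qed
  obtain r where r: "real_polynomial_function r" "\<And>x. x \<in> ?I \<Longrightarrow> \<bar>v x - r x\<bar> < d"
    using Stone_Weierstrass_real_polynomial_function[OF compact_Icc continuous_on_subset[OF v(1)] d] by blast
  obtain r1 where r1: "real_polynomial_function r1" "\<And>x. (r has_real_derivative r1 x) (at x)"
    using has_real_derivative_polynomial_function[OF r(1)] by blast
  obtain r2 where r2: "real_polynomial_function r2" "\<And>x. (r1 has_real_derivative r2 x) (at x)"
    using has_real_derivative_polynomial_function[OF r1(1)] by blast
  have rc: "continuous_on ?I r" "continuous_on ?I r1" "continuous_on ?I r2"
    using continuous_real_polymonial_function r(1) r1(1) r2(1)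
    by (blast intro: continuous_at_imp_continuous_on)+
  define h where "h x = x * (l - x) * r x" for x
  define h1 where "h1 x = (l - 2 * x) * r x + x * (l - x) * r1 x" for x
  define h2 where "h2 x = - 2 * r x + 2 * (l - 2 * x) * r1 x + x * (l - x) * r2 x" for x
  have dh: "(h has_real_derivative h1 x) (at x within ?I)" "(h1 has_real_derivative h2 x) (at x within ?I)" for x
  proof -
    note [derivative_intros] = DERIV_subset[OF r1(2)[of x] subset_UNIV] DERIV_subset[OF r2(2)[of x] subset_UNIV]
    show "(h has_real_derivative h1 x) (at x within ?I)"
      unfolding h_def h1_def by (rule derivative_eq_intros refl)+ (simp add: algebra_simps)
    show "(h1 has_real_derivative h2 x) (at x within ?I)"
      unfolding h1_def h2_def by (rule derivative_eq_intros refl)+ (simp add: algebra_simps)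
  qed
  have "bvp (\<lambda>x. p x * h x - D * h2 x) h h1"
    unfolding bvp_def
  proof (intro conjI ballI)
    show "continuous_on ?I (\<lambda>x. p x * h x - D * h2 x)"
      unfolding h_def h2_def
      by (intro continuous_on_diff continuous_on_add continuous_on_mult continuous_on_const
          continuous_on_id cont_p rc)
    show "(h1 has_real_derivative (p x * h x - (p x * h x - D * h2 x)) / D) (at x within ?I)" for x
      using dh(2)[of x] D by simp
  qed (simp_all add: dh, simp_all add: h_def)
  then have s: "sol (\<lambda>x. p x * h x - D * h2 x) h" by (auto simp: sol_def)
  have Lh: "L2_on ?I h" using sol_L2 s by blast
  have Lv: "L2_on ?I (\<lambda>x. x * (l - x) * v x)"
    using continuous_on_subset[OF v(1)] by (intro L2_on_continuous continuous_intros) auto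
  have "nsq (\<lambda>x. x * (l - x) * v x - h x) \<le> (l * l * d)\<^sup>2 * l"
  proof (intro inner_on_self_le_const L2_on_diff Lv Lh)
    fix x assume x: "x \<in> ?I"
    have "\<bar>x * (l - x) * v x - h x\<bar> = \<bar>x\<bar> * \<bar>l - x\<bar> * \<bar>v x - r x\<bar>"
      by (simp add: h_def right_diff_distrib abs_mult flip: abs_mult)
    also have "\<dots> \<le> l * l * d" using x r(2)[OF x] by (intro mult_mono) auto
    finally show "\<bar>x * (l - x) * v x - h x\<bar> \<le> l * l * d" .
  qed (use l in auto)
  then have 2: "nsq (\<lambda>x. x * (l - x) * v x - h x) < e / 4"
    using d2 by linarith
  have "nsq (\<lambda>x. f x - h x)
      = nsq (\<lambda>x. (f x - x * (l - x) * v x) + (x * (l - x) * v x - h x))" by simp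
  also have "\<dots> \<le> 2 * nsq (\<lambda>x. f x - x * (l - x) * v x)
      + 2 * nsq (\<lambda>x. x * (l - x) * v x - h x)"
    using f Lh Lv by (intro inner_on_self_add_le L2_on_diff)
  also have "\<dots> < e" using v(2) 2 by simp
  finally show thesis using that s by blast
qed

text \<open>\<open>sl_eigenpair\<close> asks for derivatives only inside the interval. The equation
  expresses h'' through the continuous function \<open>h\<close>, so integrating it twice from 0
  extends h' and the equation to the endpoints.\<close>

lemma sl_eigenpair_regular:
  assumes D: "D > 0" and l: "l > 0" and q: "continuous_on {0..l} q" and h: "sl_eigenpair D q l s h"
  obtains h1 where "\<And>x. x \<in> {0..l} \<Longrightarrow> (h has_real_derivative h1 x) (at x within {0..l})"
    "\<And>x. x \<in> {0..l} \<Longrightarrow> (h1 has_real_derivative (s - q x) / D * h x) (at x within {0..l})"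
proof -
  let ?I = "{0..l}"
  have hc: "continuous_on ?I h" using h by (simp add: sl_eigenpair_def)
  obtain h' h'' where d: "\<And>x. x \<in> {0<..<l} \<Longrightarrow> (h has_real_derivative h' x) (at x)"
    "\<And>x. x \<in> {0<..<l} \<Longrightarrow> (h' has_real_derivative h'' x) (at x)"
    "\<And>x. x \<in> {0<..<l} \<Longrightarrow> s * h x = D * h'' x + q x * h x"
    using h unfolding sl_eigenpair_def by blast
  define r where "r x = (s - q x) / D * h x" for x
  have rc: "continuous_on ?I r" unfolding r_def using q hc D by (auto intro!: continuous_intros)
  have h''r: "h'' x = r x" if "x \<in> {0<..<l}" for x
    using d(3)[OF that] D by (simp add: r_def field_simps)
  define R where "R x = integral {0..x} r" for x
  have dR: "(R has_real_derivative r x) (at x within ?I)" if "x \<in> ?I" for x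
    unfolding R_def by (rule indefinite_integral_derivative[OF rc that])
  have at: "at x within ?I = at x" if "x \<in> {0<..<l}" for x
    using that by (intro at_within_interior) (simp add: interior_atLeastAtMost_real)
  have "((\<lambda>x. h' x - R x) has_real_derivative 0) (at x within {0<..<l})" if x: "x \<in> {0<..<l}" for x
  proof -
    have "(R has_real_derivative r x) (at x)" using dR[of x] x at[OF x] by simp
    from DERIV_diff[OF d(2)[OF x] this] h''r[OF x] show ?thesis
      by (simp add: has_field_derivative_at_within)
  qed
  then obtain c where c: "\<And>x. x \<in> {0<..<l} \<Longrightarrow> h' x - R x = c"
    using has_field_derivative_zero_constant[of "{0<..<l}" "\<lambda>x. h' x - R x"] by auto
  define h1 where "h1 x = c + R x" for x
  have dh1: "(h1 has_real_derivative r x) (at x within ?I)" if "x \<in> ?I" for x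
    unfolding h1_def using DERIV_add[OF DERIV_const dR[OF that]] by simp
  have h1c: "continuous_on ?I h1" using dh1 by (rule derivative_continuous_on)
  define H where "H x = integral {0..x} h1" for x
  have dH: "(H has_real_derivative h1 x) (at x within ?I)" if "x \<in> ?I" for x
    unfolding H_def by (rule indefinite_integral_derivative[OF h1c that])
  have Hc: "continuous_on ?I H" using dH by (rule derivative_continuous_on)
  have const: "h x - H x = h 0 - H 0" if x: "x \<in> ?I" for x
  proof (cases "x = 0")
    case False
    then have "0 < x" using x by auto
    then show ?thesis
    proof (rule DERIV_isconst2[of 0 x "\<lambda>x. h x - H x"])
      show "continuous_on {0..x} (\<lambda>x. h x - H x)"
        using hc Hc x by (intro continuous_on_diff) (auto elim: continuous_on_subset)
      fix y assume "0 < y" "y < x"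
      then have y: "y \<in> {0<..<l}" using x by auto
      show "((\<lambda>x. h x - H x) has_real_derivative 0) (at y)"
      proof -
        have "(H has_real_derivative h1 y) (at y)" using dH[of y] y at[OF y] by simp
        moreover have "h' y - h1 y = 0" using c[OF y] by (simp add: h1_def)
        ultimately show ?thesis using DERIV_diff[OF d(1)[OF y]] by metis
      qed
    qed (use x False in auto)
  qed simp
  have "(h has_real_derivative h1 x) (at x within ?I)" if x: "x \<in> ?I" for x
  proof (rule has_field_derivative_transform[OF x, of h "\<lambda>x. H x + (h 0 - H 0)"])
    show "h y = H y + (h 0 - H 0)" if "y \<in> ?I" for y using const[OF that] by simp
    show "((\<lambda>x. H x + (h 0 - H 0)) has_real_derivative h1 x) (at x within ?I)"
      using DERIV_add[OF dH[OF x] DERIV_const] by simp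
  qed
  with dh1 show thesis using that unfolding r_def by blast
qed

section \<open>Eigenfunction expansions\<close>

locale sl_system =
  fixes D l :: real and q :: "real \<Rightarrow> real" and \<sigma> :: "nat \<Rightarrow> real" and g :: "nat \<Rightarrow> real \<Rightarrow> real"
  assumes D_pos: "D > 0" and l_pos: "l > 0" and cont_q: "continuous_on {0..l} q"
    and eigensystem: "sl_eigensystem D q l \<sigma> g"
begin

text \<open>The summand 1 provides the normalisation p >= 1 of \<open>dirichlet_bvp\<close>.\<close>

definition \<mu> :: real where "\<mu> = 1 + Sup (q ` {0..l})"

lemma q_le: "x \<in> {0..l} \<Longrightarrow> q x \<le> \<mu> - 1"
  unfolding \<mu>_def using compact_continuous_image[OF cont_q compact_Icc]
  by (simp add: cSup_upper bounded_imp_bdd_above compact_imp_bounded)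

sublocale dirichlet_bvp D l "\<lambda>x. \<mu> - q x"
  using D_pos l_pos q_le by unfold_locales (auto intro!: continuous_intros cont_q, smt (verit) atLeastAtMost_iff q_le)

text \<open>For \<open>n \<ge> 1\<close>, the reciprocal of the n-th eigenvalue of the solution
  operator.\<close>

definition \<kappa> :: "nat \<Rightarrow> real" where "\<kappa> n = \<mu> - \<sigma> n"

definition nrm :: "nat \<Rightarrow> real" where "nrm n = sqrt (nsq (g n))"

text \<open>\<open>sl_eigensystem\<close> fixes no normalisation; the divisor \<open>nrm n\<close>
  reappears in the coefficients of the final expansion.\<close>

definition e :: "nat \<Rightarrow> real \<Rightarrow> real" where "e n x = g n x / nrm n"

lemma eigenpair: "n \<ge> 1 \<Longrightarrow> sl_eigenpair D q l (\<sigma> n) (g n)"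
  using eigensystem by (simp add: sl_eigensystem_def)

text \<open>The eigenvalue equation reads (\<mu> - q) h - D h'' = (\<mu> - s) h, and regularity up
  to the endpoints makes it a case of \<open>bvp\<close>.\<close>

lemma sol_of_eigenpair:
  assumes "sl_eigenpair D q l s h"
  shows "sol (\<lambda>x. (\<mu> - s) * h x) h"
proof -
  obtain h1 where h1: "\<And>x. x \<in> {0..l} \<Longrightarrow> (h has_real_derivative h1 x) (at x within {0..l})"
    "\<And>x. x \<in> {0..l} \<Longrightarrow> (h1 has_real_derivative (s - q x) / D * h x) (at x within {0..l})"
    using sl_eigenpair_regular[OF D_pos l_pos cont_q assms] by blast
  have "bvp (\<lambda>x. (\<mu> - s) * h x) h h1"
    unfolding bvp_def
  proof (intro conjI ballI)
    show "continuous_on {0..l} (\<lambda>x. (\<mu> - s) * h x)" "h 0 = 0" "h l = 0"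
      using assms by (auto simp: sl_eigenpair_def intro!: continuous_intros)
    fix x assume x: "x \<in> {0..l}"
    show "(h has_real_derivative h1 x) (at x within {0..l})" using h1 x by blast
    have "(s - q x) / D * h x = ((\<mu> - q x) * h x - (\<mu> - s) * h x) / D"
      by (simp add: left_diff_distrib)
    then show "(h1 has_real_derivative ((\<mu> - q x) * h x - (\<mu> - s) * h x) / D) (at x within {0..l})"
      using h1(2)[OF x] by metis
  qed
  then show ?thesis by (auto simp: sol_def)
qed

lemma eigenpair_of_sol:
  assumes "sol (\<lambda>x. k * w x) w" "\<exists>x\<in>{0..l}. w x \<noteq> 0"
  shows "sl_eigenpair D q l (\<mu> - k) w"
proof -
  obtain w' where b: "bvp (\<lambda>x. k * w x) w w'" using assms by (auto simp: sol_def)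
  have at: "at x within {0..l} = at x" if "x \<in> {0<..<l}" for x
    using that by (intro at_within_interior) (simp add: interior_atLeastAtMost_real)
  have ode: "\<forall>x\<in>{0<..<l}. (w has_real_derivative w' x) (at x) \<and>
        (w' has_real_derivative ((\<mu> - q x) * w x - k * w x) / D) (at x) \<and>
        (\<mu> - k) * w x = D * (((\<mu> - q x) * w x - k * w x) / D) + q x * w x"
  proof
    fix x assume x: "x \<in> {0<..<l}"
    then have "x \<in> {0..l}" by auto
    then have "(w has_real_derivative w' x) (at x within {0..l})"
      "(w' has_real_derivative ((\<mu> - q x) * w x - k * w x) / D) (at x within {0..l})"
      using b by (auto simp: bvp_def)
    with at[OF x] D_pos show "(w has_real_derivative w' x) (at x) \<and>
        (w' has_real_derivative ((\<mu> - q x) * w x - k * w x) / D) (at x) \<and>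
        (\<mu> - k) * w x = D * (((\<mu> - q x) * w x - k * w x) / D) + q x * w x"
      by (simp add: left_diff_distrib)
  qed
  show ?thesis
    unfolding sl_eigenpair_def
  proof (intro conjI)
    show "continuous_on {0..l} w" "w 0 = 0" "w l = 0"
      using b bvp_continuous[OF b] by (auto simp: bvp_def)
  qed (rule assms(2), rule exI[of _ w'], rule exI[of _ "\<lambda>x. ((\<mu> - q x) * w x - k * w x) / D"], rule ode)
qed

section \<open>The orthonormal system of eigenfunctions and its Bessel inequalities\<close>

lemma sol_g: "n \<ge> 1 \<Longrightarrow> sol (\<lambda>x. \<kappa> n * g n x) (g n)"
  unfolding \<kappa>_def by (intro sol_of_eigenpair eigenpair)

lemma g_nonzero: "n \<ge> 1 \<Longrightarrow> \<exists>x\<in>{0..l}. g n x \<noteq> 0"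
  using eigenpair by (auto simp: sl_eigenpair_def)

lemma nrm_pos: assumes "n \<ge> 1" shows "nrm n > 0"
proof -
  have "nsq (g n) \<noteq> 0"
    using inner_on_self_eq_0D[OF sol_continuous(2)[OF sol_g[OF assms]] l_pos] g_nonzero[OF assms] by blast
  then show ?thesis using inner_on_self_nonneg[of "{0..l}" "g n"] by (simp add: nrm_def)
qed

lemma sol_e: "n \<ge> 1 \<Longrightarrow> sol (\<lambda>x. \<kappa> n * e n x) (e n)"
  using sol_cmult[OF sol_g, of n "1 / nrm n"] by (simp add: e_def[abs_def])

lemma e_continuous: "n \<ge> 1 \<Longrightarrow> continuous_on {0..l} (e n)"
  using sol_e sol_continuous by blast

lemma e_L2: "n \<ge> 1 \<Longrightarrow> L2_on {0..l} (e n)"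
  using sol_e sol_L2 by blast

lemma e_norm: assumes "n \<ge> 1" shows "nsq (e n) = 1"
proof -
  have "nsq (e n) = 1 / nrm n * (1 / nrm n * nsq (g n))"
    unfolding inner_on_cmult_left[symmetric] inner_on_cmult_right[symmetric]
    by (simp add: e_def[abs_def] inner_on_def)
  also have "\<dots> = 1"
    using nrm_pos[OF assms] inner_on_self_nonneg[of "{0..l}" "g n"]
    by (simp add: nrm_def)
  finally show ?thesis .
qed

text \<open>Positivity of the solution operator, tested on a unit eigenfunction.\<close>

lemma \<kappa>_ge_1: assumes "n \<ge> 1" shows "\<kappa> n \<ge> 1"
  using sol_pos[OF sol_e[OF assms]] e_norm[OF assms] by (simp add: inner_on_cmult_left)

lemma e_orthogonal: assumes "m \<ge> 1" "n \<ge> 1" "m \<noteq> n" shows "ip (e m) (e n) = 0"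
proof -
  have "\<kappa> m * ip (e m) (e n) = \<kappa> n * ip (e m) (e n)"
    using sol_sym[OF sol_e[OF assms(1)] sol_e[OF assms(2)]]
    by (simp add: inner_on_cmult_left inner_on_cmult_right)
  moreover have "\<kappa> m \<noteq> \<kappa> n"
    using eigensystem assms by (auto simp: sl_eigensystem_def inj_on_def \<kappa>_def)
  ultimately show ?thesis by simp
qed

lemma e_orthonormal:
  "m \<ge> 1 \<Longrightarrow> n \<ge> 1 \<Longrightarrow> ip (e m) (e n) = (if m = n then 1 else 0)"
  by (simp add: e_norm e_orthogonal)

lemma ip_sum_e:
  assumes "finite I" "I \<subseteq> {1..}" "n \<ge> 1"
  shows "ip (\<lambda>x. \<Sum>i\<in>I. c i * e i x) (e n) = (if n \<in> I then c n else 0)"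
proof -
  have "ip (\<lambda>x. \<Sum>i\<in>I. c i * e i x) (e n) = (\<Sum>i\<in>I. c i * ip (e i) (e n))"
    using assms by (intro inner_on_lincomb_left e_L2) auto
  also have "\<dots> = (\<Sum>i\<in>I. if i = n then c i else 0)"
    using assms by (intro sum.cong refl) (auto simp: e_orthonormal subset_iff)
  finally show ?thesis using assms(1) by simp
qed

lemma sum_e_L2: "I \<subseteq> {1..} \<Longrightarrow> L2_on {0..l} (\<lambda>x. \<Sum>i\<in>I. c i * e i x)"
  by (intro L2_on_sum L2_on_cmult e_L2) auto

lemma norm_sum_e:
  assumes "finite I" "I \<subseteq> {1..}"
  shows "nsq (\<lambda>x. \<Sum>i\<in>I. c i * e i x) = (\<Sum>i\<in>I. (c i)\<^sup>2)"
proof -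
  have "nsq (\<lambda>x. \<Sum>i\<in>I. c i * e i x)
      = (\<Sum>i\<in>I. c i * ip (e i) (\<lambda>x. \<Sum>i\<in>I. c i * e i x))"
    using assms by (intro inner_on_lincomb_left e_L2 sum_e_L2) auto
  also have "\<dots> = (\<Sum>i\<in>I. (c i)\<^sup>2)"
    using assms by (intro sum.cong refl)
      (auto simp: inner_on_commute[of _ "e _"] ip_sum_e power2_eq_square subset_iff)
  finally show ?thesis .
qed

definition coef :: "(real \<Rightarrow> real) \<Rightarrow> nat \<Rightarrow> real" where "coef f n = ip f (e n)"

text \<open>Completing the square. The choice \<open>c = coef f\<close> gives Bessel's inequality,
  and comparison with any other choice shows that it is the best approximation, as
  \<open>expansion\<close> requires.\<close>

lemma norm_diff_sum_e:
  assumes f: "L2_on {0..l} f" and I: "finite I" "I \<subseteq> {1..}"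
  shows "nsq (\<lambda>x. f x - (\<Sum>i\<in>I. c i * e i x))
    = ip f f - (\<Sum>i\<in>I. (coef f i)\<^sup>2) + (\<Sum>i\<in>I. (c i - coef f i)\<^sup>2)"
proof -
  have "ip f (\<lambda>x. \<Sum>i\<in>I. c i * e i x) = (\<Sum>i\<in>I. c i * ip (e i) f)"
    unfolding inner_on_commute[of _ f] using I by (intro inner_on_lincomb_left f e_L2) auto
  also have "\<dots> = (\<Sum>i\<in>I. c i * coef f i)" by (simp add: coef_def inner_on_commute)
  finally have 1: "ip f (\<lambda>x. \<Sum>i\<in>I. c i * e i x) = (\<Sum>i\<in>I. c i * coef f i)" .
  have "- 2 * (\<Sum>i\<in>I. c i * coef f i) + (\<Sum>i\<in>I. (c i)\<^sup>2)
      = - (\<Sum>i\<in>I. (coef f i)\<^sup>2) + (\<Sum>i\<in>I. (c i - coef f i)\<^sup>2)"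
    by (simp add: power2_diff sum.distrib sum_negf sum_subtractf sum_distrib_left mult.assoc)
  then show ?thesis
    using inner_on_self_diff[OF f sum_e_L2[OF I(2), of c]] norm_sum_e[OF I, of c] 1 by simp
qed

lemma bessel:
  assumes f: "L2_on {0..l} f" and I: "finite I" "I \<subseteq> {1..}"
  shows "(\<Sum>i\<in>I. (coef f i)\<^sup>2) \<le> ip f f"
  using norm_diff_sum_e[OF assms, of "coef f"]
    inner_on_self_nonneg[of "{0..l}" "\<lambda>x. f x - (\<Sum>i\<in>I. coef f i * e i x)"] by simp

lemma summable_coef_sq:
  assumes "L2_on {0..l} f"
  shows "summable (\<lambda>n. (coef f (Suc n))\<^sup>2)"
proof (rule summableI_nonneg_bounded)
  fix N
  have "(\<Sum>n<N. (coef f (Suc n))\<^sup>2) = (\<Sum>i\<in>Suc ` {..<N}. (coef f i)\<^sup>2)"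
    by (simp add: sum.reindex)
  also have "\<dots> \<le> ip f f" using assms by (intro bessel) auto
  finally show "(\<Sum>n<N. (coef f (Suc n))\<^sup>2) \<le> ip f f" .
qed simp

lemma sol_sum_e:
  assumes "finite I" "I \<subseteq> {1..}"
  shows "sol (\<lambda>x. \<Sum>i\<in>I. c i * e i x) (\<lambda>x. \<Sum>i\<in>I. c i / \<kappa> i * e i x)"
proof (rule sol_sum[OF assms(1)])
  fix i assume "i \<in> I"
  then have i: "i \<ge> 1" using assms by auto
  show "sol (\<lambda>x. c i * e i x) (\<lambda>x. c i / \<kappa> i * e i x)"
    using sol_cmult[OF sol_e[OF i], of "c i / \<kappa> i"] \<kappa>_ge_1[OF i] by (simp add: field_simps)
qed

text \<open>The solution operator divides the i-th coefficient by \<open>\<kappa> i\<close>, so its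
  sup bound becomes a bound by the sum of squares of the coefficients.\<close>

lemma sum_e_sup:
  assumes "finite I" "I \<subseteq> {1..}" "x \<in> {0..l}"
  shows "(\<Sum>i\<in>I. c i / \<kappa> i * e i x)\<^sup>2 \<le> l / D * (\<Sum>i\<in>I. (c i)\<^sup>2)"
  using sol_sup[OF sol_sum_e[OF assms(1,2)] assms(3), of c] norm_sum_e[OF assms(1,2)] by simp

text \<open>The choice c i = e i x / \<kappa> i turns \<open>sum_e_sup\<close> into S^2 <= (l / D)
  S. This is Bessel's inequality for the Green's function at \<open>x\<close>, whose i-th
  coefficient is e i x / \<kappa> i.\<close>

lemma sum_e_sq_le:
  assumes "finite I" "I \<subseteq> {1..}" "x \<in> {0..l}"
  shows "(\<Sum>i\<in>I. (e i x / \<kappa> i)\<^sup>2) \<le> l / D"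
proof -
  let ?S = "\<Sum>i\<in>I. (e i x / \<kappa> i)\<^sup>2"
  have "?S * ?S \<le> l / D * ?S"
    using sum_e_sup[OF assms, of "\<lambda>i. e i x / \<kappa> i"] by (simp add: power2_eq_square)
  moreover have "?S \<ge> 0" by (intro sum_nonneg) auto
  ultimately show ?thesis
    using l_pos D_pos mult_right_le_imp_le[of ?S ?S "l / D"] by (cases "?S = 0") auto
qed

lemma e_sup: assumes "n \<ge> 1" "x \<in> {0..l}" shows "\<bar>e n x\<bar> \<le> sqrt (l / D) * \<kappa> n"
proof -
  have "(e n x / \<kappa> n)\<^sup>2 \<le> l / D" using sum_e_sq_le[of "{n}" x] assms by simp
  then have "\<bar>e n x / \<kappa> n\<bar> \<le> sqrt (l / D)" by (metis real_sqrt_abs real_sqrt_le_iff)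
  then show ?thesis using \<kappa>_ge_1[OF assms(1)] by (simp add: field_simps)
qed

text \<open>Integrate \<open>sum_e_sq_le\<close> over \<open>x\<close>, each \<open>e i\<close>
  having norm 1. In other words, the solution operator is Hilbert-Schmidt.\<close>

lemma summable_inverse_\<kappa>_sq: "summable (\<lambda>n. 1 / (\<kappa> (Suc n))\<^sup>2)"
proof (rule summableI_nonneg_bounded)
  fix N
  let ?I = "Suc ` {..<N}"
  have I: "finite ?I" "?I \<subseteq> {1..}" by auto
  have "(\<Sum>n<N. 1 / (\<kappa> (Suc n))\<^sup>2) = (\<Sum>i\<in>?I. 1 / (\<kappa> i)\<^sup>2 * nsq (e i))"
    by (simp add: sum.reindex e_norm)
  also have "\<dots> = (\<Sum>i\<in>?I. LINT x|lebesgue_on {0..l}. (e i x / \<kappa> i)\<^sup>2)"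
    by (intro sum.cong refl) (simp add: inner_on_self power_divide)
  also have "\<dots> = (LINT x|lebesgue_on {0..l}. (\<Sum>i\<in>?I. (e i x / \<kappa> i)\<^sup>2))"
  proof (rule Bochner_Integration.integral_sum[symmetric])
    fix i assume "i \<in> ?I"
    then have i: "i \<ge> 1" by auto
    show "integrable (lebesgue_on {0..l}) (\<lambda>x. (e i x / \<kappa> i)\<^sup>2)"
      using L2_onD(2)[OF e_L2[OF i]] by (simp add: power_divide)
  qed
  also have "\<dots> \<le> (LINT x|lebesgue_on {0..l}. l / D)"
  proof (rule Bochner_Integration.integral_mono)
    show "integrable (lebesgue_on {0..l}) (\<lambda>x. \<Sum>i\<in>?I. (e i x / \<kappa> i)\<^sup>2)"
      using L2_onD(2)[OF e_L2] by (intro Bochner_Integration.integrable_sum) (auto simp: power_divide)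
    show "integrable (lebesgue_on {0..l}) (\<lambda>x. l / D)"
      by (intro continuous_imp_integrable_real) auto
  qed (use sum_e_sq_le[OF I] in auto)
  also have "\<dots> = l / D * l" using l_pos by (simp add: measure_restrict_space)
  finally show "(\<Sum>n<N. 1 / (\<kappa> (Suc n))\<^sup>2) \<le> l / D * l" .
qed simp

text \<open>A nonzero continuous \<open>z\<close> orthogonal to all \<open>e n\<close> would yield a
  further eigenfunction \<open>w\<close> orthogonal to them. Its eigenvalue occurs in the exhaustive
  list \<open>\<sigma>\<close> and is simple, so \<open>w\<close> would be a multiple of one of the
  \<open>e n\<close>.\<close>

lemma continuous_orth_zero:
  assumes z: "continuous_on {0..l} z" "\<And>n. n \<ge> 1 \<Longrightarrow> ip z (e n) = 0" and x: "x \<in> {0..l}"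
  shows "z x = 0"
proof (rule ccontr)
  assume "z x \<noteq> 0"
  moreover have "orth (e ` {1..}) z" using z by (auto simp: orth_def)
  moreover have "\<exists>k. k \<noteq> 0 \<and> sol (\<lambda>x. k * h x) h" if h: "h \<in> e ` {1..}" for h
  proof -
    obtain n where "n \<ge> 1" "h = e n" using h by auto
    then show ?thesis using sol_e[of n] \<kappa>_ge_1[of n] by (intro exI[of _ "\<kappa> n"]) auto
  qed
  ultimately obtain k w where w: "sol (\<lambda>x. k * w x) w" "orth (e ` {1..}) w" "\<exists>x\<in>{0..l}. w x \<noteq> 0"
    using exists_eigenfunction_orth[of "e ` {1..}" z x] x by blast
  then have "sl_eigenpair D q l (\<mu> - k) w" by (intro eigenpair_of_sol)
  then obtain n where n: "n \<ge> 1" "\<mu> - k = \<sigma> n"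
    using eigensystem unfolding sl_eigensystem_def by auto
  then have k: "k = \<kappa> n" by (simp add: \<kappa>_def)
  have en: "\<exists>x\<in>{0..l}. e n x \<noteq> 0" using g_nonzero[OF n(1)] nrm_pos[OF n(1)] by (auto simp: e_def)
  obtain c where c: "\<And>x. x \<in> {0..l} \<Longrightarrow> w x = c * e n x"
    using sol_eigenfunction_unique[OF sol_e[OF n(1)] _ en, of w] w(1) k by blast
  have "ip w (e n) = ip (\<lambda>x. c * e n x) (e n)" using c by (intro inner_on_cong) auto
  then have "c = 0" using w(2) n(1) by (auto simp: orth_def inner_on_cmult_left e_norm)
  with c w(3) show False by auto
qed

text \<open>For \<open>h\<close> in the range of the operator the coefficients are those of
  \<open>\<phi>\<close> divided by \<open>\<kappa>\<close>, so the remainders \<open>?y\<close> are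
  uniformly Cauchy. Their limit is continuous and orthogonal to every \<open>e n\<close>, hence
  zero.\<close>

lemma expansion_of_sol:
  assumes h: "sol \<phi> h"
  shows "(\<lambda>N. nsq (\<lambda>x. h x - (\<Sum>i=1..N. coef h i * e i x))) \<longlonglongrightarrow> 0"
proof -
  let ?y = "\<lambda>N x. h x - (\<Sum>i=1..N. coef h i * e i x)"
  have L: "L2_on {0..l} \<phi>" "L2_on {0..l} h" using sol_L2 h by auto
  have coef_h: "coef h i = coef \<phi> i / \<kappa> i" if "i \<ge> 1" for i
    using sol_sym[OF h sol_e[OF that]] \<kappa>_ge_1[OF that]
    by (simp add: coef_def inner_on_cmult_right field_simps)
  have tail: "(?y M x - ?y N x)\<^sup>2 \<le> l / D * (\<Sum>n=M..<N. (coef \<phi> (Suc n))\<^sup>2)"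
    if "x \<in> {0..l}" "M \<le> N" for x M N
  proof -
    have "(\<Sum>i=1..N. coef h i * e i x) = (\<Sum>i=1..M. coef h i * e i x) + (\<Sum>i\<in>Suc ` {M..<N}. coef h i * e i x)"
      using sum.atLeastLessThan_concat[of 0 M N "\<lambda>i. coef h (Suc i) * e (Suc i) x"] that
      by (simp add: sum.atLeast1_atMost_eq sum.reindex lessThan_atLeast0 del: image_Suc_atLeastLessThan)
    moreover have "(\<Sum>i\<in>Suc ` {M..<N}. coef h i * e i x) = (\<Sum>i\<in>Suc ` {M..<N}. coef \<phi> i / \<kappa> i * e i x)"
      using coef_h by (intro sum.cong refl) auto
    ultimately have "?y M x - ?y N x = (\<Sum>i\<in>Suc ` {M..<N}. coef \<phi> i / \<kappa> i * e i x)"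
      by linarith
    moreover have "(\<Sum>i\<in>Suc ` {M..<N}. coef \<phi> i / \<kappa> i * e i x)\<^sup>2 \<le> l / D * (\<Sum>i\<in>Suc ` {M..<N}. (coef \<phi> i)\<^sup>2)"
      using that by (intro sum_e_sup) auto
    moreover have "(\<Sum>i\<in>Suc ` {M..<N}. (coef \<phi> i)\<^sup>2) = (\<Sum>n=M..<N. (coef \<phi> (Suc n))\<^sup>2)"
      by (simp add: sum.reindex del: image_Suc_atLeastLessThan)
    ultimately show ?thesis by metis
  qed
  have sc: "summable (\<lambda>n. (coef \<phi> (Suc n))\<^sup>2)" by (rule summable_coef_sq[OF L(1)])
  have "uniformly_Cauchy_on {0..l} ?y"
  proof (rule uniformly_Cauchy_onI')
    fix \<epsilon> :: real assume \<epsilon>: "\<epsilon> > 0"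
    then have "\<epsilon>\<^sup>2 * D / l > 0" using D_pos l_pos by simp
    then obtain M where M: "\<And>m n. m \<ge> M \<Longrightarrow> norm (\<Sum>i=m..<n. (coef \<phi> (Suc i))\<^sup>2) < \<epsilon>\<^sup>2 * D / l"
      using sc unfolding summable_Cauchy by meson
    show "\<exists>M. \<forall>x\<in>{0..l}. \<forall>m\<ge>M. \<forall>n>m. dist (?y m x) (?y n x) < \<epsilon>"
    proof (intro exI[of _ M] ballI allI impI)
      fix x m n assume x: "x \<in> {0..l}" and m: "M \<le> m" and n: "m < n"
      have "(?y m x - ?y n x)\<^sup>2 \<le> l / D * (\<Sum>i=m..<n. (coef \<phi> (Suc i))\<^sup>2)"
        using tail[OF x] n by simp
      also have "\<dots> < l / D * (\<epsilon>\<^sup>2 * D / l)"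
        using M[OF m, of n] l_pos D_pos by (intro mult_strict_left_mono) auto
      also have "\<dots> = \<epsilon>\<^sup>2" using l_pos D_pos by simp
      finally have "\<bar>?y m x - ?y n x\<bar>\<^sup>2 < \<epsilon>\<^sup>2" by simp
      then show "dist (?y m x) (?y n x) < \<epsilon>"
        unfolding dist_real_def using \<epsilon> power2_less_imp_less by (meson less_imp_le)
    qed
  qed
  then obtain y where ul: "uniform_limit {0..l} ?y y sequentially"
    using Cauchy_uniformly_convergent uniformly_convergent_on_def by blast
  have yc: "continuous_on {0..l} (?y N)" for N
    using sol_continuous(2)[OF h] e_continuous
    by (intro continuous_on_diff continuous_on_sum continuous_on_mult continuous_on_const) auto
  have y: "continuous_on {0..l} y"
    by (rule uniform_limit_theorem[OF _ ul]) (use yc in auto)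
  have Ly: "L2_on {0..l} y" "L2_on {0..l} (?y N)" for N
    using y yc by (auto intro: L2_on_continuous)
  have lim: "(\<lambda>N. nsq (\<lambda>x. ?y N x - y x)) \<longlonglongrightarrow> 0"
    using l_pos by (intro inner_on_uniform_limit ul always_eventually allI L2_on_diff[OF Ly(2,1)]) auto
  have "y x = 0" if "x \<in> {0..l}" for x
  proof (rule continuous_orth_zero[OF y _ that])
    fix n :: nat assume n: "n \<ge> 1"
    have "(ip y (e n))\<^sup>2 \<le> nsq (\<lambda>x. ?y N x - y x)" if "N \<ge> n" for N
    proof -
      have "ip (?y N) (e n) = 0"
        using n that ip_sum_e[of "{1..N}" n "coef h"]
        by (subst inner_on_diff_left) (auto simp: L sum_e_L2 e_L2 coef_def)
      then have "ip (\<lambda>x. ?y N x - y x) (e n) = - ip y (e n)"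
        using inner_on_diff_left[OF Ly(2,1) e_L2[OF n], of N] by simp
      then show ?thesis
        using inner_on_Cauchy_Schwarz[OF L2_on_diff[OF Ly(2,1)] e_L2[OF n], of N] e_norm[OF n] by simp
    qed
    then have "(ip y (e n))\<^sup>2 \<le> 0"
      by (intro tendsto_lowerbound[OF lim]) (auto simp: eventually_sequentially)
    then show "ip y (e n) = 0" by simp
  qed
  then have "nsq (\<lambda>x. ?y N x - y x) = nsq (?y N)" for N
    by (intro inner_on_cong) auto
  with lim show ?thesis by simp
qed

text \<open>Approximate \<open>f\<close> by some \<open>h\<close> in the range and use the partial
  sums of \<open>h\<close>; replacing their coefficients by those of \<open>f\<close> can only
  decrease the error.\<close>

theorem expansion:
  assumes f: "L2_on {0..l} f"
  shows "(\<lambda>N. nsq (\<lambda>x. f x - (\<Sum>i=1..N. coef f i * e i x))) \<longlonglongrightarrow> 0"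
proof (rule tendstoI)
  fix \<epsilon> :: real assume \<epsilon>: "\<epsilon> > 0"
  then have "\<epsilon> / 4 > 0" by simp
  then obtain \<phi> h where h: "sol \<phi> h" "nsq (\<lambda>x. f x - h x) < \<epsilon> / 4"
    using sol_dense[OF f] by blast
  have Lh: "L2_on {0..l} h" using sol_L2 h by blast
  have "\<forall>\<^sub>F N in sequentially.
      nsq (\<lambda>x. h x - (\<Sum>i=1..N. coef h i * e i x)) < \<epsilon> / 4"
    using \<epsilon> by (intro order_tendstoD(2)[OF expansion_of_sol[OF h(1)]]) auto
  then show "\<forall>\<^sub>F N in sequentially.
      dist (nsq (\<lambda>x. f x - (\<Sum>i=1..N. coef f i * e i x))) 0 < \<epsilon>"
  proof eventually_elim
    case (elim N)
    let ?S = "\<lambda>c x. \<Sum>i=1..N. c i * e i x"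
    have "nsq (\<lambda>x. f x - ?S (coef f) x)
        \<le> nsq (\<lambda>x. f x - ?S (coef h) x)"
      using norm_diff_sum_e[OF f, of "{1..N}" "coef f"] norm_diff_sum_e[OF f, of "{1..N}" "coef h"]
        sum_nonneg[of "{1..N}" "\<lambda>i. (coef h i - coef f i)\<^sup>2"] by simp
    also have "\<dots> = nsq (\<lambda>x. (f x - h x) + (h x - ?S (coef h) x))"
      by simp
    also have "\<dots> \<le> 2 * nsq (\<lambda>x. f x - h x)
        + 2 * nsq (\<lambda>x. h x - ?S (coef h) x)"
      using f Lh by (intro inner_on_self_add_le L2_on_diff sum_e_L2) auto
    also have "\<dots> < \<epsilon>" using elim h(2) by simp
    finally show ?case using inner_on_self_nonneg[of "{0..l}" "\<lambda>x. f x - ?S (coef f) x"] by simp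
  qed
qed

section \<open>The heat series\<close>

definition heat :: "(nat \<Rightarrow> real \<Rightarrow> real) \<Rightarrow> real \<Rightarrow> real \<Rightarrow> real" where
  "heat a x s = (\<Sum>n. exp (\<sigma> (Suc n) * s) * a n x)"

text \<open>Polynomial growth in \<open>\<kappa>\<close>, uniformly on \<open>X\<close>: preserved
  by factors \<open>\<sigma>\<close> and \<open>\<kappa>\<close>, and defeated by the exponential at
  positive times.\<close>

definition poly_bounded :: "(nat \<Rightarrow> real \<Rightarrow> real) \<Rightarrow> real set \<Rightarrow> bool" where
  "poly_bounded a X \<longleftrightarrow> (\<exists>B m. \<forall>n. \<forall>x\<in>X. \<bar>a n x\<bar> \<le> B * \<kappa> (Suc n) ^ m)"

lemma poly_boundedI: "(\<And>n x. x \<in> X \<Longrightarrow> \<bar>a n x\<bar> \<le> B * \<kappa> (Suc n) ^ m) \<Longrightarrow> poly_bounded a X"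
  by (auto simp: poly_bounded_def)

lemma \<kappa>_Suc: "\<kappa> (Suc n) \<ge> 1"
  by (rule \<kappa>_ge_1) simp

lemma poly_bounded_mono:
  assumes "poly_bounded a X" "\<And>n x. x \<in> X \<Longrightarrow> \<bar>a' n x\<bar> \<le> C * \<kappa> (Suc n) ^ k * \<bar>a n x\<bar>"
  shows "poly_bounded a' X"
proof -
  obtain B m where B: "\<And>n x. x \<in> X \<Longrightarrow> \<bar>a n x\<bar> \<le> B * \<kappa> (Suc n) ^ m"
    using assms(1) by (auto simp: poly_bounded_def)
  show ?thesis
  proof (rule poly_boundedI)
    fix n x assume x: "x \<in> X"
    have "\<bar>a' n x\<bar> \<le> C * \<kappa> (Suc n) ^ k * \<bar>a n x\<bar>" using assms(2)[OF x] .
    also have "\<dots> \<le> \<bar>C\<bar> * \<kappa> (Suc n) ^ k * \<bar>a n x\<bar>"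
      using \<kappa>_Suc[of n] by (intro mult_right_mono) auto
    also have "\<dots> \<le> \<bar>C\<bar> * \<kappa> (Suc n) ^ k * (B * \<kappa> (Suc n) ^ m)"
      using \<kappa>_Suc[of n] B[OF x, of n] by (intro mult_left_mono) auto
    also have "\<dots> = \<bar>C\<bar> * B * \<kappa> (Suc n) ^ (k + m)" by (simp add: power_add)
    finally show "\<bar>a' n x\<bar> \<le> \<bar>C\<bar> * B * \<kappa> (Suc n) ^ (k + m)" .
  qed
qed

text \<open>exp (\<sigma> s) is exp (\<mu> s) exp (- \<kappa> s), and a single term of the
  exponential series bounds \<kappa>^(m + 2) exp (- \<kappa> s0) by (m + 2)! / s0^(m + 2). The two
  powers beyond \<open>m\<close> produce the summable majorant.\<close>

lemma heat_term_bound: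
  assumes a: "poly_bounded a X" and s: "0 < s0"
  obtains C where "\<And>n x s. x \<in> X \<Longrightarrow> s0 \<le> s \<Longrightarrow> s \<le> s1 \<Longrightarrow>
    \<bar>exp (\<sigma> (Suc n) * s) * a n x\<bar> \<le> C * (1 / (\<kappa> (Suc n))\<^sup>2)"
proof -
  obtain B m where B: "\<And>n x. x \<in> X \<Longrightarrow> \<bar>a n x\<bar> \<le> B * \<kappa> (Suc n) ^ m"
    using a by (auto simp: poly_bounded_def)
  define C where "C = exp (\<bar>\<mu>\<bar> * s1) * \<bar>B\<bar> * (fact (m + 2) / s0 ^ (m + 2))"
  show thesis
  proof
    fix n x s assume x: "x \<in> X" and s01: "s0 \<le> s" "s \<le> s1"
    let ?k = "\<kappa> (Suc n)"
    have k: "?k \<ge> 1" by (rule \<kappa>_Suc)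
    have "exp (\<sigma> (Suc n) * s) = exp (\<mu> * s) * exp (- (?k * s))"
      by (simp add: \<kappa>_def left_diff_distrib flip: exp_add)
    also have "\<dots> \<le> exp (\<bar>\<mu>\<bar> * s1) * exp (- (?k * s0))"
    proof (intro mult_mono)
      have "\<mu> * s \<le> \<bar>\<mu>\<bar> * s1" using s01 s by (intro mult_mono) auto
      then show "exp (\<mu> * s) \<le> exp (\<bar>\<mu>\<bar> * s1)" by simp
      show "exp (- (?k * s)) \<le> exp (- (?k * s0))" using k s01 by simp
    qed auto
    finally have E: "exp (\<sigma> (Suc n) * s) \<le> exp (\<bar>\<mu>\<bar> * s1) * exp (- (?k * s0))" .
    define N c where "N = m + 2" and "c = (fact (m + 2) :: real)"
    have c: "c > 0" by (simp add: c_def)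
    have "(?k * s0) ^ N / c \<le> exp (?k * s0)"
    proof -
      have "(?k * s0) ^ (m + 2) /\<^sub>R fact (m + 2) \<le> (\<Sum>i. (?k * s0) ^ i /\<^sub>R fact i)"
        using sum_le_suminf[OF summable_exp_generic, of "{m + 2}" "?k * s0"] k s by auto
      then show ?thesis by (simp add: exp_def divide_inverse mult.commute N_def c_def)
    qed
    then have "?k ^ N * exp (- (?k * s0)) \<le> c / s0 ^ N"
      using s c by (simp add: power_mult_distrib exp_minus field_simps)
    then have "exp (- (?k * s0)) * ?k ^ m * ?k\<^sup>2 \<le> c / s0 ^ N"
      by (simp add: N_def power_add mult_ac power2_eq_square)
    then have "exp (- (?k * s0)) * ?k ^ m \<le> c / s0 ^ N / ?k\<^sup>2"
      using k by (subst pos_le_divide_eq) auto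
    then have K: "exp (- (?k * s0)) * ?k ^ m \<le> fact (m + 2) / s0 ^ (m + 2) * (1 / ?k\<^sup>2)"
      by (simp only: N_def c_def times_divide_eq_right mult_1_right)
    have "\<bar>exp (\<sigma> (Suc n) * s) * a n x\<bar> = exp (\<sigma> (Suc n) * s) * \<bar>a n x\<bar>" by (simp add: abs_mult)
    also have "\<dots> \<le> (exp (\<bar>\<mu>\<bar> * s1) * exp (- (?k * s0))) * (\<bar>B\<bar> * ?k ^ m)"
    proof (intro mult_mono E)
      have "B * ?k ^ m \<le> \<bar>B\<bar> * ?k ^ m" using k by (intro mult_right_mono) auto
      then show "\<bar>a n x\<bar> \<le> \<bar>B\<bar> * ?k ^ m" using B[OF x, of n] by linarith
    qed auto
    also have "\<dots> = exp (\<bar>\<mu>\<bar> * s1) * \<bar>B\<bar> * (exp (- (?k * s0)) * ?k ^ m)" by (simp add: mult_ac)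
    also have "\<dots> \<le> exp (\<bar>\<mu>\<bar> * s1) * \<bar>B\<bar> * (fact (m + 2) / s0 ^ (m + 2) * (1 / ?k\<^sup>2))"
      by (intro mult_left_mono K) auto
    finally show "\<bar>exp (\<sigma> (Suc n) * s) * a n x\<bar> \<le> C * (1 / ?k\<^sup>2)" by (simp add: C_def mult.assoc)
  qed
qed

lemma heat_summable:
  assumes "poly_bounded a X" "x \<in> X" "0 < s"
  shows "summable (\<lambda>n. exp (\<sigma> (Suc n) * s) * a n x)"
proof -
  obtain C where C: "\<And>n x s'. x \<in> X \<Longrightarrow> s \<le> s' \<Longrightarrow> s' \<le> s \<Longrightarrow>
    \<bar>exp (\<sigma> (Suc n) * s') * a n x\<bar> \<le> C * (1 / (\<kappa> (Suc n))\<^sup>2)"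
    using heat_term_bound[OF assms(1,3), of s] by blast
  show ?thesis
    by (rule summable_comparison_test'[OF summable_mult[OF summable_inverse_\<kappa>_sq, of C], of 0])
       (use C assms in auto)
qed

lemma heat_uniform:
  assumes "poly_bounded a X" "0 < s0"
  shows "uniform_limit (X \<times> {s0..s1}) (\<lambda>N (x, s). \<Sum>n<N. exp (\<sigma> (Suc n) * s) * a n x)
    (\<lambda>(x, s). heat a x s) sequentially"
proof -
  obtain C where C: "\<And>n x s. x \<in> X \<Longrightarrow> s0 \<le> s \<Longrightarrow> s \<le> s1 \<Longrightarrow>
    \<bar>exp (\<sigma> (Suc n) * s) * a n x\<bar> \<le> C * (1 / (\<kappa> (Suc n))\<^sup>2)"
    using heat_term_bound[OF assms] by blast
  have "uniform_limit (X \<times> {s0..s1}) (\<lambda>N z. \<Sum>n<N. exp (\<sigma> (Suc n) * snd z) * a n (fst z))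
    (\<lambda>z. \<Sum>n. exp (\<sigma> (Suc n) * snd z) * a n (fst z)) sequentially"
    by (rule Weierstrass_m_test[OF _ summable_mult[OF summable_inverse_\<kappa>_sq, of C]]) (use C in auto)
  then show ?thesis by (simp add: heat_def case_prod_beta')
qed

text \<open>Uniform convergence holds on time ranges bounded away from 0 and infinity; continuity at
  time \<open>s\<close> is read off on [s / 2, 2 s].\<close>

lemma heat_continuous:
  assumes a: "poly_bounded a X" "\<And>n. continuous_on X (a n)"
  shows "continuous_on (X \<times> {0<..}) (\<lambda>(x, s). heat a x s)"
  unfolding continuous_on_eq_continuous_within
proof
  fix z :: "real \<times> real" assume z: "z \<in> X \<times> {0<..}"
  obtain x s where xs: "z = (x, s)" by (cases z)
  with z have x: "x \<in> X" and s: "s > 0" by auto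
  have "continuous_on (X \<times> {s / 2 .. 2 * s}) (\<lambda>(x, s). heat a x s)"
  proof (rule uniform_limit_theorem[OF _ heat_uniform[OF a(1)]])
    have "continuous_on (X \<times> {s / 2 .. 2 * s}) (\<lambda>z. \<Sum>n<N. exp (\<sigma> (Suc n) * snd z) * a n (fst z))" for N
      by (intro continuous_on_sum continuous_on_mult continuous_on_exp continuous_on_const
          continuous_on_snd continuous_on_id continuous_on_compose2[OF a(2) continuous_on_fst[OF continuous_on_id]]) auto
    then show "\<forall>\<^sub>F N in sequentially. continuous_on (X \<times> {s / 2 .. 2 * s}) (\<lambda>(x, s). \<Sum>n<N. exp (\<sigma> (Suc n) * s) * a n x)"
      by (simp add: case_prod_beta')
  qed (use s in auto)
  then have "continuous (at z within X \<times> {s / 2 .. 2 * s}) (\<lambda>(x, s). heat a x s)"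
    using x s unfolding continuous_on_eq_continuous_within xs by auto
  moreover have "at z within X \<times> {s / 2 .. 2 * s} = at z within X \<times> {0<..}"
    using s by (intro at_within_nhd[of _ "UNIV \<times> {s / 2<..<2 * s}"]) (auto simp: xs intro!: open_Times)
  ultimately show "continuous (at z within X \<times> {0<..}) (\<lambda>(x, s). heat a x s)" by simp
qed

lemma heat_derivative_time:
  assumes a: "poly_bounded a X" and x: "x \<in> X" and s: "0 < s"
  shows "((\<lambda>s. heat a x s) has_real_derivative heat (\<lambda>n x. \<sigma> (Suc n) * a n x) x s) (at s)"
proof -
  let ?S = "{s / 2 .. 2 * s}"
  have a': "poly_bounded (\<lambda>n x. \<sigma> (Suc n) * a n x) X"
  proof (rule poly_bounded_mono[OF a])
    fix n x
    \<comment> \<open>From \<sigma> = \<mu> - \<kappa> and \<kappa> >= 1.\<close>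
    have "\<bar>\<sigma> (Suc n)\<bar> \<le> (1 + \<bar>\<mu>\<bar>) * \<kappa> (Suc n) ^ 1"
      using \<kappa>_Suc[of n] mult_right_mono[of 1 "\<kappa> (Suc n)" "\<bar>\<mu>\<bar>"]
      by (simp add: \<kappa>_def algebra_simps)
    then show "\<bar>\<sigma> (Suc n) * a n x\<bar> \<le> (1 + \<bar>\<mu>\<bar>) * \<kappa> (Suc n) ^ 1 * \<bar>a n x\<bar>"
      unfolding abs_mult by (rule mult_right_mono) simp
  qed
  have "uniform_limit ?S (\<lambda>N s. \<Sum>n<N. exp (\<sigma> (Suc n) * s) * (\<sigma> (Suc n) * a n x))
    (\<lambda>s. heat (\<lambda>n x. \<sigma> (Suc n) * a n x) x s) sequentially"
    using uniform_limit_compose'[OF heat_uniform[OF a', of "s / 2" "2 * s"], of "\<lambda>s. (x, s)" ?S] x s by simp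
  moreover have "((\<lambda>s. exp (\<sigma> (Suc n) * s) * a n x) has_real_derivative
      exp (\<sigma> (Suc n) * s') * (\<sigma> (Suc n) * a n x)) (at s' within ?S)" for n s'
    by (auto intro!: derivative_eq_intros)
  ultimately obtain G where G: "\<And>s'. s' \<in> ?S \<Longrightarrow> (\<lambda>n. exp (\<sigma> (Suc n) * s') * a n x) sums G s'"
    "\<And>s'. s' \<in> ?S \<Longrightarrow> (G has_real_derivative heat (\<lambda>n x. \<sigma> (Suc n) * a n x) x s') (at s' within ?S)"
    using has_field_derivative_series[OF convex_real_interval(5)[of "s / 2" "2 * s"],
        of "\<lambda>n s. exp (\<sigma> (Suc n) * s) * a n x" "\<lambda>n s. exp (\<sigma> (Suc n) * s) * (\<sigma> (Suc n) * a n x)" _ s]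
      heat_summable[OF a x s] s by force
  have sS: "s \<in> ?S" using s by simp
  have "((\<lambda>s. heat a x s) has_real_derivative heat (\<lambda>n x. \<sigma> (Suc n) * a n x) x s) (at s within ?S)"
    by (rule has_field_derivative_transform[OF sS _ G(2)[OF sS]]) (use G(1) in \<open>auto simp: heat_def sums_iff\<close>)
  moreover have "at s within ?S = at s"
    using s by (intro at_within_interior) (simp add: interior_atLeastAtMost_real)
  ultimately show ?thesis by simp
qed

lemma heat_derivative_space:
  assumes a: "poly_bounded a {0..l}" and a': "poly_bounded a' {0..l}"
    and d: "\<And>n x. x \<in> {0..l} \<Longrightarrow> (a n has_real_derivative a' n x) (at x within {0..l})"
    and x: "x \<in> {0..l}" and s: "0 < s"
  shows "((\<lambda>x. heat a x s) has_real_derivative heat a' x s) (at x within {0..l})"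
proof -
  have "uniform_limit {0..l} (\<lambda>N x. \<Sum>n<N. exp (\<sigma> (Suc n) * s) * a' n x) (\<lambda>x. heat a' x s) sequentially"
    using uniform_limit_compose'[OF heat_uniform[OF a', of s s], of "\<lambda>x. (x, s)" "{0..l}"] s by simp
  moreover have "((\<lambda>x. exp (\<sigma> (Suc n) * s) * a n x) has_real_derivative exp (\<sigma> (Suc n) * s) * a' n x)
      (at x within {0..l})" if "x \<in> {0..l}" for n x
    using d[OF that] by (rule DERIV_cmult)
  ultimately obtain G where G: "\<And>x. x \<in> {0..l} \<Longrightarrow> (\<lambda>n. exp (\<sigma> (Suc n) * s) * a n x) sums G x"
    "\<And>x. x \<in> {0..l} \<Longrightarrow> (G has_real_derivative heat a' x s) (at x within {0..l})"
    using has_field_derivative_series[OF convex_real_interval(5)[of 0 l],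
        of "\<lambda>n x. exp (\<sigma> (Suc n) * s) * a n x" "\<lambda>n x. exp (\<sigma> (Suc n) * s) * a' n x" _ x]
      heat_summable[OF a x s] x by force
  show ?thesis
    by (rule has_field_derivative_transform[OF x _ G(2)[OF x]]) (use G(1) in \<open>auto simp: heat_def sums_iff\<close>)
qed

text \<open>\<open>sol\<close> hides the derivative behind a quantifier; the choice makes it a
  function of \<open>n\<close>.\<close>

definition e1 :: "nat \<Rightarrow> real \<Rightarrow> real" where
  "e1 n = (SOME y'. bvp (\<lambda>x. \<kappa> n * e n x) (e n) y')"

text \<open>The second derivative of \<open>e n\<close> as the eigenvalue equation gives it, so that
  a polynomial bound for \<open>e n\<close> passes to it at once.\<close>

definition e2 :: "nat \<Rightarrow> real \<Rightarrow> real" where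
  "e2 n x = (\<sigma> n - q x) / D * e n x"

lemma e_derivs:
  assumes "n \<ge> 1" "x \<in> {0..l}"
  shows "(e n has_real_derivative e1 n x) (at x within {0..l})"
    "(e1 n has_real_derivative e2 n x) (at x within {0..l})"
proof -
  have b: "bvp (\<lambda>x. \<kappa> n * e n x) (e n) (e1 n)"
    unfolding e1_def using sol_e[OF assms(1)] unfolding sol_def by (rule someI_ex)
  then show "(e n has_real_derivative e1 n x) (at x within {0..l})" using assms by (auto simp: bvp_def)
  have "((\<mu> - q x) * e n x - \<kappa> n * e n x) / D = e2 n x"
    by (simp add: e2_def \<kappa>_def left_diff_distrib)
  moreover have "(e1 n has_real_derivative ((\<mu> - q x) * e n x - \<kappa> n * e n x) / D) (at x within {0..l})"
    using b assms by (auto simp: bvp_def)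
  ultimately show "(e1 n has_real_derivative e2 n x) (at x within {0..l})" by metis
qed

lemma e_0: "n \<ge> 1 \<Longrightarrow> e n 0 = 0" and e_l: "n \<ge> 1 \<Longrightarrow> e n l = 0"
  using sol_e by (auto simp: sol_def bvp_def)

lemma e1_continuous: "n \<ge> 1 \<Longrightarrow> continuous_on {0..l} (e1 n)"
  using e_derivs(2) by (rule derivative_continuous_on)

lemma e2_continuous: "n \<ge> 1 \<Longrightarrow> continuous_on {0..l} (e2 n)"
  unfolding e2_def using e_continuous[of n] cont_q D_pos by (auto intro!: continuous_intros)

lemma poly_bounded_e: "poly_bounded (\<lambda>n. e (Suc n)) {0..l}"
  by (rule poly_boundedI[of _ _ "sqrt (l / D)" 1]) (use e_sup in auto)

lemma poly_bounded_e2: "poly_bounded (\<lambda>n. e2 (Suc n)) {0..l}"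
proof -
  obtain Q where Q: "\<And>x. x \<in> {0..l} \<Longrightarrow> \<bar>\<mu> - q x\<bar> \<le> Q"
    using bounded_continuous_Icc[of 0 l "\<lambda>x. \<mu> - q x"] cont_p by blast
  show ?thesis
  proof (rule poly_bounded_mono[OF poly_bounded_e])
    fix n x assume x: "x \<in> {0..l}"
    have "Q \<ge> 0" using Q[OF x] by linarith
    then have "\<bar>\<sigma> (Suc n) - q x\<bar> \<le> (Q + 1) * \<kappa> (Suc n) ^ 1"
      using Q[OF x] \<kappa>_Suc[of n] mult_left_mono[of 1 "\<kappa> (Suc n)" Q] by (simp add: \<kappa>_def algebra_simps)
    then have "\<bar>\<sigma> (Suc n) - q x\<bar> / D \<le> (Q + 1) / D * \<kappa> (Suc n) ^ 1"
      using D_pos by (simp add: field_simps)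
    then show "\<bar>e2 (Suc n) x\<bar> \<le> (Q + 1) / D * \<kappa> (Suc n) ^ 1 * \<bar>e (Suc n) x\<bar>"
      using D_pos unfolding e2_def abs_mult abs_divide by (intro mult_right_mono) auto
  qed
qed

text \<open>The bound on \<open>e2\<close> controls the variation of \<open>e1\<close>; a point
  where \<open>e1\<close> vanishes turns this into a bound on \<open>e1\<close> itself.\<close>

lemma poly_bounded_e1: "poly_bounded (\<lambda>n. e1 (Suc n)) {0..l}"
proof -
  obtain B m where B: "\<And>n x. x \<in> {0..l} \<Longrightarrow> \<bar>e2 (Suc n) x\<bar> \<le> B * \<kappa> (Suc n) ^ m"
    using poly_bounded_e2 unfolding poly_bounded_def by blast
  show ?thesis
  proof (rule poly_boundedI)
    fix n x assume x: "x \<in> {0..l}"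
    have n: "Suc n \<ge> 1" by simp
    have at: "at x within {0..l} = at x" if "0 < x" "x < l" for x
      using that by (intro at_within_interior) (simp add: interior_atLeastAtMost_real)
    have d: "(e (Suc n) has_real_derivative e1 (Suc n) x) (at x)" if "0 < x" "x < l" for x
      using e_derivs(1)[OF n, of x] at[OF that] that by simp
    \<comment> \<open>Rolle's theorem supplies a zero \<open>z\<close> of \<open>e1\<close>.\<close>
    obtain dz z where z: "0 < z" "z < l" "(e (Suc n) has_real_derivative dz) (at z)"
      "e (Suc n) l - e (Suc n) 0 = (l - 0) * dz"
      using MVT[OF l_pos e_continuous[OF n]] d real_differentiable_def by blast
    then have "e1 (Suc n) z = 0"
      using DERIV_unique[OF d[OF z(1,2)] z(3)] e_0[OF n] e_l[OF n] l_pos by simp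
    then have "\<bar>e1 (Suc n) x\<bar> \<le> B * \<kappa> (Suc n) ^ m * \<bar>x - z\<bar>"
      using field_differentiable_bound[OF convex_real_interval(5) e_derivs(2)[OF n], where B = "B * \<kappa> (Suc n) ^ m" and x = x and y = z]
        B[of _ n] x z by simp
    also have "\<dots> \<le> \<bar>B\<bar> * \<kappa> (Suc n) ^ m * l"
    proof (rule mult_mono)
      show "B * \<kappa> (Suc n) ^ m \<le> \<bar>B\<bar> * \<kappa> (Suc n) ^ m"
        using \<kappa>_Suc[of n] by (intro mult_right_mono) auto
    qed (use x z \<kappa>_Suc[of n] in auto)
    finally show "\<bar>e1 (Suc n) x\<bar> \<le> (\<bar>B\<bar> * l) * \<kappa> (Suc n) ^ m" by (simp add: mult_ac)
  qed
qed

section \<open>The solution of the heat equation for square-integrable data\<close>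

lemma coef_bounded:
  assumes "L2_on {0..l} f" "n \<ge> 1"
  shows "\<bar>coef f n\<bar> \<le> sqrt (ip f f)"
  using inner_on_abs_le[OF assms(1) e_L2[OF assms(2)]] e_norm[OF assms(2)] by (simp add: coef_def)

lemma poly_bounded_coef:
  assumes "L2_on {0..l} f" "poly_bounded a {0..l}"
  shows "poly_bounded (\<lambda>n x. coef f (Suc n) * a n x) {0..l}"
  by (rule poly_bounded_mono[OF assms(2), of _ "sqrt (ip f f)" 0])
     (use coef_bounded[OF assms(1)] in \<open>auto simp: abs_mult intro!: mult_right_mono\<close>)

text \<open>The solution of v_s = D v_xx + q v with datum \<open>f\<close>, for s > 0. At s = 0 the
  series need not converge pointwise; the datum is recovered in norm by \<open>evol_initial\<close>.
  The companions \<open>evol1\<close> and \<open>evol2\<close> are its termwise derivatives in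
  \<open>x\<close>.\<close>

definition evol :: "(real \<Rightarrow> real) \<Rightarrow> real \<Rightarrow> real \<Rightarrow> real" where
  "evol f = heat (\<lambda>n x. coef f (Suc n) * e (Suc n) x)"

definition evol1 :: "(real \<Rightarrow> real) \<Rightarrow> real \<Rightarrow> real \<Rightarrow> real" where
  "evol1 f = heat (\<lambda>n x. coef f (Suc n) * e1 (Suc n) x)"

definition evol2 :: "(real \<Rightarrow> real) \<Rightarrow> real \<Rightarrow> real \<Rightarrow> real" where
  "evol2 f = heat (\<lambda>n x. coef f (Suc n) * e2 (Suc n) x)"

lemma evol_continuous:
  assumes "L2_on {0..l} f"
  shows "continuous_on ({0..l} \<times> {0<..}) (\<lambda>(x, s). evol f x s)"
    "continuous_on ({0..l} \<times> {0<..}) (\<lambda>(x, s). evol1 f x s)"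
    "continuous_on ({0..l} \<times> {0<..}) (\<lambda>(x, s). evol2 f x s)"
  unfolding evol_def evol1_def evol2_def
  by (intro heat_continuous poly_bounded_coef assms poly_bounded_e poly_bounded_e1 poly_bounded_e2
      continuous_on_mult continuous_on_const e_continuous e1_continuous e2_continuous; simp)+

lemma evol_boundary: "evol f 0 s = 0" "evol f l s = 0"
  by (simp_all add: evol_def heat_def e_0 e_l)

lemma evol_derivs:
  assumes f: "L2_on {0..l} f" and x: "x \<in> {0..l}" and s: "0 < s"
  shows "((\<lambda>x. evol f x s) has_real_derivative evol1 f x s) (at x within {0..l})"
    "((\<lambda>x. evol1 f x s) has_real_derivative evol2 f x s) (at x within {0..l})"
    "((\<lambda>s. evol f x s) has_real_derivative D * evol2 f x s + q x * evol f x s) (at s)"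
proof -
  note pb = poly_bounded_coef[OF f poly_bounded_e] poly_bounded_coef[OF f poly_bounded_e1]
    poly_bounded_coef[OF f poly_bounded_e2]
  show "((\<lambda>x. evol f x s) has_real_derivative evol1 f x s) (at x within {0..l})"
    unfolding evol_def evol1_def using pb x s e_derivs(1)
    by (intro heat_derivative_space DERIV_cmult) auto
  show "((\<lambda>x. evol1 f x s) has_real_derivative evol2 f x s) (at x within {0..l})"
    unfolding evol1_def evol2_def using pb x s e_derivs(2)
    by (intro heat_derivative_space DERIV_cmult) auto
  \<comment> \<open>Termwise D e2 + q e = \<sigma> e, so the right-hand side of the equation is the
    termwise time derivative.\<close>
  have "D * evol2 f x s + q x * evol f x s
      = (\<Sum>n. D * (exp (\<sigma> (Suc n) * s) * (coef f (Suc n) * e2 (Suc n) x))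
          + q x * (exp (\<sigma> (Suc n) * s) * (coef f (Suc n) * e (Suc n) x)))"
    unfolding evol2_def evol_def heat_def
    using suminf_add[OF summable_mult[OF heat_summable[OF pb(3) x s], of D]
        summable_mult[OF heat_summable[OF pb(1) x s], of "q x"]]
      suminf_mult[OF heat_summable[OF pb(3) x s], of D] suminf_mult[OF heat_summable[OF pb(1) x s], of "q x"]
    by simp
  also have "\<dots> = heat (\<lambda>n x. \<sigma> (Suc n) * (coef f (Suc n) * e (Suc n) x)) x s"
    unfolding heat_def
  proof (intro arg_cong[where f=suminf] ext)
    fix n
    have "D * (E * (b * e2 (Suc n) x)) + q x * (E * (b * e (Suc n) x)) = E * (\<sigma> (Suc n) * (b * e (Suc n) x))"
      for E b using D_pos by (simp add: e2_def field_simps)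
    then show "D * (exp (\<sigma> (Suc n) * s) * (coef f (Suc n) * e2 (Suc n) x))
        + q x * (exp (\<sigma> (Suc n) * s) * (coef f (Suc n) * e (Suc n) x))
      = exp (\<sigma> (Suc n) * s) * (\<sigma> (Suc n) * (coef f (Suc n) * e (Suc n) x))" .
  qed
  finally show "((\<lambda>s. evol f x s) has_real_derivative D * evol2 f x s + q x * evol f x s) (at s)"
    unfolding evol_def using heat_derivative_time[OF pb(1) x s] by simp
qed

lemma evol_L2: "L2_on {0..l} f \<Longrightarrow> 0 < s \<Longrightarrow> L2_on {0..l} (\<lambda>x. evol f x s)"
  using derivative_continuous_on[OF evol_derivs(1)] by (intro L2_on_continuous) blast

text \<open>Compare with a partial sum \<open>S N\<close>: evol - S N is small uniformly for 0 < s <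
  1 by the tail of the squared coefficients, S N s - S N 0 is a finite sum of continuous terms, and
  S N 0 - f is small by \<open>expansion\<close>.\<close>

lemma evol_initial:
  assumes f: "L2_on {0..l} f"
  shows "((\<lambda>s. nsq (\<lambda>x. evol f x s - f x)) \<longlongrightarrow> 0) (at_right 0)"
proof (rule tendstoI)
  fix \<epsilon> :: real assume \<epsilon>: "\<epsilon> > 0"
  define b where "b = coef f"
  define S where "S N s x = (\<Sum>i=1..N. (b i * exp (\<sigma> i * s)) * e i x)" for N s x
  \<comment> \<open>Bounds the square of exp (\<sigma> s) for 0 < s < 1, because every eigenvalue is
    at most |\<mu>|.\<close>
  define K where "K = exp (2 * \<bar>\<mu>\<bar>)"
  have K: "K \<ge> 1" by (simp add: K_def)
  have LS: "L2_on {0..l} (S N s)" for N s unfolding S_def by (intro sum_e_L2) auto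
  have "summable (\<lambda>n. (b (Suc n))\<^sup>2)" unfolding b_def by (rule summable_coef_sq[OF f])
  then obtain N0 where N0: "\<And>m n. m \<ge> N0 \<Longrightarrow> norm (\<Sum>i=m..<n. (b (Suc i))\<^sup>2) < \<epsilon> / (16 * K)"
    using \<epsilon> K unfolding summable_Cauchy by (metis divide_pos_pos mult_pos_pos zero_less_numeral less_le_trans zero_less_one)
  have "\<forall>\<^sub>F N in sequentially. nsq (\<lambda>x. f x - S N 0 x) < \<epsilon> / 16"
    using order_tendstoD(2)[OF expansion[OF f], of "\<epsilon> / 16"] \<epsilon> by (simp add: S_def b_def)
  then obtain N1 where N1: "\<And>N. N \<ge> N1 \<Longrightarrow> nsq (\<lambda>x. f x - S N 0 x) < \<epsilon> / 16"
    by (auto simp: eventually_sequentially)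
  define N where "N = max N0 N1"
  have tail: "nsq (\<lambda>x. S M s x - S N s x) < \<epsilon> / 16"
    if "M \<ge> N" "0 < s" "s < 1" for M s
  proof -
    have "S M s x - S N s x = (\<Sum>i\<in>Suc ` {N..<M}. (b i * exp (\<sigma> i * s)) * e i x)" for x
      using sum.atLeastLessThan_concat[of 0 N M "\<lambda>i. (b (Suc i) * exp (\<sigma> (Suc i) * s)) * e (Suc i) x"] that
      by (simp add: S_def sum.atLeast1_atMost_eq sum.reindex lessThan_atLeast0 del: image_Suc_atLeastLessThan)
    then have "nsq (\<lambda>x. S M s x - S N s x) = (\<Sum>i\<in>Suc ` {N..<M}. (b i * exp (\<sigma> i * s))\<^sup>2)"
      using norm_sum_e[of "Suc ` {N..<M}" "\<lambda>i. b i * exp (\<sigma> i * s)"] by (simp del: image_Suc_atLeastLessThan) force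
    also have "\<dots> = (\<Sum>i=N..<M. (b (Suc i) * exp (\<sigma> (Suc i) * s))\<^sup>2)"
      by (simp add: sum.reindex del: image_Suc_atLeastLessThan)
    also have "\<dots> \<le> (\<Sum>i=N..<M. K * (b (Suc i))\<^sup>2)"
    proof (rule sum_mono)
      fix i
      have "\<sigma> (Suc i) \<le> \<bar>\<mu>\<bar>" using \<kappa>_Suc[of i] by (simp add: \<kappa>_def)
      then have "\<sigma> (Suc i) * s \<le> \<bar>\<mu>\<bar> * 1" using that by (intro mult_mono) auto
      then have "exp (2 * (\<sigma> (Suc i) * s)) \<le> K" by (simp add: K_def)
      moreover have "exp r * exp r = exp (2 * r)" for r :: real by (simp flip: exp_add)
      ultimately have "exp (\<sigma> (Suc i) * s) * exp (\<sigma> (Suc i) * s) \<le> K" by metis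
      then show "(b (Suc i) * exp (\<sigma> (Suc i) * s))\<^sup>2 \<le> K * (b (Suc i))\<^sup>2"
        unfolding power_mult_distrib
        by (subst mult.commute) (intro mult_right_mono, auto simp: power2_eq_square)
    qed
    also have "\<dots> = K * (\<Sum>i=N..<M. (b (Suc i))\<^sup>2)" by (simp add: sum_distrib_left)
    also have "\<dots> < K * (\<epsilon> / (16 * K))"
      using N0[of N M] K by (intro mult_strict_left_mono) (auto simp: N_def)
    also have "\<dots> = \<epsilon> / 16" using K by simp
    finally show ?thesis .
  qed
  \<comment> \<open>Orthonormality estimates differences of partial sums; letting \<open>M\<close>
    grow at fixed \<open>s\<close> transfers the bound to the full series.\<close>
  have A: "nsq (\<lambda>x. evol f x s - S N s x) \<le> \<epsilon> / 8" if s: "0 < s" "s < 1" for s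
  proof -
    have Le: "L2_on {0..l} (\<lambda>x. evol f x s)" using evol_L2[OF f] s by blast
    have Seq: "(\<Sum>n<M. exp (\<sigma> (Suc n) * s) * (b (Suc n) * e (Suc n) x)) = S M s x" for M x
      by (simp add: S_def sum.atLeast1_atMost_eq mult_ac)
    have "uniform_limit {0..l} (\<lambda>M. S M s) (\<lambda>x. evol f x s) sequentially"
      using uniform_limit_compose'[OF heat_uniform[OF poly_bounded_coef[OF f poly_bounded_e], of s s],
          of "\<lambda>x. (x, s)" "{0..l}"] s
      by (simp add: Seq[unfolded b_def] evol_def)
    then have "(\<lambda>M. nsq (\<lambda>x. S M s x - evol f x s)) \<longlonglongrightarrow> 0"
      using l_pos by (intro inner_on_uniform_limit always_eventually allI L2_on_diff LS Le) auto
    then have "(\<lambda>M. 2 * nsq (\<lambda>x. S M s x - evol f x s) + 2 * (\<epsilon> / 16)) \<longlonglongrightarrow> 2 * 0 + 2 * (\<epsilon> / 16)"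
      by (intro tendsto_intros)
    moreover have "nsq (\<lambda>x. evol f x s - S N s x)
      \<le> 2 * nsq (\<lambda>x. S M s x - evol f x s) + 2 * (\<epsilon> / 16)" if "M \<ge> N" for M
    proof -
      have "nsq (\<lambda>x. evol f x s - S N s x)
        = nsq (\<lambda>x. (evol f x s - S M s x) + (S M s x - S N s x))"
        by simp
      also have "\<dots> \<le> 2 * nsq (\<lambda>x. evol f x s - S M s x)
          + 2 * nsq (\<lambda>x. S M s x - S N s x)"
        by (intro inner_on_self_add_le L2_on_diff LS Le)
      also have "nsq (\<lambda>x. evol f x s - S M s x)
          = nsq (\<lambda>x. S M s x - evol f x s)"
        by (simp add: inner_on_self power2_commute)
      finally show ?thesis using tail[OF that s] by linarith
    qed
    then have "\<forall>\<^sub>F M in sequentially. nsq (\<lambda>x. evol f x s - S N s x)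
      \<le> 2 * nsq (\<lambda>x. S M s x - evol f x s) + 2 * (\<epsilon> / 16)"
      unfolding eventually_sequentially by blast
    ultimately show ?thesis using tendsto_lowerbound[of _ "2 * 0 + 2 * (\<epsilon> / 16)"] by fastforce
  qed
  have "((\<lambda>s. \<Sum>i=1..N. (b i * exp (\<sigma> i * s) - b i)\<^sup>2) \<longlongrightarrow> (\<Sum>i=1..N. (b i * exp (\<sigma> i * 0) - b i)\<^sup>2)) (at_right 0)"
    by (intro tendsto_intros)
  then have "\<forall>\<^sub>F s in at_right 0. (\<Sum>i=1..N. (b i * exp (\<sigma> i * s) - b i)\<^sup>2) < \<epsilon> / 16"
    using \<epsilon> by (intro order_tendstoD) auto
  moreover have "\<forall>\<^sub>F s::real in at_right 0. 0 < s" by (simp add: eventually_at_right_less)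
  moreover have "\<forall>\<^sub>F s::real in at_right 0. s < 1" by (rule order_tendstoD(2)[OF tendsto_ident_at]) simp
  ultimately show "\<forall>\<^sub>F s in at_right 0. dist (nsq (\<lambda>x. evol f x s - f x)) 0 < \<epsilon>"
  proof eventually_elim
    case (elim s)
    have Le: "L2_on {0..l} (\<lambda>x. evol f x s)" using evol_L2[OF f] elim by blast
    have "S N s x - S N 0 x = (\<Sum>i=1..N. (b i * exp (\<sigma> i * s) - b i) * e i x)" for x
      by (simp add: S_def sum_subtractf left_diff_distrib)
    then have 2: "nsq (\<lambda>x. S N s x - S N 0 x) < \<epsilon> / 16"
      using norm_sum_e[of "{1..N}" "\<lambda>i. b i * exp (\<sigma> i * s) - b i"] elim by simp
    have 3: "nsq (\<lambda>x. S N 0 x - f x) < \<epsilon> / 16"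
      using N1[of N] by (simp add: N_def inner_on_self power2_commute)
    have "nsq (\<lambda>x. S N s x - f x)
      = nsq (\<lambda>x. (S N s x - S N 0 x) + (S N 0 x - f x))" by simp
    also have "\<dots> \<le> 2 * nsq (\<lambda>x. S N s x - S N 0 x)
        + 2 * nsq (\<lambda>x. S N 0 x - f x)"
      by (intro inner_on_self_add_le L2_on_diff LS f)
    finally have 4: "nsq (\<lambda>x. S N s x - f x) < \<epsilon> / 4" using 2 3 by simp
    have "nsq (\<lambda>x. evol f x s - f x)
      = nsq (\<lambda>x. (evol f x s - S N s x) + (S N s x - f x))" by simp
    also have "\<dots> \<le> 2 * nsq (\<lambda>x. evol f x s - S N s x)
        + 2 * nsq (\<lambda>x. S N s x - f x)"
      by (intro inner_on_self_add_le L2_on_diff LS f Le)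
    also have "\<dots> < \<epsilon>" using 4 A[of s] elim \<epsilon> by linarith
    finally show ?case using inner_on_self_nonneg[of "{0..l}" "\<lambda>x. evol f x s - f x"] by simp
  qed
qed

end

section \<open>Evolution of the coefficients of a solution\<close>

lemma continuous_on_slice:
  assumes "continuous_on (A \<times> B) (\<lambda>(x, t). f x t)" "t \<in> B"
  shows "continuous_on A (\<lambda>x. f x t)"
proof -
  have "continuous_on A (\<lambda>x. (x, t))" by (intro continuous_on_Pair continuous_on_id continuous_on_const)
  from continuous_on_compose2[OF assms(1) this] assms(2) show ?thesis by auto
qed

context sl_system
begin

text \<open>With the integrating factor exp (- s K), the truncated coefficient
  \<open>c \<epsilon>\<close> has derivative exp (- s K) k R, where \<open>R\<close> tends to 0 with
  \<open>\<epsilon>\<close> uniformly in time. The mean value inequality and the limit \<epsilon> ->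
  0 then make exp (- s K) times the full coefficient constant. Continuity of \<open>v\<close> on the
  closed rectangle is what makes \<open>R\<close> small.\<close>

lemma coef_evolution:
  fixes v vt vx vxx :: "real \<Rightarrow> real \<Rightarrow> real" and K k :: "real \<Rightarrow> real"
  assumes t12: "t1 < t2"
    and vc: "continuous_on ({0..l} \<times> {t1..t2}) (\<lambda>(x, t). v x t)"
    and vtc: "continuous_on ({0<..<l} \<times> {t1..t2}) (\<lambda>(x, t). vt x t)"
    and vxxc: "continuous_on ({0<..<l} \<times> {t1..t2}) (\<lambda>(x, t). vxx x t)"
    and dt: "\<And>x t. x \<in> {0<..<l} \<Longrightarrow> t \<in> {t1..t2} \<Longrightarrow> (v x has_real_derivative vt x t) (at t within {t1..t2})"
    and dx: "\<And>x t. x \<in> {0<..<l} \<Longrightarrow> t \<in> {t1..t2} \<Longrightarrow> ((\<lambda>x. v x t) has_real_derivative vx x t) (at x)"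
    and dxx: "\<And>x t. x \<in> {0<..<l} \<Longrightarrow> t \<in> {t1..t2} \<Longrightarrow> ((\<lambda>x. vx x t) has_real_derivative vxx x t) (at x)"
    and pde: "\<And>x t. x \<in> {0<..<l} \<Longrightarrow> t \<in> {t1..t2} \<Longrightarrow> vt x t = k t * (D * vxx x t + q x * v x t)"
    and bd: "\<And>t. t \<in> {t1..t2} \<Longrightarrow> v 0 t = 0" "\<And>t. t \<in> {t1..t2} \<Longrightarrow> v l t = 0"
    and K: "\<And>t. t \<in> {t1..t2} \<Longrightarrow> (K has_real_derivative k t) (at t within {t1..t2})"
    and kc: "continuous_on {t1..t2} k" and n: "n \<ge> 1"
  shows "exp (- \<sigma> n * K t2) * ip (\<lambda>x. v x t2) (e n) = exp (- \<sigma> n * K t1) * ip (\<lambda>x. v x t1) (e n)"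
proof -
  let ?T = "{t1..t2}" and ?I = "{0..l}"
  let ?F = "at_right (0 :: real)"
  define E where "E = e n"
  define s where "s = \<sigma> n"
  have Ec: "continuous_on ?I E" and E1c: "continuous_on ?I (e1 n)" and E2c: "continuous_on ?I (e2 n)"
    unfolding E_def using e_continuous e1_continuous e2_continuous n by auto
  have E0: "E 0 = 0" "E l = 0" using e_0 e_l n by (auto simp: E_def)
  have Kc: "continuous_on ?T K" using K by (rule derivative_continuous_on)
  have v_x: "continuous_on ?I (\<lambda>x. v x t)" if "t \<in> ?T" for t
    by (rule continuous_on_slice[OF vc that])
  obtain M where M: "M \<ge> 0" "\<And>x t. x \<in> ?I \<Longrightarrow> t \<in> ?T \<Longrightarrow> \<bar>v x t\<bar> \<le> M"
  proof -
    have "bounded ((\<lambda>(x, t). v x t) ` (?I \<times> ?T))"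
      using compact_continuous_image[OF vc] compact_Times compact_imp_bounded by blast
    then obtain M where M: "\<forall>z\<in>?I \<times> ?T. \<bar>case z of (x, t) \<Rightarrow> v x t\<bar> \<le> M" by (auto simp: bounded_iff)
    have "\<bar>v x t\<bar> \<le> max M 0" if "x \<in> ?I" "t \<in> ?T" for x t
      using bspec[OF M, of "(x, t)"] that by auto
    then show thesis using that[of "max M 0"] by auto
  qed
  obtain G where G: "G \<ge> 0" "\<And>x. x \<in> ?I \<Longrightarrow> \<bar>e1 n x\<bar> \<le> G" using bounded_continuous_Icc[OF E1c] by blast
  obtain Q where Q: "Q \<ge> 0" "\<And>x. x \<in> ?I \<Longrightarrow> \<bar>s - q x\<bar> \<le> Q"
    using bounded_continuous_Icc[of 0 l "\<lambda>x. s - q x"] cont_q continuous_on_diff continuous_on_const by blast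
  have "continuous_on ?T (\<lambda>t. exp (- s * K t) * k t)" using Kc kc by (auto intro!: continuous_intros)
  then obtain A where A: "A \<ge> 0" "\<And>t. t \<in> ?T \<Longrightarrow> \<bar>exp (- s * K t) * k t\<bar> \<le> A"
    using bounded_continuous_Icc by blast
  \<comment> \<open>Slope of the affine interpolant \<open>L \<epsilon>\<close> of \<open>E\<close>
    between \<epsilon> and l - \<epsilon>; the mean value inequality bounds it by \<open>G\<close>
    for every \<epsilon>.\<close>
  define m where "m \<epsilon> = (E (l - \<epsilon>) - E \<epsilon>) / (l - 2 * \<epsilon>)" for \<epsilon>
  define L where "L \<epsilon> x = E \<epsilon> + (x - \<epsilon>) * m \<epsilon>" for \<epsilon> x
  define \<phi> where "\<phi> \<epsilon> x = E x - L \<epsilon> x" for \<epsilon> x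
  \<comment> \<open>\<open>\<phi> \<epsilon>\<close> vanishes at \<open>\<epsilon>\<close> and \<open>l - \<epsilon>\<close>, so integrating by parts leaves no boundary term with \<open>vx\<close>,
    about which nothing is known near the ends of the interval.\<close>
  define \<alpha> where "\<alpha> \<epsilon> = \<bar>E \<epsilon>\<bar> + \<bar>E (l - \<epsilon>)\<bar>" for \<epsilon>
  define c where "c \<epsilon> t = integral {\<epsilon>..l - \<epsilon>} (\<lambda>x. v x t * \<phi> \<epsilon> x)" for \<epsilon> t
  \<comment> \<open>Two defects make up the remainder: \<open>L \<epsilon>\<close> does not satisfy
    the eigenvalue equation, and \<open>v\<close> times the derivative of
    \<open>\<phi> \<epsilon>\<close> survives at the two ends.\<close>
  define R where "R \<epsilon> t = integral {\<epsilon>..l - \<epsilon>} (\<lambda>x. v x t * ((s - q x) * L \<epsilon> x))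
      - D * (v (l - \<epsilon>) t * (e1 n (l - \<epsilon>) - m \<epsilon>) - v \<epsilon> t * (e1 n \<epsilon> - m \<epsilon>))" for \<epsilon> t
  have Lc: "continuous_on X (L \<epsilon>)" for \<epsilon> X unfolding L_def[abs_def] by (intro continuous_intros)
  have m_le: "\<bar>m \<epsilon>\<bar> \<le> G" if "0 < \<epsilon>" "\<epsilon> < l / 2" for \<epsilon>
  proof -
    have "norm (E (l - \<epsilon>) - E \<epsilon>) \<le> G * norm (l - \<epsilon> - \<epsilon>)"
      unfolding E_def using that G(2) by (intro field_differentiable_bound[OF convex_real_interval(5) e_derivs(1)[OF n]]) auto
    then show ?thesis using that by (simp add: m_def field_simps)
  qed
  have L_le: "\<bar>L \<epsilon> x\<bar> \<le> \<alpha> \<epsilon>" if \<epsilon>: "0 < \<epsilon>" "\<epsilon> < l / 2" and x: "x \<in> {\<epsilon>..l - \<epsilon>}" for \<epsilon> x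
  proof -
    define \<theta> where "\<theta> = (x - \<epsilon>) / (l - 2 * \<epsilon>)"
    have \<theta>: "0 \<le> \<theta>" "\<theta> \<le> 1" using \<epsilon> x by (auto simp: \<theta>_def)
    have "L \<epsilon> x = E \<epsilon> + \<theta> * (E (l - \<epsilon>) - E \<epsilon>)" by (simp add: L_def m_def \<theta>_def)
    then have "L \<epsilon> x = (1 - \<theta>) * E \<epsilon> + \<theta> * E (l - \<epsilon>)" by (simp add: algebra_simps)
    also have "\<bar>\<dots>\<bar> \<le> (1 - \<theta>) * \<bar>E \<epsilon>\<bar> + \<theta> * \<bar>E (l - \<epsilon>)\<bar>"
      using abs_triangle_ineq[of "(1 - \<theta>) * E \<epsilon>" "\<theta> * E (l - \<epsilon>)"] \<theta> by (simp add: abs_mult)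
    also have "\<dots> \<le> 1 * \<bar>E \<epsilon>\<bar> + 1 * \<bar>E (l - \<epsilon>)\<bar>" using \<theta> by (intro add_mono mult_right_mono) auto
    finally show ?thesis by (simp add: \<alpha>_def)
  qed
  have \<phi>0: "\<phi> \<epsilon> \<epsilon> = 0" "\<phi> \<epsilon> (l - \<epsilon>) = 0" if "0 < \<epsilon>" "\<epsilon> < l / 2" for \<epsilon>
    using that by (auto simp: \<phi>_def L_def m_def field_simps)
  have sub: "{\<epsilon>..l - \<epsilon>} \<subseteq> ?I" "{\<epsilon>..l - \<epsilon>} \<subseteq> {0<..<l}" if "0 < \<epsilon>" for \<epsilon> using that by auto
  have \<phi>c: "continuous_on {\<epsilon>..l - \<epsilon>} (\<phi> \<epsilon>)" if "0 < \<epsilon>" for \<epsilon>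
    unfolding \<phi>_def[abs_def] using Lc continuous_on_subset[OF Ec sub(1)[OF that]] by (intro continuous_intros)
  have vc': "continuous_on {\<epsilon>..l - \<epsilon>} (\<lambda>x. v x t)" if "0 < \<epsilon>" "t \<in> ?T" for \<epsilon> t
    using continuous_on_subset[OF v_x sub(1)] that by blast
  have vxxc': "continuous_on {\<epsilon>..l - \<epsilon>} (\<lambda>x. vxx x t)" if "0 < \<epsilon>" "t \<in> ?T" for \<epsilon> t
    using continuous_on_subset[OF continuous_on_slice[OF vxxc that(2)] sub(2)[OF that(1)]] .
  have dc: "(c \<epsilon> has_real_derivative integral {\<epsilon>..l - \<epsilon>} (\<lambda>x. vt x t * \<phi> \<epsilon> x)) (at t within ?T)"
    if \<epsilon>: "0 < \<epsilon>" "\<epsilon> < l / 2" and t: "t \<in> ?T" for \<epsilon> t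
  proof -
    have "((\<lambda>t. integral (cbox \<epsilon> (l - \<epsilon>)) (\<lambda>x. v x t * \<phi> \<epsilon> x)) has_field_derivative
        integral (cbox \<epsilon> (l - \<epsilon>)) (\<lambda>x. vt x t * \<phi> \<epsilon> x)) (at t within ?T)"
    proof (rule leibniz_rule_field_derivative[OF _ _ _ t convex_real_interval(5)])
      show "((\<lambda>t. v x t * \<phi> \<epsilon> x) has_real_derivative vt x t * \<phi> \<epsilon> x) (at t within ?T)"
        if "t \<in> ?T" "x \<in> cbox \<epsilon> (l - \<epsilon>)" for t x
        using dt[of x t] that \<epsilon> by (intro DERIV_cmult_right) auto
      show "(\<lambda>x. v x t * \<phi> \<epsilon> x) integrable_on cbox \<epsilon> (l - \<epsilon>)" if "t \<in> ?T" for t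
        using vc'[OF \<epsilon>(1) that] \<phi>c[OF \<epsilon>(1)]
        by (auto intro!: integrable_continuous_real continuous_intros)
      have 1: "continuous_on (?T \<times> cbox \<epsilon> (l - \<epsilon>)) (\<lambda>z. case (snd z, fst z) of (x, t) \<Rightarrow> vt x t)"
        using \<epsilon> by (intro continuous_on_compose2[OF vtc]) (auto intro!: continuous_intros)
      have 2: "continuous_on (?T \<times> cbox \<epsilon> (l - \<epsilon>)) (\<lambda>z. \<phi> \<epsilon> (snd z))"
        using \<epsilon> by (intro continuous_on_compose2[OF \<phi>c[OF \<epsilon>(1)]]) (auto intro!: continuous_intros)
      show "continuous_on (?T \<times> cbox \<epsilon> (l - \<epsilon>)) (\<lambda>(t, x). vt x t * \<phi> \<epsilon> x)"
        using continuous_on_mult[OF 1 2] by (simp add: case_prod_beta')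
    qed
    then show ?thesis by (simp add: c_def[abs_def])
  qed
  have ceq: "integral {\<epsilon>..l - \<epsilon>} (\<lambda>x. vt x t * \<phi> \<epsilon> x) = k t * (s * c \<epsilon> t + R \<epsilon> t)"
    if \<epsilon>: "0 < \<epsilon>" "\<epsilon> < l / 2" and t: "t \<in> ?T" for \<epsilon> t
  proof -
    let ?J = "{\<epsilon>..l - \<epsilon>}"
    note c1 = vc'[OF \<epsilon>(1) t] vxxc'[OF \<epsilon>(1) t] \<phi>c[OF \<epsilon>(1)] Lc
      continuous_on_subset[OF E2c sub(1)[OF \<epsilon>(1)]] continuous_on_subset[OF cont_q sub(1)[OF \<epsilon>(1)]]
    have "((\<lambda>x. vx x t * \<phi> \<epsilon> x - v x t * (e1 n x - m \<epsilon>)) has_real_derivative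
        vxx x t * \<phi> \<epsilon> x - v x t * e2 n x) (at x within ?J)" if x: "x \<in> ?J" for x
    proof -
      have xI: "x \<in> ?I" "x \<in> {0<..<l}" using sub[OF \<epsilon>(1)] x by auto
      have d\<phi>: "(\<phi> \<epsilon> has_real_derivative e1 n x - m \<epsilon>) (at x within ?J)"
        unfolding \<phi>_def[abs_def] L_def E_def
        using DERIV_subset[OF e_derivs(1)[OF n xI(1)] sub(1)[OF \<epsilon>(1)]]
        by (auto intro!: derivative_eq_intros)
      note [derivative_intros] = d\<phi> DERIV_subset[OF e_derivs(2)[OF n xI(1)] sub(1)[OF \<epsilon>(1)]]
        DERIV_subset[OF dx[OF xI(2) t] subset_UNIV] DERIV_subset[OF dxx[OF xI(2) t] subset_UNIV]
      show ?thesis by (rule derivative_eq_intros refl)+ (simp add: algebra_simps)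
    qed
    from integral_derivative[OF _ this] \<epsilon>
    have I1: "((\<lambda>x. vxx x t * \<phi> \<epsilon> x - v x t * e2 n x) has_integral
        - (v (l - \<epsilon>) t * (e1 n (l - \<epsilon>) - m \<epsilon>)) + v \<epsilon> t * (e1 n \<epsilon> - m \<epsilon>)) ?J"
      by (simp add: \<phi>0)
    have I2: "((\<lambda>x. v x t * \<phi> \<epsilon> x) has_integral c \<epsilon> t) ?J"
      unfolding c_def by (intro integrable_integral integrable_continuous_real continuous_on_mult c1)
    have I3: "((\<lambda>x. v x t * ((s - q x) * L \<epsilon> x)) has_integral
        integral ?J (\<lambda>x. v x t * ((s - q x) * L \<epsilon> x))) ?J"
      by (intro integrable_integral integrable_continuous_real continuous_on_mult continuous_on_diff continuous_on_const c1)
    have "((\<lambda>x. k t * (s * (v x t * \<phi> \<epsilon> x) + (v x t * ((s - q x) * L \<epsilon> x)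
        + D * (vxx x t * \<phi> \<epsilon> x - v x t * e2 n x)))) has_integral
      k t * (s * c \<epsilon> t + (integral ?J (\<lambda>x. v x t * ((s - q x) * L \<epsilon> x))
        + D * (- (v (l - \<epsilon>) t * (e1 n (l - \<epsilon>) - m \<epsilon>)) + v \<epsilon> t * (e1 n \<epsilon> - m \<epsilon>))))) ?J"
      by (intro has_integral_mult_right has_integral_add I1 I2 I3)
    also have "(integral ?J (\<lambda>x. v x t * ((s - q x) * L \<epsilon> x))
        + D * (- (v (l - \<epsilon>) t * (e1 n (l - \<epsilon>) - m \<epsilon>)) + v \<epsilon> t * (e1 n \<epsilon> - m \<epsilon>))) = R \<epsilon> t"
      by (simp add: R_def algebra_simps)
    finally have H: "((\<lambda>x. k t * (s * (v x t * \<phi> \<epsilon> x) + (v x t * ((s - q x) * L \<epsilon> x)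
        + D * (vxx x t * \<phi> \<epsilon> x - v x t * e2 n x)))) has_integral k t * (s * c \<epsilon> t + R \<epsilon> t)) ?J" .
    have "k t * (s * (v x t * \<phi> \<epsilon> x) + (v x t * ((s - q x) * L \<epsilon> x)
        + D * (vxx x t * \<phi> \<epsilon> x - v x t * e2 n x))) = vt x t * \<phi> \<epsilon> x" if x: "x \<in> ?J" for x
    proof -
      have xI: "x \<in> {0<..<l}" using sub[OF \<epsilon>(1)] x by auto
      have De2: "D * e2 n x = (s - q x) * (\<phi> \<epsilon> x + L \<epsilon> x)"
        using D_pos by (simp add: e2_def s_def \<phi>_def E_def)
      have "s * (v x t * \<phi> \<epsilon> x) + (v x t * ((s - q x) * L \<epsilon> x) + D * (vxx x t * \<phi> \<epsilon> x - v x t * e2 n x))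
        = s * (v x t * \<phi> \<epsilon> x) + (v x t * ((s - q x) * L \<epsilon> x) + (D * vxx x t * \<phi> \<epsilon> x - v x t * (D * e2 n x)))"
        by (simp add: algebra_simps)
      also have "\<dots> = (D * vxx x t + q x * v x t) * \<phi> \<epsilon> x" unfolding De2 by (simp add: algebra_simps)
      finally show ?thesis using pde[OF xI t] by (simp add: mult.assoc)
    qed
    from has_integral_eq[OF this H] show ?thesis by (simp add: integral_unique)
  qed
  define Z where "Z \<epsilon> t = exp (- s * K t) * c \<epsilon> t" for \<epsilon> t
  have dZ: "(Z \<epsilon> has_real_derivative exp (- s * K t) * k t * R \<epsilon> t) (at t within ?T)"
    if \<epsilon>: "0 < \<epsilon>" "\<epsilon> < l / 2" and t: "t \<in> ?T" for \<epsilon> t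
  proof -
    note [derivative_intros] = K[OF t] dc[OF \<epsilon> t, unfolded ceq[OF \<epsilon> t]]
    show ?thesis unfolding Z_def[abs_def]
      by (rule derivative_eq_intros refl)+ (simp add: algebra_simps)
  qed
  have R_le: "\<bar>R \<epsilon> t\<bar> \<le> M * (Q * \<alpha> \<epsilon>) * l + D * (2 * G) * (\<bar>v (l - \<epsilon>) t\<bar> + \<bar>v \<epsilon> t\<bar>)"
    if \<epsilon>: "0 < \<epsilon>" "\<epsilon> < l / 2" and t: "t \<in> ?T" for \<epsilon> t
  proof -
    let ?J = "{\<epsilon>..l - \<epsilon>}"
    have \<alpha>0: "\<alpha> \<epsilon> \<ge> 0" by (simp add: \<alpha>_def)
    have "norm (integral ?J (\<lambda>x. v x t * ((s - q x) * L \<epsilon> x))) \<le> M * (Q * \<alpha> \<epsilon>) * (l - \<epsilon> - \<epsilon>)"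
    proof (rule integral_bound)
      show "continuous_on ?J (\<lambda>x. v x t * ((s - q x) * L \<epsilon> x))"
        by (intro continuous_on_mult continuous_on_diff continuous_on_const vc'[OF \<epsilon>(1) t] Lc
            continuous_on_subset[OF cont_q sub(1)[OF \<epsilon>(1)]])
      fix x assume x: "x \<in> ?J"
      then have xI: "x \<in> ?I" using sub[OF \<epsilon>(1)] by auto
      show "norm (v x t * ((s - q x) * L \<epsilon> x)) \<le> M * (Q * \<alpha> \<epsilon>)"
        unfolding real_norm_def abs_mult using M Q \<alpha>0 xI t L_le[OF \<epsilon> x] by (intro mult_mono) auto
    qed (use \<epsilon> in auto)
    also have "\<dots> \<le> M * (Q * \<alpha> \<epsilon>) * l" using \<epsilon> M Q \<alpha>0 by (intro mult_left_mono) auto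
    finally have 1: "\<bar>integral ?J (\<lambda>x. v x t * ((s - q x) * L \<epsilon> x))\<bar> \<le> M * (Q * \<alpha> \<epsilon>) * l" by simp
    have g: "\<bar>e1 n x - m \<epsilon>\<bar> \<le> 2 * G" if "x \<in> ?I" for x
      using G(2)[OF that] m_le[OF \<epsilon>] by linarith
    have "\<bar>v x t * (e1 n x - m \<epsilon>)\<bar> \<le> 2 * G * \<bar>v x t\<bar>" if "x \<in> ?I" for x
      using g[OF that] by (simp add: abs_mult mult.commute mult_left_mono)
    from this[of "l - \<epsilon>"] this[of \<epsilon>] \<epsilon>
    have "\<bar>v (l - \<epsilon>) t * (e1 n (l - \<epsilon>) - m \<epsilon>) - v \<epsilon> t * (e1 n \<epsilon> - m \<epsilon>)\<bar> \<le> 2 * G * (\<bar>v (l - \<epsilon>) t\<bar> + \<bar>v \<epsilon> t\<bar>)"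
      by (simp add: distrib_left)
    then have "\<bar>D * (v (l - \<epsilon>) t * (e1 n (l - \<epsilon>) - m \<epsilon>) - v \<epsilon> t * (e1 n \<epsilon> - m \<epsilon>))\<bar>
        \<le> D * (2 * G * (\<bar>v (l - \<epsilon>) t\<bar> + \<bar>v \<epsilon> t\<bar>))"
      using D_pos by (simp add: abs_mult)
    with 1 show ?thesis unfolding R_def by (simp add: mult.assoc)
  qed
  have ev_pos: "\<forall>\<^sub>F \<epsilon> in ?F. 0 < \<epsilon> \<and> \<epsilon> < l / 2"
    using order_tendstoD(2)[OF tendsto_ident_at, of 0 "l / 2" "{0<..}"] l_pos
    by (intro eventually_conj eventually_at_right_less) simp
  have lim_l: "((\<lambda>\<epsilon>. l - \<epsilon>) \<longlongrightarrow> l) ?F" by (auto intro!: tendsto_eq_intros)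
  have ev_in: "\<forall>\<^sub>F \<epsilon> in ?F. \<epsilon> \<in> ?I" "\<forall>\<^sub>F \<epsilon> in ?F. l - \<epsilon> \<in> ?I"
    using ev_pos by (auto elim!: eventually_mono)
  have lim0: "(f \<longlongrightarrow> f 0) ?F" and liml: "((\<lambda>\<epsilon>. f (l - \<epsilon>)) \<longlongrightarrow> f l) ?F"
    if "continuous_on ?I f" for f :: "real \<Rightarrow> real"
    using continuous_on_tendsto_compose[OF that tendsto_ident_at _ ev_in(1)]
      continuous_on_tendsto_compose[OF that lim_l _ ev_in(2)] l_pos by auto
  have \<alpha>0: "(\<alpha> \<longlongrightarrow> 0) ?F"
    using tendsto_add[OF tendsto_rabs[OF lim0[OF Ec]] tendsto_rabs[OF liml[OF Ec]]]
    by (simp add: \<alpha>_def[abs_def] E0)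
  \<comment> \<open>The remainder is needed over the whole time interval, so smallness of
    \<open>v\<close> near the ends must be uniform in \<open>t\<close>; compactness of the rectangle
    provides this.\<close>
  have v_small: "\<forall>\<^sub>F \<epsilon> in ?F. \<forall>t\<in>?T. \<bar>v \<epsilon> t\<bar> < \<delta> \<and> \<bar>v (l - \<epsilon>) t\<bar> < \<delta>" if \<delta>: "\<delta> > 0" for \<delta>
  proof -
    have "uniformly_continuous_on (?I \<times> ?T) (\<lambda>(x, t). v x t)"
      by (intro compact_uniformly_continuous vc compact_Times compact_Icc)
    then obtain \<eta> where \<eta>: "\<eta> > 0" "\<And>z z'. z \<in> ?I \<times> ?T \<Longrightarrow> z' \<in> ?I \<times> ?T \<Longrightarrow> dist z' z < \<eta> \<Longrightarrow>
        dist (case z' of (x, t) \<Rightarrow> v x t) (case z of (x, t) \<Rightarrow> v x t) < \<delta>"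
      unfolding uniformly_continuous_on_def using \<delta> by metis
    have "\<forall>\<^sub>F \<epsilon> in ?F. \<epsilon> < \<eta>" by (rule order_tendstoD(2)[OF tendsto_ident_at \<eta>(1)])
    with ev_pos show ?thesis
    proof eventually_elim
      case (elim \<epsilon>)
      show ?case
      proof
        fix t assume t: "t \<in> ?T"
        show "\<bar>v \<epsilon> t\<bar> < \<delta> \<and> \<bar>v (l - \<epsilon>) t\<bar> < \<delta>"
          using \<eta>(2)[of "(0, t)" "(\<epsilon>, t)"] \<eta>(2)[of "(l, t)" "(l - \<epsilon>, t)"] elim t bd[OF t]
          by (auto simp: dist_Pair_Pair dist_real_def)
      qed
    qed
  qed
  have clim: "((\<lambda>\<epsilon>. c \<epsilon> t) \<longlongrightarrow> ip (\<lambda>x. v x t) E) ?F" if t: "t \<in> ?T" for t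
  proof -
    have vE: "continuous_on ?I (\<lambda>x. v x t * E x)" by (intro continuous_on_mult v_x t Ec)
    \<comment> \<open>An antiderivative of v E turns the moving limits of integration into
      continuity of \<open>P\<close>.\<close>
    define P where "P x = integral {0..x} (\<lambda>x. v x t * E x)" for x
    have Pc: "continuous_on ?I P"
      unfolding P_def by (intro indefinite_integral_continuous_1 integrable_continuous_real vE)
    have "((\<lambda>\<epsilon>. P (l - \<epsilon>) - P \<epsilon>) \<longlongrightarrow> P l - P 0) ?F" by (intro tendsto_diff lim0 liml Pc)
    then have 1: "((\<lambda>\<epsilon>. P (l - \<epsilon>) - P \<epsilon>) \<longlongrightarrow> ip (\<lambda>x. v x t) E) ?F"
      using inner_on_eq_integral[OF v_x[OF t] Ec] by (simp add: P_def)
    have 2: "((\<lambda>\<epsilon>. integral {\<epsilon>..l - \<epsilon>} (\<lambda>x. v x t * L \<epsilon> x)) \<longlongrightarrow> 0) ?F"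
    proof (rule Lim_null_comparison)
      show "((\<lambda>\<epsilon>. M * \<alpha> \<epsilon> * l) \<longlongrightarrow> 0) ?F" using \<alpha>0 by (auto intro!: tendsto_eq_intros)
      show "\<forall>\<^sub>F \<epsilon> in ?F. norm (integral {\<epsilon>..l - \<epsilon>} (\<lambda>x. v x t * L \<epsilon> x)) \<le> M * \<alpha> \<epsilon> * l"
        using ev_pos
      proof eventually_elim
        case (elim \<epsilon>)
        then have \<epsilon>: "0 < \<epsilon>" "\<epsilon> < l / 2" by auto
        have "norm (integral {\<epsilon>..l - \<epsilon>} (\<lambda>x. v x t * L \<epsilon> x)) \<le> M * \<alpha> \<epsilon> * (l - \<epsilon> - \<epsilon>)"
        proof (rule integral_bound)
          fix x assume x: "x \<in> {\<epsilon>..l - \<epsilon>}"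
          then have xI: "x \<in> ?I" using sub[OF \<epsilon>(1)] by auto
          show "norm (v x t * L \<epsilon> x) \<le> M * \<alpha> \<epsilon>"
            unfolding real_norm_def abs_mult using M xI t L_le[OF \<epsilon> x] by (intro mult_mono) auto
        qed (use \<epsilon> in \<open>auto intro!: continuous_on_mult Lc vc'[OF \<epsilon>(1) t]\<close>)
        also have "\<dots> \<le> M * \<alpha> \<epsilon> * l" using \<epsilon> M by (intro mult_left_mono) (auto simp: \<alpha>_def)
        finally show ?case .
      qed
    qed
    have "((\<lambda>\<epsilon>. (P (l - \<epsilon>) - P \<epsilon>) - integral {\<epsilon>..l - \<epsilon>} (\<lambda>x. v x t * L \<epsilon> x)) \<longlongrightarrow> ip (\<lambda>x. v x t) E) ?F"
      using tendsto_diff[OF 1 2] by simp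
    moreover have "\<forall>\<^sub>F \<epsilon> in ?F. (P (l - \<epsilon>) - P \<epsilon>) - integral {\<epsilon>..l - \<epsilon>} (\<lambda>x. v x t * L \<epsilon> x) = c \<epsilon> t"
      using ev_pos
    proof eventually_elim
      case (elim \<epsilon>)
      then have \<epsilon>: "0 < \<epsilon>" "\<epsilon> < l / 2" by auto
      have "(\<lambda>x. v x t * E x) integrable_on {0..l - \<epsilon>}"
        using \<epsilon> by (intro integrable_continuous_real continuous_on_subset[OF vE]) auto
      then have "P \<epsilon> + integral {\<epsilon>..l - \<epsilon>} (\<lambda>x. v x t * E x) = P (l - \<epsilon>)"
        unfolding P_def using \<epsilon> by (intro Henstock_Kurzweil_Integration.integral_combine) auto
      moreover have "c \<epsilon> t = integral {\<epsilon>..l - \<epsilon>} (\<lambda>x. v x t * E x) - integral {\<epsilon>..l - \<epsilon>} (\<lambda>x. v x t * L \<epsilon> x)"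
        unfolding c_def \<phi>_def[abs_def] right_diff_distrib
        by (intro Henstock_Kurzweil_Integration.integral_diff integrable_continuous_real continuous_on_mult
            vc'[OF \<epsilon>(1) t] Lc continuous_on_subset[OF Ec sub(1)[OF \<epsilon>(1)]])
      ultimately show ?case by linarith
    qed
    ultimately show ?thesis by (rule Lim_transform_eventually)
  qed
  define Zl where "Zl t = exp (- s * K t) * ip (\<lambda>x. v x t) E" for t
  have Zlim: "((\<lambda>\<epsilon>. Z \<epsilon> t) \<longlongrightarrow> Zl t) ?F" if "t \<in> ?T" for t
    unfolding Z_def Zl_def by (intro tendsto_mult_left clim that)
  \<comment> \<open>For small \<epsilon>, \<open>\<alpha> \<epsilon>\<close> and the values of
    \<open>v\<close> at the two ends are all below \<open>\<delta>\<close>; the boundary terms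
    contribute 2 D G (\<delta> + \<delta>) = 4 D G \<delta>.\<close>
  have bnd: "\<bar>Zl t2 - Zl t1\<bar> \<le> A * ((M * Q * l + 4 * D * G) * \<delta>) * (t2 - t1)" if \<delta>: "\<delta> > 0" for \<delta>
  proof (rule tendsto_upperbound)
    show "((\<lambda>\<epsilon>. \<bar>Z \<epsilon> t2 - Z \<epsilon> t1\<bar>) \<longlongrightarrow> \<bar>Zl t2 - Zl t1\<bar>) ?F"
      using t12 by (intro tendsto_intros Zlim) auto
    have "\<forall>\<^sub>F \<epsilon> in ?F. \<alpha> \<epsilon> < \<delta>" by (rule order_tendstoD(2)[OF \<alpha>0 \<delta>])
    with ev_pos v_small[OF \<delta>]
    show "\<forall>\<^sub>F \<epsilon> in ?F. \<bar>Z \<epsilon> t2 - Z \<epsilon> t1\<bar> \<le> A * ((M * Q * l + 4 * D * G) * \<delta>) * (t2 - t1)"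
    proof eventually_elim
      case (elim \<epsilon>)
      then have \<epsilon>: "0 < \<epsilon>" "\<epsilon> < l / 2" by auto
      have "norm (Z \<epsilon> t2 - Z \<epsilon> t1) \<le> A * ((M * Q * l + 4 * D * G) * \<delta>) * norm (t2 - t1)"
      proof (rule field_differentiable_bound[OF convex_real_interval(5) dZ[OF \<epsilon>]])
        fix t assume t: "t \<in> ?T"
        have "\<bar>R \<epsilon> t\<bar> \<le> M * (Q * \<alpha> \<epsilon>) * l + D * (2 * G) * (\<bar>v (l - \<epsilon>) t\<bar> + \<bar>v \<epsilon> t\<bar>)"
          by (rule R_le[OF \<epsilon> t])
        also have "\<dots> \<le> M * (Q * \<delta>) * l + D * (2 * G) * (\<delta> + \<delta>)"
        proof (rule add_mono)
          show "M * (Q * \<alpha> \<epsilon>) * l \<le> M * (Q * \<delta>) * l"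
            using elim M Q l_pos by (intro mult_right_mono mult_left_mono) auto
          have "\<bar>v (l - \<epsilon>) t\<bar> + \<bar>v \<epsilon> t\<bar> \<le> \<delta> + \<delta>"
            using bspec[OF elim(2) t] by linarith
          then show "D * (2 * G) * (\<bar>v (l - \<epsilon>) t\<bar> + \<bar>v \<epsilon> t\<bar>) \<le> D * (2 * G) * (\<delta> + \<delta>)"
            using D_pos G by (intro mult_left_mono) auto
        qed
        also have "\<dots> = (M * Q * l + 4 * D * G) * \<delta>" by (simp add: algebra_simps)
        finally show "norm (exp (- s * K t) * k t * R \<epsilon> t) \<le> A * ((M * Q * l + 4 * D * G) * \<delta>)"
          unfolding real_norm_def abs_mult[of "exp (- s * K t) * k t"] using A(2)[OF t]
          by (intro mult_mono A(1)) auto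
      qed (use t12 in auto)
      then show ?case using t12 by simp
    qed
  qed simp
  have *: "\<bar>Zl t2 - Zl t1\<bar> \<le> (A * (M * Q * l + 4 * D * G) * (t2 - t1)) * \<delta>" if "\<delta> > 0" for \<delta>
  proof -
    have "A * (X * \<delta>) * Y = A * X * Y * \<delta>" for X Y by simp
    then show ?thesis using bnd[OF that] by metis
  qed
  have "((\<lambda>\<delta>. (A * (M * Q * l + 4 * D * G) * (t2 - t1)) * \<delta>) \<longlongrightarrow> (A * (M * Q * l + 4 * D * G) * (t2 - t1)) * 0) ?F"
    by (intro tendsto_intros)
  then have "\<bar>Zl t2 - Zl t1\<bar> \<le> (A * (M * Q * l + 4 * D * G) * (t2 - t1)) * 0"
    by (rule tendsto_lowerbound) (auto simp: eventually_at_right_less intro!: eventually_mono[OF eventually_at_right_less] *)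
  then have "Zl t2 = Zl t1" by simp
  then show ?thesis by (simp add: Zl_def E_def s_def)
qed

end

section \<open>The gauge transformation\<close>

locale moving_interval =
  fixes D f0 L0 a b \<gamma>0 \<gamma>1 :: real and L L' A A' :: "real \<Rightarrow> real" and J :: "real set"
  assumes D: "D > 0" and L0: "L0 > 0"
    and J: "J = time_interval a b L0"
    and L: "\<And>t. t \<in> J \<Longrightarrow> L t > 0" "\<And>t. t \<in> J \<Longrightarrow> (L t)\<^sup>2 = a * t\<^sup>2 + 2 * b * t + L0\<^sup>2"
    and dL: "\<And>t. t \<in> J \<Longrightarrow> (L has_real_derivative L' t) (at t within J)"
    and dA: "\<And>t. t \<in> J \<Longrightarrow> (A has_real_derivative A' t) (at t within J)"
    and dA': "\<And>t. t \<in> J \<Longrightarrow> (A' has_real_derivative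
                \<gamma>1 / (a * t\<^sup>2 + 2 * b * t + L0\<^sup>2) powr (3/2)) (at t within J)"
    and \<gamma>0: "\<gamma>0 = a * L0\<^sup>2 - b\<^sup>2"
begin

lemma J_nonneg: "t \<in> J \<Longrightarrow> 0 \<le> t"
  by (simp add: J time_interval_def)

lemma zero_in_J: "0 \<in> J"
  using L0 by (simp add: J time_interval_def)

lemma J_down: "t \<in> J \<Longrightarrow> {0..t} \<subseteq> J"
  by (auto simp: J time_interval_def)

text \<open>Positivity of the polynomial is an open condition, so \<open>J\<close> has no greatest
  element. Derivatives within \<open>J\<close> can therefore be taken within a closed interval
  [0, r] with r > t.\<close>

lemma J_right: assumes t: "t \<in> J" obtains r where "r > t" "{0..r} \<subseteq> J"
proof -
  let ?P = "\<lambda>t. a * t\<^sup>2 + 2 * b * t + L0\<^sup>2"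
  have P: "?P s > 0" if "s \<in> {0..t}" for s using t that by (auto simp: J time_interval_def)
  have "isCont ?P t" by (intro continuous_intros)
  then have "\<forall>\<^sub>F s in at t. ?P s > 0"
    using P[of t] J_nonneg[OF t] by (intro order_tendstoD(1)) (auto simp: isCont_def)
  then obtain d where d: "d > 0" "\<And>s. s \<noteq> t \<Longrightarrow> dist s t < d \<Longrightarrow> ?P s > 0"
    unfolding eventually_at by blast
  have "?P s > 0" if "s \<in> {0..t + d / 2}" for s
  proof (cases "s \<le> t")
    case True
    with P that show ?thesis by auto
  next
    case False
    with d that show ?thesis by (intro d(2)) (auto simp: dist_real_def)
  qed
  then have "{0..t + d / 2} \<subseteq> J"
    by (auto simp: J time_interval_def)
  then show thesis using that[of "t + d / 2"] d by auto
qed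

lemma J_at:
  assumes t: "t \<in> J"
  obtains r where "r > t" "{0..r} \<subseteq> J" "at t within J = at t within {0..r}"
proof -
  obtain r where r: "r > t" "{0..r} \<subseteq> J" using J_right[OF t] by blast
  have "at t within J = at t within {0..r}"
    by (rule at_within_nhd[of _ "{..<r}"]) (use r J_nonneg in auto)
  with r show thesis by (rule that)
qed

lemma J_at_interior: assumes t: "t \<in> J - {0}" shows "at t within J = at t"
proof -
  obtain r where r: "r > t" "{0..r} \<subseteq> J" using J_right t by blast
  have "{0<..<r} \<subseteq> J" using r by auto
  then have "t \<in> interior J" using interior_maximal[of "{0<..<r}" J] r J_nonneg[of t] t by auto
  then show ?thesis by (rule at_within_interior)
qed

lemma J_deriv_unique:
  assumes t: "t \<in> J" and "(f has_real_derivative d) (at t within J)" "(f has_real_derivative d') (at t within J)"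
  shows "d = d'"
proof -
  obtain r where r: "r > t" "{0..r} \<subseteq> J" "at t within J = at t within {0..r}" using J_at[OF t] by blast
  then show ?thesis
    using vector_derivative_unique_within_closed_interval[of 0 r t f d d'] assms J_nonneg[OF t]
    by (simp add: has_real_derivative_iff_has_vector_derivative)
qed

lemma J_antiderivative:
  assumes t: "t \<in> J" and d: "\<And>s. s \<in> J \<Longrightarrow> (F has_real_derivative f s) (at s within J)"
  shows "integral {0..t} f = F t - F 0"
proof -
  have "(f has_integral F t - F 0) {0..t}"
    using J_nonneg[OF t] J_down[OF t] DERIV_subset[OF d J_down[OF t]] by (intro integral_derivative) auto
  then show ?thesis by (rule integral_unique)
qed

lemma J_const:
  assumes d: "\<And>s. s \<in> J \<Longrightarrow> (F has_real_derivative 0) (at s within J)" and t: "t \<in> J"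
  shows "F t = F 0"
  using J_antiderivative[OF t d] by simp

lemma J_integral_derivative:
  assumes f: "continuous_on J f" and t: "t \<in> J"
  shows "((\<lambda>t. integral {0..t} f) has_real_derivative f t) (at t within J)"
proof -
  obtain r where r: "r > t" "{0..r} \<subseteq> J" "at t within J = at t within {0..r}" using J_at[OF t] by blast
  have "continuous_on {0..r} f" using continuous_on_subset[OF f r(2)] .
  then show ?thesis unfolding r(3) using r J_nonneg[OF t] by (intro indefinite_integral_derivative) auto
qed

lemma L_continuous: "continuous_on J L"
  using dL by (rule derivative_continuous_on)

lemma A'_continuous: "continuous_on J A'"
  using dA' by (rule derivative_continuous_on)

lemma L_eq: "t \<in> J \<Longrightarrow> L t = sqrt (a * t\<^sup>2 + 2 * b * t + L0\<^sup>2)"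
  using L by (metis abs_of_pos real_sqrt_abs)

lemma L_0: "L 0 = L0"
  using L_eq[OF zero_in_J] L0 by simp

text \<open>Differentiate L^2 directly and through its polynomial form.\<close>

lemma L'_eq: assumes t: "t \<in> J" shows "L' t = (a * t + b) / L t"
proof -
  have "((\<lambda>t. (L t)\<^sup>2) has_real_derivative 2 * L t * L' t) (at t within J)"
    using dL[OF t] by (auto intro!: derivative_eq_intros)
  moreover have "((\<lambda>t. (L t)\<^sup>2) has_real_derivative 2 * (a * t + b)) (at t within J)"
    by (rule has_field_derivative_transform[OF t L(2)]) (auto intro!: derivative_eq_intros)
  ultimately have "2 * L t * L' t = 2 * (a * t + b)" using J_deriv_unique[OF t] by blast
  then show ?thesis using L(1)[OF t] by (simp add: field_simps)
qed

lemma dA'_L: assumes t: "t \<in> J" shows "(A' has_real_derivative \<gamma>1 / L t ^ 3) (at t within J)"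
proof -
  have "(a * t\<^sup>2 + 2 * b * t + L0\<^sup>2) powr (3/2) = (L t powr 2) powr (3/2)"
    using L[OF t] by (simp add: powr_numeral)
  also have "\<dots> = L t powr (2 * (3/2))" by (simp only: powr_powr)
  also have "\<dots> = L t ^ 3" using L(1)[OF t] by (simp add: powr_numeral)
  finally show ?thesis using dA'[OF t] by simp
qed

text \<open>Since L L' = a t + b, the left side is L^2 (a - L'^2) = L^3 L''. This is the constancy
  that makes the quadratic part of the potential independent of time.\<close>

lemma discriminant: assumes t: "t \<in> J" shows "a * (L t)\<^sup>2 - (a * t + b)\<^sup>2 = \<gamma>0"
  unfolding L(2)[OF t] \<gamma>0 by (simp add: power2_eq_square algebra_simps)

section \<open>The change of time and the gauge function\<close>

definition k where "k t = L0\<^sup>2 / (L t)\<^sup>2"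

definition \<tau> where "\<tau> t = integral {0..t} (\<lambda>\<zeta>. L0\<^sup>2 / (L \<zeta>)\<^sup>2)"

definition I where "I t = integral {0..t} (\<lambda>\<zeta>. (A' \<zeta>)\<^sup>2 / (4 * D))"

lemma k_continuous: "continuous_on J k"
  unfolding k_def[abs_def] using L_continuous L(1) by (intro continuous_intros) (auto, force)

lemma k_pos: "t \<in> J \<Longrightarrow> k t > 0"
  using L(1)[of t] L0 by (simp add: k_def)

lemma d\<tau>: "t \<in> J \<Longrightarrow> (\<tau> has_real_derivative k t) (at t within J)"
  unfolding \<tau>_def[abs_def] using J_integral_derivative[OF k_continuous] by (simp add: k_def[abs_def])

lemma \<tau>_0: "\<tau> 0 = 0"
  by (simp add: \<tau>_def)

lemma \<tau>_continuous: "continuous_on J \<tau>"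
  using d\<tau> by (rule derivative_continuous_on)

lemma \<tau>_pos: assumes t: "t \<in> J - {0}" shows "\<tau> t > 0"
proof -
  have tJ: "t \<in> J" "0 < t" using t J_nonneg[of t] by auto
  have sub: "{0..t} \<subseteq> J" using J_down tJ by blast
  have "(\<tau> has_derivative (*) (k x)) (at x within {0..t})" if "0 \<le> x" "x \<le> t" for x
    using DERIV_subset[OF d\<tau> sub, of x] sub that by (auto simp: has_field_derivative_def)
  from mvt_simple[OF tJ(2) this]
  obtain x where x: "0 < x" "x < t" "\<tau> t - \<tau> 0 = k x * (t - 0)" by auto
  then have "x \<in> J" using sub by auto
  with x k_pos[of x] tJ show ?thesis by (simp add: \<tau>_0)
qed

lemma dI: "t \<in> J \<Longrightarrow> (I has_real_derivative (A' t)\<^sup>2 / (4 * D)) (at t within J)"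
  unfolding I_def[abs_def] using D by (intro J_integral_derivative) (auto intro!: continuous_intros A'_continuous)

text \<open>The logarithm of the factors of \<open>mode\<close> other than exp (s \<tau>) h, with L
  L' written as a t + b. Its dependence on \<open>x\<close> is dictated by the requirement that the
  drift be - 2 D k \<Phi>x (see \<open>drift_eq\<close>); the remaining function of \<open>t\<close>
  removes the x-independent part of the potential.\<close>

definition \<Phi> where
  "\<Phi> x t = (ln L0 - ln (L t)) / 2 + f0 * t - I t
     - (x\<^sup>2 * (a * t + b) / (4 * D * L0\<^sup>2) + x * (A' t * L t) / (2 * D * L0))"

definition \<Phi>x where
  "\<Phi>x x t = - (x * (a * t + b) / (2 * D * L0\<^sup>2) + A' t * L t / (2 * D * L0))"

definition \<Phi>xx where "\<Phi>xx t = - ((a * t + b) / (2 * D * L0\<^sup>2))"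

definition \<Phi>t where
  "\<Phi>t x t = - ((a * t + b) / (2 * (L t)\<^sup>2)) + f0 - (A' t)\<^sup>2 / (4 * D)
     - (x\<^sup>2 * a / (4 * D * L0\<^sup>2) + x * (\<gamma>1 / (L t)\<^sup>2 + A' t * (a * t + b) / L t) / (2 * D * L0))"

definition q where "q x = \<gamma>0 * x\<^sup>2 / (4 * D * L0^4) + \<gamma>1 * x / (2 * D * L0^3)"

lemma q_continuous: "continuous_on S q"
  unfolding q_def[abs_def] using D L0 by (intro continuous_intros) auto

text \<open>For an eigenpair this is the gauge factor times a separated solution of the heat
  equation in the time \<open>\<tau>\<close>.\<close>

lemma mode_eq:
  assumes t: "t \<in> J"
  shows "mode D f0 L0 L L' A' s h x t = exp (\<Phi> x t) * (exp (s * \<tau> t) * h x)"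
proof -
  have "(L0 / L t) powr (1/2) = exp ((ln L0 - ln (L t)) / 2)"
    using L(1)[OF t] L0 by (simp add: powr_def ln_div)
  moreover have "x\<^sup>2 * L' t * L t / (4 * D * L0\<^sup>2) = x\<^sup>2 * (a * t + b) / (4 * D * L0\<^sup>2)"
    using L'_eq[OF t] L(1)[OF t] by simp
  ultimately show ?thesis
    unfolding mode_def \<Phi>_def I_def \<tau>_def by (simp add: mult.assoc diff_diff_eq flip: exp_add)
qed

lemma d\<Phi>x: "((\<lambda>x. \<Phi> x t) has_real_derivative \<Phi>x x t) (at x)"
  unfolding \<Phi>_def \<Phi>x_def using D L0
  by (auto intro!: derivative_eq_intros simp: field_simps)

lemma d\<Phi>xx: "((\<lambda>x. \<Phi>x x t) has_real_derivative \<Phi>xx t) (at x)"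
  unfolding \<Phi>xx_def \<Phi>x_def using D L0
  by (auto intro!: derivative_eq_intros simp: field_simps)

lemma d\<Phi>t: assumes t: "t \<in> J" shows "((\<lambda>t. \<Phi> x t) has_real_derivative \<Phi>t x t) (at t within J)"
proof -
  have Lt: "L t > 0" using L(1)[OF t] .
  have 1: "((\<lambda>t. ln (L t)) has_real_derivative (a * t + b) / (L t)\<^sup>2) (at t within J)"
    using DERIV_chain2[OF DERIV_ln_divide dL[OF t]] Lt L'_eq[OF t] by (simp add: power2_eq_square)
  have 2: "((\<lambda>t. A' t * L t) has_real_derivative \<gamma>1 / (L t)\<^sup>2 + A' t * (a * t + b) / L t) (at t within J)"
    using DERIV_mult[OF dA'_L[OF t] dL[OF t]] Lt L'_eq[OF t]
    by (simp add: power2_eq_square power3_eq_cube add.commute mult.commute)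
  have 3: "((\<lambda>t. (ln L0 - ln (L t)) / 2) has_real_derivative - ((a * t + b) / (2 * (L t)\<^sup>2))) (at t within J)"
    using DERIV_cdivide[OF DERIV_diff[OF DERIV_const[of "ln L0"] 1], of 2] by (simp add: mult.commute)
  have 4: "((\<lambda>t. x\<^sup>2 * (a * t + b) / (4 * D * L0\<^sup>2)) has_real_derivative x\<^sup>2 * a / (4 * D * L0\<^sup>2)) (at t within J)"
    by (intro DERIV_cdivide DERIV_cmult) (auto intro!: derivative_eq_intros)
  have 5: "((\<lambda>t. x * (A' t * L t) / (2 * D * L0)) has_real_derivative
      x * (\<gamma>1 / (L t)\<^sup>2 + A' t * (a * t + b) / L t) / (2 * D * L0)) (at t within J)"
    by (intro DERIV_cdivide DERIV_cmult 2)
  have 6: "((\<lambda>t. f0 * t) has_real_derivative f0) (at t within J)"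
    by (auto intro!: derivative_eq_intros)
  show ?thesis unfolding \<Phi>_def \<Phi>t_def by (intro DERIV_diff DERIV_add 3 4 5 6 dI[OF t])
qed

text \<open>For u = exp \<Phi> v the left side is the coefficient of \<open>v\<close> once the drift
  is removed. Its x^2 part reduces by \<open>discriminant\<close>, its x part by L^3 A'' =
  \<gamma>1, and its x-independent part cancels.\<close>

lemma gauge_identity:
  assumes t: "t \<in> J"
  shows "D * k t * (\<Phi>xx t - (\<Phi>x x t)\<^sup>2) + f0 - \<Phi>t x t = k t * q x"
proof -
  \<comment> \<open>With y, z, w for L, L L' and A', only algebra and the relation a y^2 - z^2 =
    \<gamma>0 are left.\<close>
  define y where "y = L t"
  define z where "z = a * t + b"
  define w where "w = A' t"
  have y: "y > 0" using L(1)[OF t] by (simp add: y_def)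
  have \<gamma>: "a * y\<^sup>2 - z\<^sup>2 = \<gamma>0" using discriminant[OF t] by (simp add: y_def z_def)
  have 1: "D * k t * \<Phi>xx t = - (z / (2 * y\<^sup>2))"
    using D L0 y by (simp add: k_def \<Phi>xx_def z_def y_def)
  define P where "P = x * z + w * y * L0"
  have \<Phi>xP: "\<Phi>x x t = - (P / (2 * D * L0\<^sup>2))"
    using D L0 by (simp add: P_def \<Phi>x_def z_def y_def w_def add_divide_distrib power2_eq_square)
  have 2: "D * k t * (\<Phi>x x t)\<^sup>2 = (x * z + w * y * L0)\<^sup>2 / (4 * D * L0\<^sup>2 * y\<^sup>2)"
    unfolding \<Phi>xP k_def y_def[symmetric] P_def[symmetric] using D L0 y
    by (simp add: field_simps power2_eq_square)
  have 3: "\<Phi>t x t = - (z / (2 * y\<^sup>2)) + f0 - (w\<^sup>2 / (4 * D)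
     + (x\<^sup>2 * a / (4 * D * L0\<^sup>2) + x * (\<gamma>1 / y\<^sup>2 + w * z / y) / (2 * D * L0)))"
    by (simp add: \<Phi>t_def z_def y_def w_def)
  have 4: "k t * q x = (x\<^sup>2 * (a * y\<^sup>2 - z\<^sup>2) + 2 * x * \<gamma>1 * L0) / (4 * D * L0\<^sup>2 * y\<^sup>2)"
    unfolding \<gamma> using D L0 y
    by (simp add: k_def q_def y_def field_simps power2_eq_square power3_eq_cube power4_eq_xxxx)
  have 5: "w\<^sup>2 / (4 * D) + (x\<^sup>2 * a / (4 * D * L0\<^sup>2) + x * (\<gamma>1 / y\<^sup>2 + w * z / y) / (2 * D * L0))
     = (w\<^sup>2 * L0\<^sup>2 * y\<^sup>2 + x\<^sup>2 * a * y\<^sup>2 + 2 * x * \<gamma>1 * L0 + 2 * x * w * z * y * L0) / (4 * D * L0\<^sup>2 * y\<^sup>2)"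
    using D L0 y by (simp add: field_simps power2_eq_square)
  have "w\<^sup>2 * L0\<^sup>2 * y\<^sup>2 + x\<^sup>2 * a * y\<^sup>2 + 2 * x * \<gamma>1 * L0 + 2 * x * w * z * y * L0 - (x * z + w * y * L0)\<^sup>2
     = x\<^sup>2 * (a * y\<^sup>2 - z\<^sup>2) + 2 * x * \<gamma>1 * L0"
    by (simp add: power2_eq_square algebra_simps)
  then have "(w\<^sup>2 * L0\<^sup>2 * y\<^sup>2 + x\<^sup>2 * a * y\<^sup>2 + 2 * x * \<gamma>1 * L0 + 2 * x * w * z * y * L0) / (4 * D * L0\<^sup>2 * y\<^sup>2)
      - (x * z + w * y * L0)\<^sup>2 / (4 * D * L0\<^sup>2 * y\<^sup>2) = k t * q x"
    unfolding 4 by (simp only: diff_divide_distrib[symmetric])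
  then show ?thesis using 1 2 3 5 by (simp add: right_diff_distrib)
qed

lemma drift_eq:
  assumes t: "t \<in> J"
  shows "(A' t * L0 + x * L' t) / L t = - 2 * D * k t * \<Phi>x x t"
  unfolding L'_eq[OF t] \<Phi>x_def k_def using D L0 L(1)[OF t]
  by (simp add: field_simps power2_eq_square)

lemma continuous_gauge:
  "continuous_on (S \<times> J) (\<lambda>(x, t). \<Phi> x t)" "continuous_on (S \<times> J) (\<lambda>(x, t). \<Phi>x x t)"
  "continuous_on (S \<times> J) (\<lambda>(x, t). \<Phi>xx t)" "continuous_on (S \<times> J) (\<lambda>(x, t). \<Phi>t x t)"
  "continuous_on (S \<times> J) (\<lambda>(x, t). k t)" "continuous_on (S \<times> J) (\<lambda>(x, t). \<tau> t)"
proof -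
  have Ic: "continuous_on J I" using dI by (rule derivative_continuous_on)
  have s: "continuous_on (S \<times> J) (\<lambda>z. f (snd z))" if "continuous_on J f" for f :: "real \<Rightarrow> real"
    using continuous_on_compose2[OF that continuous_on_snd[OF continuous_on_id], of "S \<times> J"] by auto
  have f: "continuous_on (S \<times> J) fst" "continuous_on (S \<times> J) snd"
    by (auto intro: continuous_on_fst continuous_on_snd continuous_on_id)
  have Lp: "L (snd z) > 0" if "z \<in> S \<times> J" for z using L(1) that by auto
  note c = s[OF Ic] s[OF L_continuous] s[OF A'_continuous] f
  show "continuous_on (S \<times> J) (\<lambda>(x, t). \<Phi> x t)"
    unfolding \<Phi>_def case_prod_beta' using D L0 Lp by (intro continuous_intros c) (auto, force)
  show "continuous_on (S \<times> J) (\<lambda>(x, t). \<Phi>x x t)"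
    unfolding \<Phi>x_def case_prod_beta' using D L0 Lp by (intro continuous_intros c) auto
  show "continuous_on (S \<times> J) (\<lambda>(x, t). \<Phi>xx t)"
    unfolding \<Phi>xx_def case_prod_beta' using D L0 Lp by (intro continuous_intros c) auto
  show "continuous_on (S \<times> J) (\<lambda>(x, t). \<Phi>t x t)"
    unfolding \<Phi>t_def case_prod_beta' using D L0 Lp by (intro continuous_intros c) (auto, force+)
  show "continuous_on (S \<times> J) (\<lambda>(x, t). k t)" "continuous_on (S \<times> J) (\<lambda>(x, t). \<tau> t)"
    unfolding case_prod_beta' by (intro s k_continuous \<tau>_continuous)+
qed

end

section \<open>Existence and expansion of solutions\<close>

lemma L2_tendsto_iff:
  "L2_tendsto S F f net \<longleftrightarrow> (\<forall>\<^sub>F i in net. L2_on S (\<lambda>x. F i x - f x)) \<and>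
     ((\<lambda>i. norm2_on S (\<lambda>x. F i x - f x)) \<longlongrightarrow> 0) net"
  by (simp add: L2_tendsto_def inner_on_self)

text \<open>At t = 0 a solution agrees with its datum only almost everywhere, so square
  integrability and the norm have to be transferred across null sets.\<close>

lemma L2_on_cong_AE:
  assumes f: "L2_on S f" and S: "S \<in> sets lebesgue" and eq: "AE x in lebesgue_on S. f x = g x"
  shows "L2_on S g" "inner_on S g g = inner_on S f f"
proof -
  have "AE x in lebesgue. x \<in> S \<longrightarrow> f x = g x"
    using eq S by (simp add: AE_restrict_space_iff)
  then have "AE x in lebesgue. (if x \<in> S then f x else 0) = (if x \<in> S then g x else 0)"
    by eventually_elim auto
  moreover have "(\<lambda>x. if x \<in> S then f x else 0) \<in> borel_measurable lebesgue"
    using L2_onD(1)[OF f] S by (simp add: borel_measurable_if)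
  ultimately have "(\<lambda>x. if x \<in> S then g x else 0) \<in> borel_measurable lebesgue"
    by (rule borel_measurable_AE[rotated])
  then have g: "g \<in> borel_measurable (lebesgue_on S)" using S by (simp add: borel_measurable_if)
  have "integrable (lebesgue_on S) (\<lambda>x. (g x)\<^sup>2) \<longleftrightarrow> integrable (lebesgue_on S) (\<lambda>x. (f x)\<^sup>2)"
    using g L2_onD(1)[OF f] eq by (intro integrable_cong_AE) auto
  with g L2_onD(2)[OF f] show "L2_on S g" by (simp add: L2_on_def)
  show "inner_on S g g = inner_on S f f"
    unfolding inner_on_self using g L2_onD(1)[OF f] eq by (intro integral_cong_AE) auto
qed

context moving_interval
begin

lemma eventually_at_0_J:
  assumes "r > 0" "{0..r} \<subseteq> J" "at 0 within J = at 0 within {0..r}"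
  shows "\<forall>\<^sub>F t in at 0 within J. t \<in> {0<..r}"
  unfolding assms(3) by (auto simp: eventually_at_filter)

lemma at_0_J_nontrivial: "at 0 within J \<noteq> bot"
proof -
  obtain r where r: "r > 0" "{0..r} \<subseteq> J" "at 0 within J = at 0 within {0..r}"
    using J_at[OF zero_in_J] by blast
  have "at 0 within {0..r} = at_right 0"
    using r(1) by (simp add: at_within_Icc_at_right)
  with r show ?thesis by (simp add: trivial_limit_at_right_real)
qed

text \<open>Split W F - W 0 f into W (F - f) and (W - W 0) f: on the compact set of \<open>x\<close>
  in {0..L0} and \<open>t\<close> in {0..r} the weight is bounded and uniformly continuous.\<close>

lemma weighted_L2_limit:
  assumes W: "continuous_on ({0..L0} \<times> J) (\<lambda>(x, t). W x t)" and f: "L2_on {0..L0} f"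
    and F: "\<forall>\<^sub>F t in at 0 within J. L2_on {0..L0} (F t)"
    and lim: "((\<lambda>t. norm2_on {0..L0} (\<lambda>x. F t x - f x)) \<longlongrightarrow> 0) (at 0 within J)"
  shows "((\<lambda>t. norm2_on {0..L0} (\<lambda>x. W x t * F t x - W x 0 * f x)) \<longlongrightarrow> 0)
    (at 0 within J)"
proof (rule tendstoI)
  let ?I = "{0..L0}"
  let ?n = "\<lambda>f. inner_on ?I f f"
  fix \<epsilon> :: real assume \<epsilon>: "\<epsilon> > 0"
  obtain r where r: "r > 0" "{0..r} \<subseteq> J" "at 0 within J = at 0 within {0..r}"
    using J_at[OF zero_in_J] by blast
  have Wr: "continuous_on (?I \<times> {0..r}) (\<lambda>(x, t). W x t)"
    using continuous_on_subset[OF W] r(2) by (simp add: Sigma_mono)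
  have Wx: "continuous_on ?I (\<lambda>x. W x t)" if "t \<in> J" for t by (rule continuous_on_slice[OF W that])
  have "bounded ((\<lambda>(x, t). W x t) ` (?I \<times> {0..r}))"
    using compact_continuous_image[OF Wr] compact_Times compact_imp_bounded by blast
  then obtain B where "\<forall>z\<in>?I \<times> {0..r}. \<bar>case z of (x, t) \<Rightarrow> W x t\<bar> \<le> B" by (auto simp: bounded_iff)
  then have B: "\<bar>W x t\<bar> \<le> B" if "x \<in> ?I" "t \<in> {0..r}" for x t using that by fastforce
  define \<delta> where "\<delta> = sqrt (\<epsilon> / (4 * (?n f + 1)))"
  have nf: "?n f \<ge> 0" by (rule inner_on_self_nonneg)
  have \<delta>: "\<delta> > 0" using \<epsilon> nf by (simp add: \<delta>_def)
  have \<delta>2: "\<delta>\<^sup>2 * ?n f \<le> \<epsilon> / 4"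
  proof -
    have "\<delta>\<^sup>2 * ?n f = \<epsilon> / 4 * (?n f / (?n f + 1))" using \<epsilon> nf by (simp add: \<delta>_def)
    also have "\<dots> \<le> \<epsilon> / 4 * 1" using \<epsilon> nf by (intro mult_left_mono) auto
    finally show ?thesis by simp
  qed
  have "uniformly_continuous_on (?I \<times> {0..r}) (\<lambda>(x, t). W x t)"
    by (intro compact_uniformly_continuous Wr compact_Times compact_Icc)
  then obtain \<eta> where \<eta>: "\<eta> > 0" "\<And>z z'. z \<in> ?I \<times> {0..r} \<Longrightarrow> z' \<in> ?I \<times> {0..r} \<Longrightarrow> dist z' z < \<eta> \<Longrightarrow>
      dist (case z' of (x, t) \<Rightarrow> W x t) (case z of (x, t) \<Rightarrow> W x t) < \<delta>"
    unfolding uniformly_continuous_on_def using \<delta> by metis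
  have "\<forall>\<^sub>F t in at 0 within J. t < \<eta>" by (rule order_tendstoD(2)[OF tendsto_ident_at \<eta>(1)])
  moreover have "\<epsilon> / (4 * (B\<^sup>2 + 1)) > 0" using \<epsilon> by (simp add: add_nonneg_pos)
  then have "\<forall>\<^sub>F t in at 0 within J. ?n (\<lambda>x. F t x - f x) < \<epsilon> / (4 * (B\<^sup>2 + 1))"
    by (rule order_tendstoD(2)[OF lim])
  ultimately show "\<forall>\<^sub>F t in at 0 within J. dist (?n (\<lambda>x. W x t * F t x - W x 0 * f x)) 0 < \<epsilon>"
    using eventually_at_0_J[OF r] F
  proof eventually_elim
    case (elim t)
    then have t: "t \<in> {0..r}" "t \<in> J" using r(2) by auto
    have LF: "L2_on ?I (\<lambda>x. F t x - f x)" using elim(4) f by (rule L2_on_diff)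
    have LW: "L2_on ?I (\<lambda>x. (W x t - W x 0) * f x)"
      using f Wx[OF t(2)] Wx[OF zero_in_J] by (intro L2_on_mult_continuous continuous_on_diff)
    have 1: "?n (\<lambda>x. W x t * (F t x - f x)) \<le> B\<^sup>2 * ?n (\<lambda>x. F t x - f x)"
      using B t by (intro inner_on_mult_le LF Wx) auto
    have "B\<^sup>2 * ?n (\<lambda>x. F t x - f x) \<le> (B\<^sup>2 + 1) * ?n (\<lambda>x. F t x - f x)"
      using inner_on_self_nonneg by (intro mult_right_mono) auto
    also have "\<dots> < (B\<^sup>2 + 1) * (\<epsilon> / (4 * (B\<^sup>2 + 1)))"
      using elim(2) by (intro mult_strict_left_mono) (auto simp: add_nonneg_pos)
    also have "\<dots> = \<epsilon> / 4"
    proof -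
      have "B\<^sup>2 + 1 > 0" by (simp add: add_nonneg_pos)
      then show ?thesis by (simp add: field_simps)
    qed
    finally have 1: "?n (\<lambda>x. W x t * (F t x - f x)) < \<epsilon> / 4" using 1 by linarith
    have "?n (\<lambda>x. (W x t - W x 0) * f x) \<le> \<delta>\<^sup>2 * ?n f"
    proof (intro inner_on_mult_le f continuous_on_diff Wx t(2) zero_in_J)
      fix x assume x: "x \<in> ?I"
      show "\<bar>W x t - W x 0\<bar> \<le> \<delta>"
        using \<eta>(2)[of "(x, 0)" "(x, t)"] x t elim by (auto simp: dist_Pair_Pair dist_real_def)
    qed
    with \<delta>2 have 2: "?n (\<lambda>x. (W x t - W x 0) * f x) \<le> \<epsilon> / 4" by linarith
    have "?n (\<lambda>x. W x t * F t x - W x 0 * f x) = ?n (\<lambda>x. W x t * (F t x - f x) + (W x t - W x 0) * f x)"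
      by (simp add: algebra_simps)
    also have "\<dots> \<le> 2 * ?n (\<lambda>x. W x t * (F t x - f x)) + 2 * ?n (\<lambda>x. (W x t - W x 0) * f x)"
      by (intro inner_on_self_add_le L2_on_mult_continuous[OF LF Wx[OF t(2)]] LW)
    also have "\<dots> < \<epsilon>" using 1 2 by linarith
    finally show ?case using inner_on_self_nonneg[of ?I "\<lambda>x. W x t * F t x - W x 0 * f x"] by simp
  qed
qed

lemma continuous_exp_gauge:
  "continuous_on (S \<times> J) (\<lambda>(x, t). exp (\<Phi> x t))" "continuous_on (S \<times> J) (\<lambda>(x, t). exp (- \<Phi> x t))"
  using continuous_gauge(1)[of S] unfolding case_prod_beta' by (auto intro!: continuous_intros)

end

locale moving_eigen = moving_interval +
  fixes \<sigma> :: "nat \<Rightarrow> real" and g :: "nat \<Rightarrow> real \<Rightarrow> real"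
  assumes eigensystem: "sl_eigensystem D q L0 \<sigma> g"

sublocale moving_eigen \<subseteq> sl: sl_system D L0 q \<sigma> g
  using D L0 q_continuous eigensystem by unfold_locales auto

context moving_eigen
begin

definition v0 where "v0 u0 x = exp (- \<Phi> x 0) * u0 x"

lemma v0_L2: "L2_on {0..L0} u0 \<Longrightarrow> L2_on {0..L0} (v0 u0)"
  unfolding v0_def[abs_def]
  by (rule L2_on_mult_continuous[OF _ continuous_on_slice[OF continuous_exp_gauge(2) zero_in_J]])

text \<open>The solution is exp \<Phi> times \<open>evol\<close> of the gauged datum
  \<open>v0 u0\<close>, run in the time \<open>\<tau>\<close>.\<close>

lemma exists_solution:
  assumes u0: "L2_on {0..L0} u0"
  shows "\<exists>u. transformed_solution D f0 L0 J L L' A' u0 u"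
proof -
  define w where "w = v0 u0"
  have w: "L2_on {0..L0} w" using v0_L2[OF u0] by (simp add: w_def)
  define V where "V x t = sl.evol w x (\<tau> t)" for x t
  define V1 where "V1 x t = sl.evol1 w x (\<tau> t)" for x t
  define V2 where "V2 x t = sl.evol2 w x (\<tau> t)" for x t
  \<comment> \<open>The value at t = 0 is prescribed separately, as the series need not converge
    there.\<close>
  define u where "u x t = (if t = 0 then u0 x else exp (\<Phi> x t) * V x t)" for x t
  define ut where "ut x t = exp (\<Phi> x t) * (k t * (D * V2 x t + q x * V x t) + V x t * \<Phi>t x t)" for x t
  define ux where "ux x t = exp (\<Phi> x t) * (V1 x t + V x t * \<Phi>x x t)" for x t
  define uxx where "uxx x t = exp (\<Phi> x t) * (V2 x t + 2 * V1 x t * \<Phi>x x t + V x t * (\<Phi>xx t + (\<Phi>x x t)\<^sup>2))" for x t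
  let ?J = "J - {0}"
  have tc: "continuous_on ({0..L0} \<times> ?J) (\<lambda>z. (fst z, \<tau> (snd z)))"
    by (intro continuous_on_Pair continuous_on_fst continuous_on_id
        continuous_on_compose2[OF \<tau>_continuous continuous_on_snd[OF continuous_on_id]]) auto
  have tr: "(\<lambda>z. (fst z, \<tau> (snd z))) ` ({0..L0} \<times> ?J) \<subseteq> {0..L0} \<times> {0<..}"
    using \<tau>_pos by auto
  have Vc: "continuous_on ({0..L0} \<times> ?J) (\<lambda>(x, t). V x t)" "continuous_on ({0..L0} \<times> ?J) (\<lambda>(x, t). V1 x t)"
    "continuous_on ({0..L0} \<times> ?J) (\<lambda>(x, t). V2 x t)"
    using continuous_on_compose2[OF sl.evol_continuous(1)[OF w] tc tr]
      continuous_on_compose2[OF sl.evol_continuous(2)[OF w] tc tr]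
      continuous_on_compose2[OF sl.evol_continuous(3)[OF w] tc tr]
    by (simp_all add: V_def V1_def V2_def case_prod_beta')
  have sub: "{0<..<L0} \<times> ?J \<subseteq> {0..L0} \<times> ?J" "{0..L0} \<times> ?J \<subseteq> {0..L0} \<times> J" by auto
  note gc = continuous_on_subset[OF continuous_exp_gauge(1) sub(2)]
    continuous_on_subset[OF continuous_gauge(2) sub(2)] continuous_on_subset[OF continuous_gauge(3) sub(2)]
    continuous_on_subset[OF continuous_gauge(4) sub(2)] continuous_on_subset[OF continuous_gauge(5) sub(2)]
  have qc: "continuous_on ({0..L0} \<times> ?J) (\<lambda>z. q (fst z))"
    by (rule continuous_on_compose2[OF q_continuous[of UNIV] continuous_on_fst[OF continuous_on_id]]) auto
  note allc = Vc[unfolded case_prod_beta'] gc[unfolded case_prod_beta'] qc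
  have uc: "continuous_on ({0..L0} \<times> ?J) (\<lambda>(x, t). u x t)"
  proof -
    have "continuous_on ({0..L0} \<times> ?J) (\<lambda>z. exp (\<Phi> (fst z) (snd z)) * V (fst z) (snd z))"
      by (intro continuous_on_mult allc)
    then show ?thesis
      by (rule continuous_on_eq) (simp add: u_def mem_Times_iff case_prod_beta')
  qed
  have utc: "continuous_on ({0<..<L0} \<times> ?J) (\<lambda>(x, t). ut x t)"
    unfolding ut_def case_prod_beta'
    by (intro continuous_on_mult continuous_on_add continuous_on_const continuous_on_subset[OF _ sub(1)] allc)
  have uxc: "continuous_on ({0<..<L0} \<times> ?J) (\<lambda>(x, t). ux x t)"
    unfolding ux_def case_prod_beta'
    by (intro continuous_on_mult continuous_on_add continuous_on_const continuous_on_subset[OF _ sub(1)] allc)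
  have uxxc: "continuous_on ({0<..<L0} \<times> ?J) (\<lambda>(x, t). uxx x t)"
    unfolding uxx_def case_prod_beta'
    by (intro continuous_on_mult continuous_on_add continuous_on_power continuous_on_const continuous_on_subset[OF _ sub(1)] allc)
  have deriv: "((\<lambda>s. u x s) has_real_derivative ut x t) (at t) \<and>
      ((\<lambda>x. u x t) has_real_derivative ux x t) (at x) \<and>
      ((\<lambda>x. ux x t) has_real_derivative uxx x t) (at x) \<and>
      ut x t = D * (L0\<^sup>2 / (L t)\<^sup>2) * uxx x t + (A' t * L0 + x * L' t) / L t * ux x t + f0 * u x t"
    if x: "x \<in> {0<..<L0}" and t: "t \<in> ?J" for x t
  proof (intro conjI)
    have xI: "x \<in> {0..L0}" and tJ: "t \<in> J" using x t by auto
    have \<tau>: "\<tau> t > 0" using \<tau>_pos[OF t] .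
    have atx: "at x within {0..L0} = at x"
      using x by (intro at_within_interior) (simp add: interior_atLeastAtMost_real)
    have att: "at t within J = at t" using J_at_interior[OF t] .
    have dV: "((\<lambda>x. V x t) has_real_derivative V1 x t) (at x)" "((\<lambda>x. V1 x t) has_real_derivative V2 x t) (at x)"
      using sl.evol_derivs(1,2)[OF w xI \<tau>] unfolding atx V_def V1_def V2_def by auto
    have dVt: "((\<lambda>t. V x t) has_real_derivative (D * V2 x t + q x * V x t) * k t) (at t)"
      using DERIV_chain2[OF sl.evol_derivs(3)[OF w xI \<tau>] d\<tau>[OF tJ, unfolded att]]
      unfolding V_def V2_def by simp
    note [derivative_intros] = dV dVt d\<Phi>t[OF tJ, unfolded att] d\<Phi>x d\<Phi>xx
    have "((\<lambda>s. exp (\<Phi> x s) * V x s) has_real_derivative ut x t) (at t)"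
      unfolding ut_def by (rule derivative_eq_intros refl)+ (simp add: algebra_simps)
    then show "((\<lambda>s. u x s) has_real_derivative ut x t) (at t)"
    proof (rule has_field_derivative_transform_within_open)
      show "open (- {0 :: real})" by (intro open_Compl closed_singleton)
      show "t \<in> - {0}" using t by auto
    qed (auto simp: u_def)
    have t0: "t \<noteq> 0" using t by auto
    have "((\<lambda>x. exp (\<Phi> x t) * V x t) has_real_derivative ux x t) (at x)"
      unfolding ux_def by (rule derivative_eq_intros refl)+ (simp add: algebra_simps)
    then show "((\<lambda>x. u x t) has_real_derivative ux x t) (at x)" using t0 by (simp add: u_def)
    show "((\<lambda>x. ux x t) has_real_derivative uxx x t) (at x)"
      unfolding ux_def uxx_def by (rule derivative_eq_intros refl)+ (simp add: algebra_simps power2_eq_square)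
    \<comment> \<open>The terms with \<open>V1\<close> cancel because the drift is - 2 D k \<Phi>x,
      and \<open>gauge_identity\<close> converts the coefficient of \<open>V\<close>.\<close>
    have "D * k t * uxx x t + (- 2 * D * k t * \<Phi>x x t) * ux x t + f0 * u x t
      = exp (\<Phi> x t) * (D * k t * V2 x t + V x t * (D * k t * (\<Phi>xx t - (\<Phi>x x t)\<^sup>2) + f0))"
      using t0 by (simp add: uxx_def ux_def u_def algebra_simps power2_eq_square)
    also have "D * k t * (\<Phi>xx t - (\<Phi>x x t)\<^sup>2) + f0 = k t * q x + \<Phi>t x t"
      using gauge_identity[OF tJ, of x] by linarith
    also have "exp (\<Phi> x t) * (D * k t * V2 x t + V x t * (k t * q x + \<Phi>t x t)) = ut x t"
      by (simp add: ut_def algebra_simps)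
    finally show "ut x t = D * (L0\<^sup>2 / (L t)\<^sup>2) * uxx x t + (A' t * L0 + x * L' t) / L t * ux x t + f0 * u x t"
      using drift_eq[OF tJ, of x] by (simp add: k_def)
  qed
  have bd: "u 0 t = 0 \<and> u L0 t = 0" if "t \<in> ?J" for t
    using that by (auto simp: u_def V_def sl.evol_boundary)
  obtain r where r: "r > 0" "{0..r} \<subseteq> J" "at 0 within J = at 0 within {0..r}"
    using J_at[OF zero_in_J] by blast
  have evJ: "\<forall>\<^sub>F t in at 0 within J. t \<in> ?J"
    using eventually_at_0_J[OF r] r(2) by (auto elim!: eventually_mono)
  have "(\<tau> \<longlongrightarrow> \<tau> 0) (at 0 within J)"
    using \<tau>_continuous zero_in_J by (simp add: continuous_on_def)
  \<comment> \<open>\<open>\<tau>\<close> is positive away from 0, so it approaches 0 from the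
    right, as composition with \<open>evol_initial\<close> requires.\<close>
  then have "filterlim \<tau> (at_right 0) (at 0 within J)"
    unfolding filterlim_at using evJ
    by (auto simp: \<tau>_0 elim!: eventually_mono dest: \<tau>_pos[OF DiffI])
  from filterlim_compose[OF sl.evol_initial[OF w] this]
  have lim: "((\<lambda>t. norm2_on {0..L0} (\<lambda>x. V x t - w x)) \<longlongrightarrow> 0) (at 0 within J)"
    by (simp add: V_def)
  have LV: "\<forall>\<^sub>F t in at 0 within J. L2_on {0..L0} (\<lambda>x. V x t)"
    using evJ by eventually_elim (auto simp: V_def intro!: sl.evol_L2[OF w] \<tau>_pos)
  have wu0: "exp (\<Phi> x 0) * w x = u0 x" for x
    by (simp add: w_def v0_def exp_minus)
  have lim2: "((\<lambda>t. norm2_on {0..L0} (\<lambda>x. exp (\<Phi> x t) * V x t - u0 x)) \<longlongrightarrow> 0)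
      (at 0 within J)"
    using weighted_L2_limit[OF continuous_exp_gauge(1) w LV lim] by (simp add: wu0)
  have "L2_tendsto {0..L0} (\<lambda>t x. u x t) u0 (at 0 within J)"
    unfolding L2_tendsto_iff
  proof
    show "\<forall>\<^sub>F t in at 0 within J. L2_on {0..L0} (\<lambda>x. u x t - u0 x)"
      using evJ
    proof eventually_elim
      case (elim t)
      then have "continuous_on {0..L0} (\<lambda>x. u x t)" using continuous_on_slice[OF uc] by blast
      then show ?case by (intro L2_on_diff u0 L2_on_continuous)
    qed
    show "((\<lambda>t. norm2_on {0..L0} (\<lambda>x. u x t - u0 x)) \<longlongrightarrow> 0) (at 0 within J)"
      by (rule Lim_transform_eventually[OF lim2]) (use evJ in \<open>auto simp: u_def elim!: eventually_mono\<close>)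
  qed
  moreover have "AE x in lebesgue_on {0..L0}. u x 0 = u0 x" by (simp add: u_def)
  ultimately have "transformed_solution D f0 L0 J L L' A' u0 u"
    unfolding transformed_solution_def using uc utc uxc uxxc deriv bd by blast
  then show ?thesis by blast
qed

text \<open>It holds for every solution and so carries the uniqueness: \<open>coef_evolution\<close>
  is applied to the gauged solution on [t1, t], then t1 tends to 0, where the coefficients converge
  because the datum is attained in L2.\<close>

lemma solution_coef:
  assumes u0: "L2_on {0..L0} u0" and u: "transformed_solution D f0 L0 J L L' A' u0 u"
    and t: "t \<in> J - {0}" and n: "n \<ge> 1"
  shows "sl.coef (\<lambda>x. exp (- \<Phi> x t) * u x t) n = exp (\<sigma> n * \<tau> t) * sl.coef (v0 u0) n"
proof -
  let ?J = "J - {0}"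
  have uc: "continuous_on ({0..L0} \<times> ?J) (\<lambda>(x, t). u x t)"
    and bd: "\<And>t. t \<in> ?J \<Longrightarrow> u 0 t = 0" "\<And>t. t \<in> ?J \<Longrightarrow> u L0 t = 0"
    and ini: "L2_tendsto {0..L0} (\<lambda>t x. u x t) u0 (at 0 within J)"
    using u unfolding transformed_solution_def by blast+
  obtain ut ux uxx where
    c: "continuous_on ({0<..<L0} \<times> ?J) (\<lambda>(x, t). ut x t)" "continuous_on ({0<..<L0} \<times> ?J) (\<lambda>(x, t). ux x t)"
      "continuous_on ({0<..<L0} \<times> ?J) (\<lambda>(x, t). uxx x t)"
    and d: "\<forall>x\<in>{0<..<L0}. \<forall>t\<in>?J.
           ((\<lambda>s. u x s) has_real_derivative ut x t) (at t) \<and>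
           ((\<lambda>x. u x t) has_real_derivative ux x t) (at x) \<and>
           ((\<lambda>x. ux x t) has_real_derivative uxx x t) (at x) \<and>
           ut x t = D * (L0\<^sup>2 / (L t)\<^sup>2) * uxx x t
                    + (A' t * L0 + x * L' t) / L t * ux x t + f0 * u x t"
    using u unfolding transformed_solution_def by blast
  define v where "v x t = exp (- \<Phi> x t) * u x t" for x t
  define vt where "vt x t = exp (- \<Phi> x t) * (ut x t - u x t * \<Phi>t x t)" for x t
  define vx where "vx x t = exp (- \<Phi> x t) * (ux x t - u x t * \<Phi>x x t)" for x t
  define vxx where "vxx x t = exp (- \<Phi> x t) * (uxx x t - 2 * ux x t * \<Phi>x x t + u x t * ((\<Phi>x x t)\<^sup>2 - \<Phi>xx t))" for x t
  have sub: "{0..L0} \<times> ?J \<subseteq> {0..L0} \<times> J" "{0<..<L0} \<times> ?J \<subseteq> {0<..<L0} \<times> J"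
    "{0<..<L0} \<times> ?J \<subseteq> {0..L0} \<times> ?J" by auto
  have vc: "continuous_on ({0..L0} \<times> ?J) (\<lambda>(x, t). v x t)"
    unfolding v_def case_prod_beta'
    by (intro continuous_on_mult continuous_on_subset[OF continuous_exp_gauge(2) sub(1), unfolded case_prod_beta']
        uc[unfolded case_prod_beta'])
  note gc = continuous_on_subset[OF continuous_exp_gauge(2) sub(2)]
    continuous_on_subset[OF continuous_gauge(2) sub(2)] continuous_on_subset[OF continuous_gauge(3) sub(2)]
    continuous_on_subset[OF continuous_gauge(4) sub(2)] continuous_on_subset[OF uc sub(3)] c
  note gc = gc[unfolded case_prod_beta']
  have vtc: "continuous_on ({0<..<L0} \<times> ?J) (\<lambda>(x, t). vt x t)"
    unfolding vt_def case_prod_beta' by (intro continuous_on_mult continuous_on_diff gc)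
  have vxxc: "continuous_on ({0<..<L0} \<times> ?J) (\<lambda>(x, t). vxx x t)"
    unfolding vxx_def case_prod_beta'
    by (intro continuous_on_mult continuous_on_diff continuous_on_add continuous_on_power continuous_on_const gc)
  have dv: "((\<lambda>s. v x s) has_real_derivative vt x t) (at t) \<and> ((\<lambda>x. v x t) has_real_derivative vx x t) (at x) \<and>
      ((\<lambda>x. vx x t) has_real_derivative vxx x t) (at x) \<and> vt x t = k t * (D * vxx x t + q x * v x t)"
    if x: "x \<in> {0<..<L0}" and t: "t \<in> ?J" for x t
  proof -
    have tJ: "t \<in> J" using t by auto
    have d1: "((\<lambda>s. u x s) has_real_derivative ut x t) (at t)" "((\<lambda>x. u x t) has_real_derivative ux x t) (at x)"
      "((\<lambda>x. ux x t) has_real_derivative uxx x t) (at x)"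
      using bspec[OF bspec[OF d x] t] by blast+
    have "ut x t = D * (L0\<^sup>2 / (L t)\<^sup>2) * uxx x t + (A' t * L0 + x * L' t) / L t * ux x t + f0 * u x t"
      using bspec[OF bspec[OF d x] t] by blast
    then have pde: "ut x t = D * k t * uxx x t + (- 2 * D * k t * \<Phi>x x t) * ux x t + f0 * u x t"
      unfolding drift_eq[OF tJ] k_def .
    note [derivative_intros] = d1 d\<Phi>t[OF tJ, unfolded J_at_interior[OF t]] d\<Phi>x d\<Phi>xx
    have 1: "((\<lambda>s. v x s) has_real_derivative vt x t) (at t)"
      unfolding v_def vt_def by (rule derivative_eq_intros refl)+ (simp add: algebra_simps)
    have 2: "((\<lambda>x. v x t) has_real_derivative vx x t) (at x)"
      unfolding v_def vx_def by (rule derivative_eq_intros refl)+ (simp add: algebra_simps)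
    have 3: "((\<lambda>x. vx x t) has_real_derivative vxx x t) (at x)"
      unfolding vx_def vxx_def by (rule derivative_eq_intros refl)+ (simp add: algebra_simps power2_eq_square)
    have "k t * (D * vxx x t + q x * v x t)
      = exp (- \<Phi> x t) * (D * k t * uxx x t - 2 * D * k t * \<Phi>x x t * ux x t
          + u x t * (k t * q x - D * k t * (\<Phi>xx t - (\<Phi>x x t)\<^sup>2)))"
      by (simp add: vxx_def v_def algebra_simps)
    also have "k t * q x - D * k t * (\<Phi>xx t - (\<Phi>x x t)\<^sup>2) = f0 - \<Phi>t x t"
      using gauge_identity[OF tJ, of x] by linarith
    also have "exp (- \<Phi> x t) * (D * k t * uxx x t - 2 * D * k t * \<Phi>x x t * ux x t + u x t * (f0 - \<Phi>t x t)) = vt x t"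
      unfolding vt_def pde by (simp add: algebra_simps)
    finally show ?thesis using 1 2 3 by simp
  qed
  have const: "exp (- \<sigma> n * \<tau> t) * sl.coef (\<lambda>x. v x t) n = exp (- \<sigma> n * \<tau> t1) * sl.coef (\<lambda>x. v x t1) n"
    if t1: "0 < t1" "t1 < t" for t1
  proof -
    have T: "{t1..t} \<subseteq> ?J" using J_down[of t] t t1 by auto
    then have TJ: "{t1..t} \<subseteq> J" by auto
    show ?thesis
      unfolding sl.coef_def
    proof (rule sl.coef_evolution[where vt = vt and vx = vx and vxx = vxx and k = k])
      show "continuous_on ({0..L0} \<times> {t1..t}) (\<lambda>(x, t). v x t)"
        by (rule continuous_on_subset[OF vc]) (use T in auto)
      show "continuous_on ({0<..<L0} \<times> {t1..t}) (\<lambda>(x, t). vt x t)"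
        by (rule continuous_on_subset[OF vtc]) (use T in auto)
      show "continuous_on ({0<..<L0} \<times> {t1..t}) (\<lambda>(x, t). vxx x t)"
        by (rule continuous_on_subset[OF vxxc]) (use T in auto)
      show "continuous_on {t1..t} k" by (rule continuous_on_subset[OF k_continuous TJ])
      show "(\<tau> has_real_derivative k s) (at s within {t1..t})" if "s \<in> {t1..t}" for s
        by (rule DERIV_subset[OF d\<tau> TJ]) (use that TJ in auto)
      show "v 0 s = 0" "v L0 s = 0" if "s \<in> {t1..t}" for s
        using bd[of s] subsetD[OF T that] by (simp_all add: v_def)
      fix x s assume x: "x \<in> {0<..<L0}" and s: "s \<in> {t1..t}"
      have sJ: "s \<in> ?J" using s T by blast
      show "(v x has_real_derivative vt x s) (at s within {t1..t})"
        using dv[OF x sJ] has_field_derivative_at_within by blast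
      show "((\<lambda>x. v x s) has_real_derivative vx x s) (at x)" "((\<lambda>x. vx x s) has_real_derivative vxx x s) (at x)"
        "vt x s = k s * (D * vxx x s + q x * v x s)" using dv[OF x sJ] by auto
    qed (use t1 n in auto)
  qed
  obtain r where r: "r > 0" "{0..r} \<subseteq> J" "at 0 within J = at 0 within {0..r}"
    using J_at[OF zero_in_J] by blast
  have evJ: "\<forall>\<^sub>F t in at 0 within J. t \<in> ?J"
    using eventually_at_0_J[OF r] r(2) by (auto elim!: eventually_mono)
  have Lu: "L2_on {0..L0} (\<lambda>x. u x t)" and Lv: "L2_on {0..L0} (\<lambda>x. v x t)" if "t \<in> ?J" for t
    using continuous_on_slice[OF uc that] continuous_on_slice[OF vc that] by (auto intro: L2_on_continuous)
  have evL: "\<forall>\<^sub>F t in at 0 within J. L2_on {0..L0} (\<lambda>x. u x t)"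
    using evJ by eventually_elim (rule Lu)
  have lim: "((\<lambda>t. norm2_on {0..L0} (\<lambda>x. v x t - v0 u0 x)) \<longlongrightarrow> 0) (at 0 within J)"
    unfolding v_def v0_def
    using weighted_L2_limit[OF continuous_exp_gauge(2) u0 evL] ini by (simp add: L2_tendsto_iff)
  have climit: "((\<lambda>t. sl.coef (\<lambda>x. v x t) n) \<longlongrightarrow> sl.coef (v0 u0) n) (at 0 within J)"
  proof (rule LIM_zero_cancel, rule Lim_null_comparison)
    show "((\<lambda>t. sqrt (norm2_on {0..L0} (\<lambda>x. v x t - v0 u0 x))) \<longlongrightarrow> 0) (at 0 within J)"
      using tendsto_real_sqrt[OF lim] by simp
    show "\<forall>\<^sub>F t in at 0 within J. norm (sl.coef (\<lambda>x. v x t) n - sl.coef (v0 u0) n)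
        \<le> sqrt (norm2_on {0..L0} (\<lambda>x. v x t - v0 u0 x))"
      using evJ
    proof eventually_elim
      case (elim s)
      have "sl.coef (\<lambda>x. v x s) n - sl.coef (v0 u0) n = sl.coef (\<lambda>x. v x s - v0 u0 x) n"
        unfolding sl.coef_def using Lv[OF elim] v0_L2[OF u0] sl.e_L2[OF n] by (simp add: inner_on_diff_left)
      then show ?case
        using sl.coef_bounded[OF L2_on_diff[OF Lv[OF elim] v0_L2[OF u0]] n] by simp
    qed
  qed
  have "(\<tau> \<longlongrightarrow> \<tau> 0) (at 0 within J)"
    using \<tau>_continuous zero_in_J by (simp add: continuous_on_def)
  then have "((\<lambda>t. exp (- \<sigma> n * \<tau> t) * sl.coef (\<lambda>x. v x t) n) \<longlongrightarrow> exp (- \<sigma> n * \<tau> 0) * sl.coef (v0 u0) n) (at 0 within J)"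
    by (intro tendsto_intros climit)
  moreover have "\<forall>\<^sub>F t1 in at 0 within J. exp (- \<sigma> n * \<tau> t1) * sl.coef (\<lambda>x. v x t1) n
      = exp (- \<sigma> n * \<tau> t) * sl.coef (\<lambda>x. v x t) n"
  proof -
    have "t > 0" using t J_nonneg[of t] by auto
    then have "\<forall>\<^sub>F t1 in at 0 within J. t1 < t" by (rule order_tendstoD(2)[OF tendsto_ident_at])
    with eventually_at_0_J[OF r] show ?thesis
      by eventually_elim (metis const greaterThanAtMost_iff)
  qed
  ultimately have "((\<lambda>t1. exp (- \<sigma> n * \<tau> t) * sl.coef (\<lambda>x. v x t) n) \<longlongrightarrow> sl.coef (v0 u0) n) (at 0 within J)"
    by (simp add: \<tau>_0 Lim_transform_eventually)
  then have "exp (- \<sigma> n * \<tau> t) * sl.coef (\<lambda>x. v x t) n = sl.coef (v0 u0) n"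
    using tendsto_unique[OF at_0_J_nontrivial tendsto_const] by blast
  then show ?thesis
    by (simp add: v_def exp_minus field_simps)
qed

text \<open>The gauged solution is expanded in the \<open>e n\<close>, and the bounded factor exp
  \<Phi> preserves L2 convergence. Division by \<open>nrm n\<close> passes from \<open>e n\<close>
  back to \<open>g n\<close>.\<close>

lemma solution_expansion:
  assumes u0: "L2_on {0..L0} u0" and u: "transformed_solution D f0 L0 J L L' A' u0 u" and t: "t \<in> J"
  shows "L2_tendsto {0..L0}
    (\<lambda>N x. \<Sum>n=1..N. sl.coef (v0 u0) n / sl.nrm n * mode D f0 L0 L L' A' (\<sigma> n) (g n) x t)
    (\<lambda>x. u x t) sequentially"
proof -
  \<comment> \<open>For t = 0 the function \<open>V\<close> is the gauged datum, which equals exp (-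
    \<Phi>) u only almost everywhere.\<close>
  obtain V where V: "L2_on {0..L0} V" "AE x in lebesgue_on {0..L0}. exp (\<Phi> x t) * V x = u x t"
    "\<And>n. n \<ge> 1 \<Longrightarrow> sl.coef V n = exp (\<sigma> n * \<tau> t) * sl.coef (v0 u0) n"
  proof (cases "t = 0")
    case True
    have "AE x in lebesgue_on {0..L0}. u x 0 = u0 x"
      using u unfolding transformed_solution_def by blast
    then have "AE x in lebesgue_on {0..L0}. exp (\<Phi> x t) * v0 u0 x = u x t"
      by eventually_elim (simp add: True v0_def exp_minus)
    then show thesis using that[OF v0_L2[OF u0]] by (simp add: True \<tau>_0)
  next
    case False
    then have t': "t \<in> J - {0}" using t by blast
    have "continuous_on {0..L0} (\<lambda>x. u x t)"
      using u continuous_on_slice[OF _ t'] unfolding transformed_solution_def by blast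
    then have "L2_on {0..L0} (\<lambda>x. exp (- \<Phi> x t) * u x t)"
      by (intro L2_on_mult_continuous L2_on_continuous continuous_on_slice[OF continuous_exp_gauge(2) t])
    then show thesis using that[of "\<lambda>x. exp (- \<Phi> x t) * u x t"] solution_coef[OF u0 u t']
      by (simp add: exp_minus)
  qed
  let ?S = "\<lambda>N x. \<Sum>n=1..N. sl.coef V n * sl.e n x"
  let ?T = "\<lambda>N x. \<Sum>n=1..N. sl.coef (v0 u0) n / sl.nrm n * mode D f0 L0 L L' A' (\<sigma> n) (g n) x t"
  have T: "?T N x = exp (\<Phi> x t) * ?S N x" for N x
    unfolding sum_distrib_left mode_eq[OF t] using V(3)
    by (intro sum.cong refl) (simp add: sl.e_def)
  have ce: "continuous_on {0..L0} (\<lambda>x. exp (\<Phi> x t))" by (rule continuous_on_slice[OF continuous_exp_gauge(1) t])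
  obtain B where B: "\<And>x. x \<in> {0..L0} \<Longrightarrow> \<bar>exp (\<Phi> x t)\<bar> \<le> B" using bounded_continuous_Icc[OF ce] by blast
  have LS: "L2_on {0..L0} (\<lambda>x. V x - ?S N x)" for N
    by (intro L2_on_diff V(1) sl.sum_e_L2) auto
  let ?d = "\<lambda>N x. exp (\<Phi> x t) * (V x - ?S N x)"
  have Ld: "L2_on {0..L0} (?d N)" for N by (rule L2_on_mult_continuous[OF LS ce])
  have ae: "AE x in lebesgue_on {0..L0}. - 1 * ?d N x = ?T N x - u x t" for N
    using V(2) by eventually_elim (simp only: T, simp add: algebra_simps)
  note cong = L2_on_cong_AE[OF L2_on_cmult[OF Ld] _ ae]
  have "norm2_on {0..L0} (\<lambda>x. ?T N x - u x t) = norm2_on {0..L0} (?d N)" for N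
    using cong(2)[of N] by (simp add: inner_on_cmult_left inner_on_cmult_right inner_on_def)
  moreover have "(\<lambda>N. norm2_on {0..L0} (?d N)) \<longlonglongrightarrow> 0"
  proof (rule tendsto_sandwich[OF _ _ tendsto_const])
    show "\<forall>\<^sub>F N in sequentially. norm2_on {0..L0} (?d N)
        \<le> B\<^sup>2 * norm2_on {0..L0} (\<lambda>x. V x - ?S N x)"
      using inner_on_mult_le[OF LS ce B] by (auto intro!: always_eventually)
    show "(\<lambda>N. B\<^sup>2 * norm2_on {0..L0} (\<lambda>x. V x - ?S N x)) \<longlonglongrightarrow> 0"
      using tendsto_mult_right_zero[OF sl.expansion[OF V(1)]] .
  qed (auto intro!: always_eventually inner_on_self_nonneg)
  ultimately show ?thesis
    unfolding L2_tendsto_iff using cong(1) by (auto intro!: always_eventually)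
qed

end

section \<open>Closed forms\<close>

context moving_interval
begin

lemma mode_eq_powr:
  assumes t: "t \<in> J"
  shows "mode D f0 L0 L L' A' s h x t = exp (s * \<tau> t) * h x * (L0 / L t) powr (1/2) *
    exp (f0 * t - I t - x\<^sup>2 * (a * t + b) / (4 * D * L0\<^sup>2) - x * (A' t * L t) / (2 * D * L0))"
  using L'_eq[OF t] L(1)[OF t] by (simp add: mode_def I_def \<tau>_def mult.assoc)

text \<open>\<open>A\<close> and a particular solution \<open>F\<close> of F'' = \<gamma>1 / L^3
  differ by an affine function of time; each case below supplies its own \<open>F\<close>.\<close>

lemma A_form:
  assumes F: "\<And>t. t \<in> J \<Longrightarrow> (F has_real_derivative F' t) (at t within J)"
    "\<And>t. t \<in> J \<Longrightarrow> (F' has_real_derivative \<gamma>1 / L t ^ 3) (at t within J)"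
  obtains c d where "\<And>t. t \<in> J \<Longrightarrow> A t = F t + c * t + d" "\<And>t. t \<in> J \<Longrightarrow> A' t = F' t + c"
proof -
  define c where "c = A' 0 - F' 0"
  define d where "d = A 0 - F 0"
  have A': "A' t = F' t + c" if t: "t \<in> J" for t
    using J_const[of "\<lambda>t. A' t - F' t", OF _ t] DERIV_diff[OF dA'_L F(2)] by (simp add: c_def)
  have "((\<lambda>t. A t - (F t + c * t)) has_real_derivative 0) (at t within J)" if t: "t \<in> J" for t
    using DERIV_diff[OF dA[OF t] DERIV_add[OF F(1)[OF t] DERIV_cmult[OF DERIV_ident, of c]]] A'[OF t] by simp
  then have "A t = F t + c * t + d" if t: "t \<in> J" for t
    using J_const[of "\<lambda>t. A t - (F t + c * t)", OF _ t] by (simp add: d_def)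
  with A' show thesis by (rule that[rotated])
qed

lemma \<tau>_eq:
  assumes "\<And>t. t \<in> J \<Longrightarrow> (F has_real_derivative L0\<^sup>2 / (L t)\<^sup>2) (at t within J)" "F 0 = 0" "t \<in> J"
  shows "\<tau> t = F t"
  unfolding \<tau>_def using J_antiderivative[OF assms(3,1)] assms(2) by simp

lemma I_eq:
  assumes "\<And>t. t \<in> J \<Longrightarrow> (F has_real_derivative (A' t)\<^sup>2) (at t within J)" "F 0 = 0" "t \<in> J"
  shows "I t = F t / (4 * D)"
proof -
  have "((\<lambda>t. F t / (4 * D)) has_real_derivative (A' t)\<^sup>2 / (4 * D)) (at t within J)" if "t \<in> J" for t
    by (rule DERIV_cdivide[OF assms(1)[OF that]])
  from J_antiderivative[OF assms(3) this] show ?thesis unfolding I_def by (simp add: assms(2))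
qed

lemma constant_length_eq: "a = 0 \<Longrightarrow> b = 0 \<Longrightarrow> t \<in> J \<Longrightarrow> L t = L0"
  using L_eq[of t] L0 by simp

lemma constant_length:
  assumes ab: "a = 0" "b = 0"
  shows "\<exists>c d. (\<forall>t\<in>J. A t = \<gamma>1 / (2 * L0^3) * t\<^sup>2 + c * t + d) \<and>
       (\<forall>s h \<xi>. \<forall>t\<in>J. mode D f0 L0 L L' A' s h \<xi> t = exp (s * t) * h \<xi> *
          exp (f0 * t
            - 1 / (4 * D) * (\<gamma>1\<^sup>2 / (3 * L0^6) * t^3 + c * \<gamma>1 / L0^3 * t\<^sup>2 + c\<^sup>2 * t)
            - \<xi> / (2 * D * L0) * (\<gamma>1 / L0\<^sup>2 * t + c * L0)))"
    (is "\<exists>c d. _ \<and> (\<forall>s h \<xi>. \<forall>t\<in>J. _ = ?R c s h \<xi> t)")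
proof -
  note Lt = constant_length_eq[OF ab]
  obtain c d where A: "\<And>t. t \<in> J \<Longrightarrow> A t = \<gamma>1 / (2 * L0^3) * t\<^sup>2 + c * t + d"
    "\<And>t. t \<in> J \<Longrightarrow> A' t = \<gamma>1 / L0^3 * t + c"
  proof (rule A_form)
    have "((\<lambda>t. t\<^sup>2) has_real_derivative 2 * t) (at t within J)" for t
      by (auto intro!: derivative_eq_intros)
    from DERIV_cmult[OF this, of "\<gamma>1 / (2 * L0^3)"]
    show "((\<lambda>t. \<gamma>1 / (2 * L0^3) * t\<^sup>2) has_real_derivative \<gamma>1 / L0^3 * t) (at t within J)" for t
      by simp
    show "((\<lambda>t. \<gamma>1 / L0^3 * t) has_real_derivative \<gamma>1 / L t ^ 3) (at t within J)" if "t \<in> J" for t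
      unfolding Lt[OF that] by (rule DERIV_cmult_Id)
  qed (use that in blast)
  have \<tau>: "\<tau> t = t" if t: "t \<in> J" for t
    by (rule \<tau>_eq[OF _ _ t]) (use Lt L0 in \<open>auto intro!: derivative_eq_intros\<close>)
  have I: "I t = (\<gamma>1\<^sup>2 / (3 * L0^6) * t^3 + c * \<gamma>1 / L0^3 * t\<^sup>2 + c\<^sup>2 * t) / (4 * D)" if t: "t \<in> J" for t
  proof (rule I_eq[OF _ _ t])
    fix t assume t: "t \<in> J"
    have "(A' t)\<^sup>2 = \<gamma>1\<^sup>2 / L0^6 * t\<^sup>2 + 2 * (c * \<gamma>1 / L0^3) * t + c\<^sup>2"
    proof -
      have "(\<gamma>1 / L0^3 * t)\<^sup>2 = \<gamma>1\<^sup>2 / L0^6 * t\<^sup>2"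
        by (simp add: power_mult_distrib power_divide flip: power_mult)
      moreover have "2 * (\<gamma>1 / L0^3 * t) * c = 2 * (c * \<gamma>1 / L0^3) * t" by simp
      ultimately show ?thesis unfolding A(2)[OF t] power2_sum by linarith
    qed
    moreover have "((\<lambda>t. \<gamma>1\<^sup>2 / (3 * L0^6) * t^3 + c * \<gamma>1 / L0^3 * t\<^sup>2 + c\<^sup>2 * t) has_real_derivative
       \<gamma>1\<^sup>2 / (3 * L0^6) * (3 * t\<^sup>2) + c * \<gamma>1 / L0^3 * (2 * t) + c\<^sup>2) (at t within J)"
      by (intro DERIV_add DERIV_cmult DERIV_cmult_Id) (auto intro!: derivative_eq_intros)
    moreover have "\<gamma>1\<^sup>2 / (3 * L0^6) * (3 * t\<^sup>2) = \<gamma>1\<^sup>2 / L0^6 * t\<^sup>2"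
      "c * \<gamma>1 / L0^3 * (2 * t) = 2 * (c * \<gamma>1 / L0^3) * t" by simp_all
    ultimately show "((\<lambda>t. \<gamma>1\<^sup>2 / (3 * L0^6) * t^3 + c * \<gamma>1 / L0^3 * t\<^sup>2 + c\<^sup>2 * t) has_real_derivative (A' t)\<^sup>2) (at t within J)"
      by (simp only:)
  qed simp
  have "mode D f0 L0 L L' A' s h \<xi> t = ?R c s h \<xi> t" if t: "t \<in> J" for s h \<xi> t
  proof -
    have "A' t * L t = \<gamma>1 / L0\<^sup>2 * t + c * L0"
      unfolding A(2)[OF t] Lt[OF t] using L0 by (simp add: field_simps power2_eq_square power3_eq_cube)
    then show ?thesis
      unfolding mode_eq_powr[OF t] \<tau>[OF t] I[OF t] using ab L0 Lt[OF t] by simp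
  qed
  with A(1) show ?thesis by blast
qed

lemma linear_length:
  assumes a: "a \<noteq> 0" and \<gamma>: "\<gamma>0 = 0"
  shows "\<exists>\<alpha>. \<alpha> \<noteq> 0 \<and> (\<forall>t\<in>J. L t = L0 + \<alpha> * t) \<and>
    (\<exists>c d. (\<forall>t\<in>J. A t = \<gamma>1 / (2 * \<alpha>\<^sup>2 * (L0 + \<alpha> * t)) + c * t + d) \<and>
       (\<forall>s h \<xi>. \<forall>t\<in>J. mode D f0 L0 L L' A' s h \<xi> t = exp (s * L0 * t / (L0 + \<alpha> * t)) * h \<xi> *
            (L0 / (L0 + \<alpha> * t)) powr (1/2) * exp (f0 * t) *
            exp (- (1 / (4 * D)) *
              (c\<^sup>2 * t - c * \<gamma>1 * t / (\<alpha> * L0 * (L0 + \<alpha> * t))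
               - \<gamma>1\<^sup>2 / (12 * \<alpha>^3) * (1 / (L0 + \<alpha> * t)^3 - 1 / L0^3))) *
            exp (- (\<xi>\<^sup>2 * \<alpha> * (L0 + \<alpha> * t) / (4 * D * L0\<^sup>2))
              - \<xi> * c * (L0 + \<alpha> * t) / (2 * D * L0)
              + \<xi> * \<gamma>1 / (4 * D * L0 * \<alpha> * (L0 + \<alpha> * t)))))"
    (is "\<exists>\<alpha>. _ \<and> _ \<and> (\<exists>c d. _ \<and> (\<forall>s h \<xi>. \<forall>t\<in>J. _ = ?R \<alpha> c s h \<xi> t))")
proof -
  \<comment> \<open>As \<gamma>0 = 0 gives a = (b / L0)^2, the polynomial is the square of L0 +
    \<alpha> t.\<close>
  define \<alpha> where "\<alpha> = b / L0"
  have b: "b = \<alpha> * L0" using L0 by (simp add: \<alpha>_def)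
  have a\<alpha>: "a = \<alpha>\<^sup>2" using \<gamma> L0 unfolding \<gamma>0 b by (simp add: power_mult_distrib)
  have \<alpha>: "\<alpha> \<noteq> 0" using a a\<alpha> by auto
  have sq: "(L t)\<^sup>2 = (L0 + \<alpha> * t)\<^sup>2" if "t \<in> J" for t
    unfolding L(2)[OF that] a\<alpha> b by (simp add: power2_eq_square algebra_simps)
  \<comment> \<open>The square root could have the opposite sign only past the zero - L0 / \<alpha>;
    that zero would lie in \<open>J\<close>, where \<open>L\<close> would vanish.\<close>
  have pos: "L0 + \<alpha> * t > 0" if t: "t \<in> J" for t
  proof (rule ccontr)
    assume neg: "\<not> L0 + \<alpha> * t > 0"
    then have "\<alpha> < 0" using J_nonneg[OF t] L0 mult_nonneg_nonneg[of \<alpha> t] by linarith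
    then have "- L0 / \<alpha> \<in> {0..t}" using neg L0 by (auto simp: field_simps)
    then have s: "- L0 / \<alpha> \<in> J" using J_down[OF t] by blast
    show False using sq[OF s] L(1)[OF s] \<alpha> by simp
  qed
  have Lt: "L t = L0 + \<alpha> * t" if "t \<in> J" for t
    using sq[OF that] pos[OF that] L(1)[OF that] by (simp add: power2_eq_iff_nonneg)
  have dl: "((\<lambda>t. L0 + \<alpha> * t) has_real_derivative \<alpha>) (at t within J)" for t
    by (auto intro!: derivative_eq_intros)
  obtain c d where A: "\<And>t. t \<in> J \<Longrightarrow> A t = \<gamma>1 / (2 * \<alpha>\<^sup>2 * (L0 + \<alpha> * t)) + c * t + d"
    "\<And>t. t \<in> J \<Longrightarrow> A' t = - \<gamma>1 / (2 * \<alpha> * (L0 + \<alpha> * t)\<^sup>2) + c"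
  proof (rule A_form)
    fix t assume t: "t \<in> J"
    define y where "y = L0 + \<alpha> * t"
    have y: "y \<noteq> 0" using pos[OF t] by (simp add: y_def)
    have "((\<lambda>t. 1 / (L0 + \<alpha> * t)) has_real_derivative - (\<alpha> / y\<^sup>2)) (at t within J)"
      using DERIV_divide[OF DERIV_const[of 1] dl[of t]] y by (simp add: y_def power2_eq_square)
    from DERIV_cmult[OF this, of "\<gamma>1 / (2 * \<alpha>\<^sup>2)"] \<alpha>
    show "((\<lambda>t. \<gamma>1 / (2 * \<alpha>\<^sup>2 * (L0 + \<alpha> * t))) has_real_derivative - \<gamma>1 / (2 * \<alpha> * (L0 + \<alpha> * t)\<^sup>2)) (at t within J)"
      by (simp add: y_def power2_eq_square)
    have "((\<lambda>t. (L0 + \<alpha> * t)\<^sup>2) has_real_derivative 2 * y * \<alpha>) (at t within J)"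
      unfolding y_def by (rule derivative_eq_intros dl refl)+ simp
    from DERIV_divide[OF DERIV_const[of 1] this] y
    have "((\<lambda>t. 1 / (L0 + \<alpha> * t)\<^sup>2) has_real_derivative - (2 * y * \<alpha> / (y\<^sup>2 * y\<^sup>2))) (at t within J)"
      by (simp add: y_def)
    moreover have "2 * y * \<alpha> / (y\<^sup>2 * y\<^sup>2) = 2 * \<alpha> / y ^ 3"
      using y by (simp add: power2_eq_square power3_eq_cube)
    ultimately have "((\<lambda>t. 1 / (L0 + \<alpha> * t)\<^sup>2) has_real_derivative - (2 * \<alpha> / y ^ 3)) (at t within J)"
      by simp
    from DERIV_cmult[OF this, of "- \<gamma>1 / (2 * \<alpha>)"] \<alpha>
    show "((\<lambda>t. - \<gamma>1 / (2 * \<alpha> * (L0 + \<alpha> * t)\<^sup>2)) has_real_derivative \<gamma>1 / L t ^ 3) (at t within J)"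
      unfolding Lt[OF t] by (simp add: y_def)
  qed (use that in blast)
  have \<tau>: "\<tau> t = L0 * t / (L0 + \<alpha> * t)" if t: "t \<in> J" for t
  proof (rule \<tau>_eq[OF _ _ t])
    fix t assume t: "t \<in> J"
    have "((\<lambda>t. L0 * t / (L0 + \<alpha> * t)) has_real_derivative
        (L0 * (L0 + \<alpha> * t) - L0 * t * \<alpha>) / ((L0 + \<alpha> * t) * (L0 + \<alpha> * t))) (at t within J)"
      using pos[OF t] by (intro DERIV_divide dl DERIV_cmult_Id) auto
    moreover have "L0 * (L0 + \<alpha> * t) - L0 * t * \<alpha> = L0\<^sup>2" by (simp add: power2_eq_square algebra_simps)
    ultimately show "((\<lambda>t. L0 * t / (L0 + \<alpha> * t)) has_real_derivative L0\<^sup>2 / (L t)\<^sup>2) (at t within J)"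
      unfolding Lt[OF t] by (simp add: power2_eq_square)
  qed simp
  \<comment> \<open>The antiderivative of A'^2 that vanishes at 0.\<close>
  let ?G = "\<lambda>t. c\<^sup>2 * t - c * \<gamma>1 * t / (\<alpha> * L0 * (L0 + \<alpha> * t))
               - \<gamma>1\<^sup>2 / (12 * \<alpha>^3) * (1 / (L0 + \<alpha> * t)^3 - 1 / L0^3)"
  have I: "I t = ?G t / (4 * D)" if t: "t \<in> J" for t
  proof (rule I_eq[OF _ _ t])
    fix t assume t: "t \<in> J"
    define y where "y = L0 + \<alpha> * t"
    have y: "y \<noteq> 0" using pos[OF t] by (simp add: y_def)
    have 1: "((\<lambda>t. c * \<gamma>1 * t / (\<alpha> * L0 * (L0 + \<alpha> * t))) has_real_derivative c * \<gamma>1 / (\<alpha> * y\<^sup>2)) (at t within J)"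
    proof -
      have "((\<lambda>t. c * \<gamma>1 * t / (\<alpha> * L0 * (L0 + \<alpha> * t))) has_real_derivative
        (c * \<gamma>1 * (\<alpha> * L0 * y) - c * \<gamma>1 * t * (\<alpha> * L0 * \<alpha>)) / ((\<alpha> * L0 * y) * (\<alpha> * L0 * y))) (at t within J)"
        unfolding y_def using pos[OF t] \<alpha> L0 by (intro DERIV_divide DERIV_cmult dl DERIV_cmult_Id) auto
      moreover have "c * \<gamma>1 * (\<alpha> * L0 * y) - c * \<gamma>1 * t * (\<alpha> * L0 * \<alpha>) = c * \<gamma>1 * \<alpha> * L0 * L0"
        by (simp add: y_def algebra_simps)
      moreover have "c * \<gamma>1 * \<alpha> * L0 * L0 / ((\<alpha> * L0 * y) * (\<alpha> * L0 * y)) = c * \<gamma>1 / (\<alpha> * y\<^sup>2)"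
        using y \<alpha> L0 by (simp add: power2_eq_square)
      ultimately show ?thesis by simp
    qed
    have 2: "((\<lambda>t. 1 / (L0 + \<alpha> * t)^3) has_real_derivative - (3 * \<alpha> / y ^ 4)) (at t within J)"
    proof -
      have "((\<lambda>t. (L0 + \<alpha> * t)^3) has_real_derivative 3 * y\<^sup>2 * \<alpha>) (at t within J)"
        unfolding y_def by (rule derivative_eq_intros dl refl)+ simp
      from DERIV_divide[OF DERIV_const[of 1] this] y
      have "((\<lambda>t. 1 / (L0 + \<alpha> * t)^3) has_real_derivative - (3 * y\<^sup>2 * \<alpha>) / (y^3 * y^3)) (at t within J)"
        by (simp add: y_def)
      moreover have "(3 * y\<^sup>2 * \<alpha>) / (y^3 * y^3) = 3 * \<alpha> / y ^ 4"
        using y by (simp add: field_simps power2_eq_square power3_eq_cube power4_eq_xxxx)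
      ultimately show ?thesis by simp
    qed
    have "((\<lambda>t. c\<^sup>2 * t) has_real_derivative c\<^sup>2) (at t within J)" by (rule DERIV_cmult_Id)
    from DERIV_diff[OF DERIV_diff[OF this 1] DERIV_cmult[OF DERIV_diff[OF 2 DERIV_const[of "1 / L0^3"]], of "\<gamma>1\<^sup>2 / (12 * \<alpha>^3)"]]
    have "(?G has_real_derivative c\<^sup>2 - c * \<gamma>1 / (\<alpha> * y\<^sup>2) - \<gamma>1\<^sup>2 / (12 * \<alpha>^3) * (- (3 * \<alpha> / y ^ 4) - 0)) (at t within J)" .
    moreover have "c\<^sup>2 - c * \<gamma>1 / (\<alpha> * y\<^sup>2) - \<gamma>1\<^sup>2 / (12 * \<alpha>^3) * (- (3 * \<alpha> / y ^ 4) - 0) = (A' t)\<^sup>2"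
    proof -
      have "A' t = c - \<gamma>1 / (2 * \<alpha> * y\<^sup>2)" using A(2)[OF t] by (simp add: y_def)
      then have "(A' t)\<^sup>2 = c\<^sup>2 + (\<gamma>1 / (2 * \<alpha> * y\<^sup>2))\<^sup>2 - 2 * c * (\<gamma>1 / (2 * \<alpha> * y\<^sup>2))" by (simp only: power2_diff)
      moreover have "2 * c * (\<gamma>1 / (2 * \<alpha> * y\<^sup>2)) = c * \<gamma>1 / (\<alpha> * y\<^sup>2)" by simp
      moreover have "(\<gamma>1 / (2 * \<alpha> * y\<^sup>2))\<^sup>2 = \<gamma>1\<^sup>2 / (12 * \<alpha>^3) * (3 * \<alpha> / y ^ 4)"
        using y \<alpha> by (simp add: field_simps power2_eq_square power3_eq_cube power4_eq_xxxx)
      ultimately show ?thesis by simp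
    qed
    ultimately show "(?G has_real_derivative (A' t)\<^sup>2) (at t within J)" by simp
  qed simp
  have "mode D f0 L0 L L' A' s h \<xi> t = ?R \<alpha> c s h \<xi> t" if t: "t \<in> J" for s h \<xi> t
  proof -
    define y where "y = L0 + \<alpha> * t"
    have y: "y \<noteq> 0" using pos[OF t] by (simp add: y_def)
    have Ly: "L t = y" using Lt[OF t] by (simp add: y_def)
    have ab: "a * t + b = \<alpha> * y" unfolding a\<alpha> b y_def by (simp add: power2_eq_square algebra_simps)
    have "A' t = c - \<gamma>1 / (2 * \<alpha> * y\<^sup>2)" using A(2)[OF t] by (simp add: y_def)
    then have AL: "A' t * L t = c * y - \<gamma>1 / (2 * \<alpha> * y)"
      unfolding Ly using y \<alpha> by (simp add: left_diff_distrib power2_eq_square)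
    have 1: "\<xi> * (A' t * L t) / (2 * D * L0) = \<xi> * c * y / (2 * D * L0) - \<xi> * \<gamma>1 / (4 * D * L0 * \<alpha> * y)"
      unfolding AL using y \<alpha> D L0 by (simp add: right_diff_distrib diff_divide_distrib mult_ac)
    have 2: "s * \<tau> t = s * L0 * t / y" unfolding \<tau>[OF t] by (simp add: y_def)
    have "mode D f0 L0 L L' A' s h \<xi> t = exp (s * L0 * t / y) * h \<xi> * (L0 / y) powr (1/2) *
        exp (f0 * t - ?G t / (4 * D) - \<xi>\<^sup>2 * (\<alpha> * y) / (4 * D * L0\<^sup>2)
          - (\<xi> * c * y / (2 * D * L0) - \<xi> * \<gamma>1 / (4 * D * L0 * \<alpha> * y)))"
      unfolding mode_eq_powr[OF t] I[OF t] ab 1 2 unfolding Ly ..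
    also have "f0 * t - ?G t / (4 * D) - \<xi>\<^sup>2 * (\<alpha> * y) / (4 * D * L0\<^sup>2)
          - (\<xi> * c * y / (2 * D * L0) - \<xi> * \<gamma>1 / (4 * D * L0 * \<alpha> * y))
        = f0 * t + (- (1 / (4 * D)) * ?G t) + (- (\<xi>\<^sup>2 * \<alpha> * y / (4 * D * L0\<^sup>2))
          - \<xi> * c * y / (2 * D * L0) + \<xi> * \<gamma>1 / (4 * D * L0 * \<alpha> * y))"
    proof -
      have "?G t / (4 * D) = 1 / (4 * D) * ?G t" by simp
      moreover have "\<xi>\<^sup>2 * (\<alpha> * y) / (4 * D * L0\<^sup>2) = \<xi>\<^sup>2 * \<alpha> * y / (4 * D * L0\<^sup>2)" by simp
      ultimately show ?thesis by linarith
    qed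
    finally show ?thesis unfolding exp_add y_def[symmetric] by (simp only: mult.assoc)
  qed
  with \<alpha> Lt A(1) show ?thesis by blast
qed

text \<open>Common form of the cases with \<gamma>0 \<noteq> 0, with \<open>\<tau>\<close> left
  unevaluated. The term added to \<open>s\<close> collects the part of the integral of A'^2 that is
  a multiple of \<open>\<tau>\<close>.\<close>

definition general_mode where
  "general_mode c s h \<xi> t =
      exp ((s + \<gamma>1\<^sup>2 / (4 * D * \<gamma>0 * L0\<^sup>2)) * \<tau> t) * h \<xi> * (L0 / L t) powr (1/2) *
      exp (f0 * t - 1 / (4 * D) * (\<gamma>1\<^sup>2 * a / \<gamma>0\<^sup>2 + c\<^sup>2) * t - c * \<gamma>1 / (2 * D * \<gamma>0) * (L t - L0)) *
      exp (- (\<xi>\<^sup>2 * (a * t + b) / (4 * D * L0\<^sup>2)) - \<xi> * \<gamma>1 * (a * t + b) / (2 * D * L0 * \<gamma>0)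
        - \<xi> * c / (2 * D * L0) * L t)"

text \<open>Here L'' = \<gamma>0 / L^3, so \<gamma>1 / \<gamma>0 times L is a particular solution
  for \<open>A\<close>. In A'^2 the quotient (a t + b)^2 / L^2 equals a - \<gamma>0 / L^2, whose
  second summand integrates to a multiple of \<open>\<tau>\<close>.\<close>

lemma nonzero_discriminant:
  assumes \<gamma>: "\<gamma>0 \<noteq> 0"
  obtains c d where "\<And>t. t \<in> J \<Longrightarrow> A t = \<gamma>1 / \<gamma>0 * L t + c * t + d"
    "\<And>s h \<xi> t. t \<in> J \<Longrightarrow> mode D f0 L0 L L' A' s h \<xi> t = general_mode c s h \<xi> t"
proof -
  have dL': "(L has_real_derivative (a * t + b) / L t) (at t within J)" if "t \<in> J" for t
    using dL[OF that] L'_eq[OF that] by simp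
  obtain c d where A: "\<And>t. t \<in> J \<Longrightarrow> A t = \<gamma>1 / \<gamma>0 * L t + c * t + d"
    "\<And>t. t \<in> J \<Longrightarrow> A' t = \<gamma>1 / \<gamma>0 * ((a * t + b) / L t) + c"
  proof (rule A_form)
    fix t assume t: "t \<in> J"
    show "((\<lambda>t. \<gamma>1 / \<gamma>0 * L t) has_real_derivative \<gamma>1 / \<gamma>0 * ((a * t + b) / L t)) (at t within J)"
      by (rule DERIV_cmult[OF dL'[OF t]])
    have "((\<lambda>t. a * t + b) has_real_derivative a) (at t within J)" by (auto intro!: derivative_eq_intros)
    from DERIV_divide[OF this dL'[OF t]] L(1)[OF t]
    have "((\<lambda>t. (a * t + b) / L t) has_real_derivative (a * L t - (a * t + b) * ((a * t + b) / L t)) / (L t * L t)) (at t within J)"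
      by simp
    moreover have "(a * L t - (a * t + b) * ((a * t + b) / L t)) / (L t * L t) = \<gamma>0 / L t ^ 3"
      unfolding discriminant[OF t, symmetric] using L(1)[OF t]
      by (simp add: divide_simps) (simp add: power2_eq_square power3_eq_cube algebra_simps)
    ultimately have "((\<lambda>t. (a * t + b) / L t) has_real_derivative \<gamma>0 / L t ^ 3) (at t within J)" by simp
    from DERIV_cmult[OF this, of "\<gamma>1 / \<gamma>0"] \<gamma>
    show "((\<lambda>t. \<gamma>1 / \<gamma>0 * ((a * t + b) / L t)) has_real_derivative \<gamma>1 / L t ^ 3) (at t within J)" by simp
  qed (use that in blast)
  have I: "I t = ((\<gamma>1\<^sup>2 * a / \<gamma>0\<^sup>2 + c\<^sup>2) * t - \<gamma>1\<^sup>2 / (\<gamma>0 * L0\<^sup>2) * \<tau> t + 2 * c * \<gamma>1 / \<gamma>0 * (L t - L0)) / (4 * D)"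
    if t: "t \<in> J" for t
  proof (rule I_eq[OF _ _ t])
    fix t assume t: "t \<in> J"
    define z where "z = a * t + b"
    have z: "z\<^sup>2 = a * (L t)\<^sup>2 - \<gamma>0" using discriminant[OF t] by (simp add: z_def)
    have "((\<lambda>t. (\<gamma>1\<^sup>2 * a / \<gamma>0\<^sup>2 + c\<^sup>2) * t - \<gamma>1\<^sup>2 / (\<gamma>0 * L0\<^sup>2) * \<tau> t + 2 * c * \<gamma>1 / \<gamma>0 * (L t - L0))
      has_real_derivative (\<gamma>1\<^sup>2 * a / \<gamma>0\<^sup>2 + c\<^sup>2) - \<gamma>1\<^sup>2 / (\<gamma>0 * L0\<^sup>2) * k t + 2 * c * \<gamma>1 / \<gamma>0 * (z / L t - 0)) (at t within J)"
      unfolding z_def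
      by (intro DERIV_add DERIV_diff DERIV_cmult d\<tau>[OF t] dL'[OF t] DERIV_const DERIV_cmult_Id)
    moreover have "(\<gamma>1\<^sup>2 * a / \<gamma>0\<^sup>2 + c\<^sup>2) - \<gamma>1\<^sup>2 / (\<gamma>0 * L0\<^sup>2) * k t + 2 * c * \<gamma>1 / \<gamma>0 * (z / L t - 0) = (A' t)\<^sup>2"
    proof -
      have "(A' t)\<^sup>2 = \<gamma>1\<^sup>2 / \<gamma>0\<^sup>2 * (z\<^sup>2 / (L t)\<^sup>2) + c\<^sup>2 + 2 * (\<gamma>1 / \<gamma>0 * (z / L t)) * c"
        unfolding A(2)[OF t] z_def[symmetric] power2_sum power_mult_distrib power_divide ..
      also have "z\<^sup>2 / (L t)\<^sup>2 = a - \<gamma>0 / (L t)\<^sup>2"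
        unfolding z using L(1)[OF t] by (simp add: diff_divide_distrib)
      also have "\<gamma>1\<^sup>2 / \<gamma>0\<^sup>2 * (a - \<gamma>0 / (L t)\<^sup>2) = \<gamma>1\<^sup>2 * a / \<gamma>0\<^sup>2 - \<gamma>1\<^sup>2 / (\<gamma>0 * L0\<^sup>2) * k t"
        using \<gamma> L0 L(1)[OF t] by (simp add: k_def right_diff_distrib power2_eq_square)
      finally show ?thesis by (simp add: mult_ac)
    qed
    ultimately show "((\<lambda>t. (\<gamma>1\<^sup>2 * a / \<gamma>0\<^sup>2 + c\<^sup>2) * t - \<gamma>1\<^sup>2 / (\<gamma>0 * L0\<^sup>2) * \<tau> t + 2 * c * \<gamma>1 / \<gamma>0 * (L t - L0))
      has_real_derivative (A' t)\<^sup>2) (at t within J)" by simp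
  qed (simp add: \<tau>_0 L_0)
  have mode: "mode D f0 L0 L L' A' s h \<xi> t = general_mode c s h \<xi> t" if t: "t \<in> J" for s h \<xi> t
  proof -
    define z where "z = a * t + b"
    have AL: "A' t * L t = \<gamma>1 / \<gamma>0 * z + c * L t"
      unfolding A(2)[OF t] z_def[symmetric] using L(1)[OF t] by (simp add: distrib_right)
    have 1: "\<xi> * (A' t * L t) / (2 * D * L0) = \<xi> * \<gamma>1 * z / (2 * D * L0 * \<gamma>0) + \<xi> * c / (2 * D * L0) * L t"
      unfolding AL by (simp add: distrib_left add_divide_distrib mult_ac)
    have 2: "I t = 1 / (4 * D) * (\<gamma>1\<^sup>2 * a / \<gamma>0\<^sup>2 + c\<^sup>2) * t - \<gamma>1\<^sup>2 / (4 * D * \<gamma>0 * L0\<^sup>2) * \<tau> t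
        + c * \<gamma>1 / (2 * D * \<gamma>0) * (L t - L0)"
    proof -
      have "(P * t - \<gamma>1\<^sup>2 / (\<gamma>0 * L0\<^sup>2) * \<tau> t + 2 * c * \<gamma>1 / \<gamma>0 * w) / (4 * D)
        = 1 / (4 * D) * P * t - \<gamma>1\<^sup>2 / (4 * D * \<gamma>0 * L0\<^sup>2) * \<tau> t + c * \<gamma>1 / (2 * D * \<gamma>0) * w" for P w
        by (simp add: add_divide_distrib diff_divide_distrib mult_ac)
      then show ?thesis unfolding I[OF t] .
    qed
    have E: "s * \<tau> t + (f0 * t - I t - \<xi>\<^sup>2 * z / (4 * D * L0\<^sup>2) - \<xi> * (A' t * L t) / (2 * D * L0))
      = (s + \<gamma>1\<^sup>2 / (4 * D * \<gamma>0 * L0\<^sup>2)) * \<tau> t +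
        (f0 * t - 1 / (4 * D) * (\<gamma>1\<^sup>2 * a / \<gamma>0\<^sup>2 + c\<^sup>2) * t - c * \<gamma>1 / (2 * D * \<gamma>0) * (L t - L0)) +
        (- (\<xi>\<^sup>2 * z / (4 * D * L0\<^sup>2)) - \<xi> * \<gamma>1 * z / (2 * D * L0 * \<gamma>0) - \<xi> * c / (2 * D * L0) * L t)"
      unfolding 1 2 distrib_right by linarith
    have "mode D f0 L0 L L' A' s h \<xi> t =
       exp (s * \<tau> t + (f0 * t - I t - \<xi>\<^sup>2 * z / (4 * D * L0\<^sup>2) - \<xi> * (A' t * L t) / (2 * D * L0))) *
        (h \<xi> * (L0 / L t) powr (1/2))"
      unfolding mode_eq_powr[OF t] exp_add z_def by (simp only: mult_ac)
    then show ?thesis unfolding E general_mode_def unfolding exp_add z_def by (simp only: mult_ac)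
  qed
  show thesis by (rule that[OF A(1) mode])
qed

lemma sqrt_length_eq: "a = 0 \<Longrightarrow> t \<in> J \<Longrightarrow> L t = sqrt (L0\<^sup>2 + 2 * b * t)"
  using L_eq[of t] by (simp add: add.commute)

lemma sqrt_length:
  assumes a: "a = 0" and b: "b \<noteq> 0"
  shows "\<exists>c d. (\<forall>t\<in>J. A t = - (\<gamma>1 / b\<^sup>2) * sqrt (L0\<^sup>2 + 2 * b * t) + c * t + d) \<and>
       (\<forall>s h \<xi>. \<forall>t\<in>J. mode D f0 L0 L L' A' s h \<xi> t = ((L0\<^sup>2 + 2 * b * t) / L0\<^sup>2) powr
            (s * L0\<^sup>2 / (2 * b) - 1/4 - \<gamma>1\<^sup>2 / (8 * b^3 * D)) * h \<xi> *
          exp (f0 * t - c\<^sup>2 / (4 * D) * t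
            + c * \<gamma>1 / (2 * b\<^sup>2 * D) * (sqrt (L0\<^sup>2 + 2 * b * t) - L0)) *
          exp (- (\<xi>\<^sup>2 * b / (4 * D * L0\<^sup>2)) + \<xi> * \<gamma>1 / (2 * D * L0 * b)
            - \<xi> * c * sqrt (L0\<^sup>2 + 2 * b * t) / (2 * D * L0)))"
    (is "\<exists>c d. _ \<and> (\<forall>s h \<xi>. \<forall>t\<in>J. _ = ?R c s h \<xi> t)")
proof -
  note Lt = sqrt_length_eq[OF a]
  have \<gamma>: "\<gamma>0 = - (b\<^sup>2)" using a by (simp add: \<gamma>0)
  then have "\<gamma>0 \<noteq> 0" using b by simp
  then obtain c d where A: "\<And>t. t \<in> J \<Longrightarrow> A t = \<gamma>1 / \<gamma>0 * L t + c * t + d"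
    "\<And>s h \<xi> t. t \<in> J \<Longrightarrow> mode D f0 L0 L L' A' s h \<xi> t = general_mode c s h \<xi> t"
    by (rule nonzero_discriminant) blast
  have pos: "L0\<^sup>2 + 2 * b * t > 0" if "t \<in> J" for t
    using L[OF that] a zero_less_power[of "L t" 2] by (simp add: add.commute)
  have \<tau>: "\<tau> t = L0\<^sup>2 / (2 * b) * ln ((L0\<^sup>2 + 2 * b * t) / L0\<^sup>2)" if t: "t \<in> J" for t
  proof (rule \<tau>_eq[OF _ _ t])
    fix t assume t: "t \<in> J"
    have "((\<lambda>t. (L0\<^sup>2 + 2 * b * t) / L0\<^sup>2) has_real_derivative 2 * b / L0\<^sup>2) (at t within J)"
      by (intro DERIV_cdivide) (auto intro!: derivative_eq_intros)
    from DERIV_cmult[OF DERIV_chain2[OF DERIV_ln this], of "L0\<^sup>2 / (2 * b)"] pos[OF t] L0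
    have "((\<lambda>t. L0\<^sup>2 / (2 * b) * ln ((L0\<^sup>2 + 2 * b * t) / L0\<^sup>2)) has_real_derivative
        L0\<^sup>2 / (2 * b) * (inverse ((L0\<^sup>2 + 2 * b * t) / L0\<^sup>2) * (2 * b / L0\<^sup>2))) (at t within J)" by simp
    moreover have "L0\<^sup>2 / (2 * b) * (inverse ((L0\<^sup>2 + 2 * b * t) / L0\<^sup>2) * (2 * b / L0\<^sup>2)) = L0\<^sup>2 / (L t)\<^sup>2"
    proof -
      define y where "y = L0\<^sup>2 + 2 * b * t"
      have "L0\<^sup>2 / (2 * b) * (inverse (y / L0\<^sup>2) * (2 * b / L0\<^sup>2)) = L0\<^sup>2 / y"
        using b L0 by (simp add: field_simps)
      moreover have "(L t)\<^sup>2 = y" using L(2)[OF t] a by (simp add: y_def add.commute)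
      ultimately show ?thesis by (simp add: y_def)
    qed
    ultimately show "((\<lambda>t. L0\<^sup>2 / (2 * b) * ln ((L0\<^sup>2 + 2 * b * t) / L0\<^sup>2)) has_real_derivative L0\<^sup>2 / (L t)\<^sup>2) (at t within J)"
      by simp
  qed (use L0 in simp)
  have "mode D f0 L0 L L' A' s h \<xi> t = ?R c s h \<xi> t" if t: "t \<in> J" for s h \<xi> t
  proof -
    define R where "R = (L0\<^sup>2 + 2 * b * t) / L0\<^sup>2"
    have R: "R > 0" using pos[OF t] L0 by (simp add: R_def)
    \<comment> \<open>R is (L / L0)^2, so the prefactor accounts for the summand -1/4 in the
      exponent.\<close>
    have P1: "(L0 / L t) powr (1/2) = R powr (- 1/4)"
    proof -
      have "R = (L0 / L t) powr (-2)"
        using L[OF t] a L0 by (simp add: R_def powr_minus powr_numeral power_divide add.commute)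
      then have "R powr (- 1/4) = (L0 / L t) powr (-2 * (- 1/4))" by (simp only: powr_powr)
      then show ?thesis by simp
    qed
    have P2: "exp ((s + \<gamma>1\<^sup>2 / (4 * D * \<gamma>0 * L0\<^sup>2)) * \<tau> t) = R powr (s * L0\<^sup>2 / (2 * b) - \<gamma>1\<^sup>2 / (8 * b^3 * D))"
    proof -
      have eq: "(s + \<gamma>1\<^sup>2 / (4 * D * \<gamma>0 * L0\<^sup>2)) * (L0\<^sup>2 / (2 * b)) = s * L0\<^sup>2 / (2 * b) - \<gamma>1\<^sup>2 / (8 * b^3 * D)"
        unfolding \<gamma> using b L0 D by (simp add: left_diff_distrib diff_divide_distrib power2_eq_square power3_eq_cube)
      have "R powr x = exp (x * ln R)" for x using R by (simp add: powr_def)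
      then show ?thesis unfolding \<tau>[OF t] R_def[symmetric] eq[symmetric] by (simp only: mult.assoc)
    qed
    have P3: "R powr (s * L0\<^sup>2 / (2 * b) - \<gamma>1\<^sup>2 / (8 * b^3 * D)) * R powr (- 1/4)
        = R powr (s * L0\<^sup>2 / (2 * b) - 1/4 - \<gamma>1\<^sup>2 / (8 * b^3 * D))"
      unfolding powr_add[symmetric] by (simp add: algebra_simps)
    have P: "exp ((s + \<gamma>1\<^sup>2 / (4 * D * \<gamma>0 * L0\<^sup>2)) * \<tau> t) * h \<xi> * (L0 / L t) powr (1/2)
        = R powr (s * L0\<^sup>2 / (2 * b) - 1/4 - \<gamma>1\<^sup>2 / (8 * b^3 * D)) * h \<xi>"
      unfolding P1 P2 P3[symmetric] by (simp only: mult_ac)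
    have E1: "f0 * t - 1 / (4 * D) * (\<gamma>1\<^sup>2 * a / \<gamma>0\<^sup>2 + c\<^sup>2) * t - c * \<gamma>1 / (2 * D * \<gamma>0) * (L t - L0)
      = f0 * t - c\<^sup>2 / (4 * D) * t + c * \<gamma>1 / (2 * b\<^sup>2 * D) * (L t - L0)"
      unfolding \<gamma> a by (simp add: mult_ac)
    have E2: "- (\<xi>\<^sup>2 * (a * t + b) / (4 * D * L0\<^sup>2)) - \<xi> * \<gamma>1 * (a * t + b) / (2 * D * L0 * \<gamma>0)
        - \<xi> * c / (2 * D * L0) * L t
      = - (\<xi>\<^sup>2 * b / (4 * D * L0\<^sup>2)) + \<xi> * \<gamma>1 / (2 * D * L0 * b) - \<xi> * c * L t / (2 * D * L0)"
      unfolding \<gamma> a using b by (simp add: power2_eq_square)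
    show ?thesis unfolding A(2)[OF t] general_mode_def P E1 E2 R_def unfolding Lt[OF t] ..
  qed
  moreover have "A t = - (\<gamma>1 / b\<^sup>2) * sqrt (L0\<^sup>2 + 2 * b * t) + c * t + d" if "t \<in> J" for t
    using A(1)[OF that] Lt[OF that] by (simp add: \<gamma>)
  ultimately show ?thesis by blast
qed

text \<open>Partial fractions for 1 / L^2, based on (a t + b - r) (a t + b + r) = a L^2. The
  quotient \<open>R\<close> is positive whatever the signs of its four factors, because it equals (L
  / L0)^2 times a nonzero square.\<close>

lemma \<tau>_negative_discriminant:
  assumes a: "a \<noteq> 0" and \<gamma>: "\<gamma>0 < 0" and t: "t \<in> J"
  defines "r \<equiv> sqrt (b\<^sup>2 - a * L0\<^sup>2)"
  defines "R \<equiv> \<lambda>t. ((a * t + b - r) * (b + r)) / ((b - r) * (a * t + b + r))"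
  shows "\<tau> t = L0\<^sup>2 / (2 * r) * ln (R t)" "R t > 0"
proof -
  have r: "r > 0" "r\<^sup>2 = - \<gamma>0" using \<gamma> by (auto simp: r_def \<gamma>0)
  have fact: "(a * t + b - r) * (a * t + b + r) = a * (L t)\<^sup>2" if "t \<in> J" for t
    using discriminant[OF that] r by (simp add: power2_eq_square algebra_simps)
  then have nz: "a * t + b - r \<noteq> 0" "a * t + b + r \<noteq> 0" if "t \<in> J" for t
    using that L(1)[OF that] a by (metis mult_eq_0_iff power_eq_0_iff less_irrefl)+
  from nz[OF zero_in_J] have nz0: "b - r \<noteq> 0" "b + r \<noteq> 0" by auto
  have pos: "R t > 0" if t: "t \<in> J" for t
  proof -
    have f0: "(b - r) * (b + r) = a * L0\<^sup>2" using fact[OF zero_in_J] by (simp add: L_0)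
    have "R t = ((a * t + b - r) * (a * t + b + r)) / ((b - r) * (b + r)) * ((b + r) / (a * t + b + r))\<^sup>2"
      unfolding R_def using nz[OF t] nz0 by (simp add: power2_eq_square divide_simps)
    also have "\<dots> = ((L t)\<^sup>2 / L0\<^sup>2) * ((b + r) / (a * t + b + r))\<^sup>2"
      unfolding fact[OF t] f0 using a by simp
    also have "\<dots> > 0" using L(1)[OF t] L0 nz[OF t] nz0 by (intro mult_pos_pos divide_pos_pos) auto
    finally show ?thesis .
  qed
  show "R t > 0" by (rule pos[OF t])
  show "\<tau> t = L0\<^sup>2 / (2 * r) * ln (R t)"
  proof (rule \<tau>_eq[OF _ _ t])
    fix t assume t: "t \<in> J"
    define z where "z = a * t + b"
    have dz: "((\<lambda>t. a * t + b + w) has_real_derivative a) (at t within J)" for w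
      by (auto intro!: derivative_eq_intros)
    have "((\<lambda>t. (a * t + b - r) * (b + r) / ((b - r) * (a * t + b + r))) has_real_derivative
       (a * (b + r) * ((b - r) * (z + r)) - (z - r) * (b + r) * ((b - r) * a)) / (((b - r) * (z + r)) * ((b - r) * (z + r)))) (at t within J)"
      unfolding z_def using nz[OF t] nz0 dz[of "- r"] by (intro DERIV_divide DERIV_cmult DERIV_cmult_right dz) auto
    moreover have "R = (\<lambda>t. (a * t + b - r) * (b + r) / ((b - r) * (a * t + b + r)))" by (simp add: R_def)
    ultimately have dR: "(R has_real_derivative
       (a * (b + r) * ((b - r) * (z + r)) - (z - r) * (b + r) * ((b - r) * a)) / (((b - r) * (z + r)) * ((b - r) * (z + r)))) (at t within J)"
      by simp
    from DERIV_cmult[OF DERIV_chain2[OF DERIV_ln[OF pos[OF t]] dR], of "L0\<^sup>2 / (2 * r)"]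
    have D1: "((\<lambda>t. L0\<^sup>2 / (2 * r) * ln (R t)) has_real_derivative L0\<^sup>2 / (2 * r) * (inverse (R t) *
       ((a * (b + r) * ((b - r) * (z + r)) - (z - r) * (b + r) * ((b - r) * a)) / (((b - r) * (z + r)) * ((b - r) * (z + r)))))) (at t within J)" .
    have "a * (b + r) * ((b - r) * (z + r)) - (z - r) * (b + r) * ((b - r) * a) = 2 * r * a * (b + r) * (b - r)"
      by (simp add: algebra_simps)
    moreover have "inverse (R t) = (b - r) * (z + r) / ((z - r) * (b + r))" by (simp add: R_def z_def)
    moreover have "L0\<^sup>2 / (2 * r) * ((b - r) * (z + r) / ((z - r) * (b + r)) *
        (2 * r * a * (b + r) * (b - r) / (((b - r) * (z + r)) * ((b - r) * (z + r)))))
      = L0\<^sup>2 * a / ((z - r) * (z + r))"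
      using nz[OF t] nz0 r(1) unfolding z_def[symmetric] by (simp add: divide_simps)
    moreover have "L0\<^sup>2 * a / ((z - r) * (z + r)) = L0\<^sup>2 / (L t)\<^sup>2"
      using fact[OF t] a unfolding z_def by simp
    ultimately have "L0\<^sup>2 / (2 * r) * (inverse (R t) *
       ((a * (b + r) * ((b - r) * (z + r)) - (z - r) * (b + r) * ((b - r) * a)) / (((b - r) * (z + r)) * ((b - r) * (z + r)))))
      = L0\<^sup>2 / (L t)\<^sup>2" by simp
    with D1 show "((\<lambda>t. L0\<^sup>2 / (2 * r) * ln (R t)) has_real_derivative L0\<^sup>2 / (L t)\<^sup>2) (at t within J)"
      by simp
  next
    show "L0\<^sup>2 / (2 * r) * ln (R 0) = 0" using nz0 by (simp add: R_def)
  qed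
qed

text \<open>Since a L^2 = \<gamma>0 + (a t + b)^2, the integrand is the derivative of an
  arctangent.\<close>

lemma \<tau>_positive_discriminant:
  assumes a: "a \<noteq> 0" and \<gamma>: "\<gamma>0 > 0" and t: "t \<in> J"
  shows "\<tau> t = L0\<^sup>2 / sqrt \<gamma>0 * (arctan ((a * t + b) / sqrt \<gamma>0) - arctan (b / sqrt \<gamma>0))"
proof (rule \<tau>_eq[OF _ _ t])
  fix t assume t: "t \<in> J"
  define r where "r = sqrt \<gamma>0"
  have r: "r > 0" "r\<^sup>2 = \<gamma>0" using \<gamma> by (auto simp: r_def)
  have "((\<lambda>t. (a * t + b) / r) has_real_derivative a / r) (at t within J)"
    by (intro DERIV_cdivide) (auto intro!: derivative_eq_intros)
  from DERIV_cmult[OF DERIV_diff[OF DERIV_chain2[OF DERIV_arctan this] DERIV_const[of "arctan (b / r)"]], of "L0\<^sup>2 / r"]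
  have "((\<lambda>t. L0\<^sup>2 / r * (arctan ((a * t + b) / r) - arctan (b / r))) has_real_derivative
      L0\<^sup>2 / r * (inverse (1 + ((a * t + b) / r)\<^sup>2) * (a / r) - 0)) (at t within J)" .
  moreover have "L0\<^sup>2 / r * (inverse (1 + ((a * t + b) / r)\<^sup>2) * (a / r) - 0) = L0\<^sup>2 / (L t)\<^sup>2"
  proof -
    have 1: "1 + ((a * t + b) / r)\<^sup>2 = a * (L t)\<^sup>2 / r\<^sup>2"
    proof -
      have "a * (L t)\<^sup>2 = r\<^sup>2 + (a * t + b)\<^sup>2" using discriminant[OF t] r(2) by linarith
      moreover have "(r\<^sup>2 + z\<^sup>2) / r\<^sup>2 = 1 + (z / r)\<^sup>2" for z
        using r(1) by (simp add: power_divide add_divide_distrib)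
      ultimately show ?thesis by metis
    qed
    show ?thesis unfolding 1 using a r(1) L(1)[OF t] by (simp add: power2_eq_square)
  qed
  ultimately show "((\<lambda>t. L0\<^sup>2 / sqrt \<gamma>0 * (arctan ((a * t + b) / sqrt \<gamma>0) - arctan (b / sqrt \<gamma>0)))
      has_real_derivative L0\<^sup>2 / (L t)\<^sup>2) (at t within J)"
    unfolding r_def by simp
qed simp

lemma powr_three_halves: "x > 0 \<Longrightarrow> x powr (3/2) = x * sqrt x" for x :: real
proof -
  assume x: "x > 0"
  have "x powr (3/2) = x powr (1 + 1/2)" by simp
  also have "\<dots> = x * sqrt x" using x by (simp only: powr_add powr_half_sqrt) simp
  finally show ?thesis .
qed

lemma general_length:
  fixes \<sigma> :: "nat \<Rightarrow> real" and g :: "nat \<Rightarrow> real \<Rightarrow> real"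
  assumes a: "a \<noteq> 0" and \<gamma>: "\<gamma>0 \<noteq> 0"
  shows "\<exists>c d. (\<forall>t\<in>J. A t = - (\<gamma>1 / (b\<^sup>2 - a * L0\<^sup>2)) * L t + c * t + d) \<and>
    (\<exists>\<Theta> :: nat \<Rightarrow> real \<Rightarrow> real.
      (\<forall>n\<ge>1. \<forall>t\<in>J.
         (a * L0\<^sup>2 - b\<^sup>2 < 0 \<longrightarrow>
            \<Theta> n t =
              (((a * t + b - sqrt (b\<^sup>2 - a * L0\<^sup>2)) * (b + sqrt (b\<^sup>2 - a * L0\<^sup>2))) /
               ((b - sqrt (b\<^sup>2 - a * L0\<^sup>2)) * (a * t + b + sqrt (b\<^sup>2 - a * L0\<^sup>2)))) powr
              (\<sigma> n * L0\<^sup>2 / (2 * sqrt (b\<^sup>2 - a * L0\<^sup>2))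
               - \<gamma>1\<^sup>2 / (8 * D * (b\<^sup>2 - a * L0\<^sup>2) powr (3/2)))) \<and>
         (a * L0\<^sup>2 - b\<^sup>2 > 0 \<longrightarrow>
            \<Theta> n t =
              exp ((\<sigma> n * L0\<^sup>2 / sqrt (a * L0\<^sup>2 - b\<^sup>2)
                    + \<gamma>1\<^sup>2 / (4 * D * (a * L0\<^sup>2 - b\<^sup>2) powr (3/2))) *
                   (arctan ((a * t + b) / sqrt (a * L0\<^sup>2 - b\<^sup>2))
                    - arctan (b / sqrt (a * L0\<^sup>2 - b\<^sup>2)))))) \<and>
      (\<forall>n\<ge>1. \<forall>\<xi>\<in>{0..L0}. \<forall>t\<in>J. mode D f0 L0 L L' A' (\<sigma> n) (g n) \<xi> t = \<Theta> n t * g n \<xi> *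
           (L0\<^sup>2 / (a * t\<^sup>2 + 2 * b * t + L0\<^sup>2)) powr (1/4) *
           exp (f0 * t
             - 1 / (4 * D) * (\<gamma>1\<^sup>2 * a / (b\<^sup>2 - a * L0\<^sup>2)\<^sup>2 + c\<^sup>2) * t
             + c * \<gamma>1 / (2 * D * (b\<^sup>2 - a * L0\<^sup>2)) * (L t - L0)) *
           exp (- (\<xi>\<^sup>2 * (a * t + b) / (4 * D * L0\<^sup>2))
             + \<xi> * \<gamma>1 * (a * t + b) / (2 * D * L0 * (b\<^sup>2 - a * L0\<^sup>2))
             - \<xi> * c / (2 * D * L0) * L t)))"
proof -
  obtain c d where A: "\<And>t. t \<in> J \<Longrightarrow> A t = \<gamma>1 / \<gamma>0 * L t + c * t + d"
    "\<And>s h \<xi> t. t \<in> J \<Longrightarrow> mode D f0 L0 L L' A' s h \<xi> t = general_mode c s h \<xi> t"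
    by (rule nonzero_discriminant[OF \<gamma>]) blast
  have \<gamma>': "b\<^sup>2 - a * L0\<^sup>2 = - \<gamma>0" "a * L0\<^sup>2 - b\<^sup>2 = \<gamma>0" by (simp_all add: \<gamma>0)
  \<comment> \<open>The factor of \<open>general_mode\<close> that contains \<open>\<tau>\<close>;
    inserting the logarithmic or the arctangent form of \<open>\<tau>\<close> gives the two closed
    forms.\<close>
  define \<Theta> where "\<Theta> s t = exp ((s + \<gamma>1\<^sup>2 / (4 * D * \<gamma>0 * L0\<^sup>2)) * \<tau> t)" for s t
  have neg: "\<Theta> s t =
              (((a * t + b - sqrt (- \<gamma>0)) * (b + sqrt (- \<gamma>0))) /
               ((b - sqrt (- \<gamma>0)) * (a * t + b + sqrt (- \<gamma>0)))) powr
              (s * L0\<^sup>2 / (2 * sqrt (- \<gamma>0)) - \<gamma>1\<^sup>2 / (8 * D * (- \<gamma>0) powr (3/2)))"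
    if t: "t \<in> J" and n: "\<gamma>0 < 0" for s t
  proof -
    define r where "r = sqrt (- \<gamma>0)"
    define R where "R = ((a * t + b - r) * (b + r)) / ((b - r) * (a * t + b + r))"
    have r: "r > 0" using n by (simp add: r_def)
    have \<tau>R: "\<tau> t = L0\<^sup>2 / (2 * r) * ln R" "R > 0"
      using \<tau>_negative_discriminant[OF a n t] unfolding \<gamma>' r_def[symmetric] R_def[symmetric] by auto
    have p: "(- \<gamma>0) powr (3/2) = - \<gamma>0 * r" using powr_three_halves[of "- \<gamma>0"] n by (simp add: r_def)
    have eq: "(s + \<gamma>1\<^sup>2 / (4 * D * \<gamma>0 * L0\<^sup>2)) * (L0\<^sup>2 / (2 * r)) = s * L0\<^sup>2 / (2 * r) - \<gamma>1\<^sup>2 / (8 * D * (- \<gamma>0 * r))"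
      using n r L0 D by (simp add: distrib_right add_divide_distrib)
    have "R powr x = exp (x * ln R)" for x using \<tau>R(2) by (simp add: powr_def)
    then have "\<Theta> s t = R powr (s * L0\<^sup>2 / (2 * r) - \<gamma>1\<^sup>2 / (8 * D * (- \<gamma>0 * r)))"
      unfolding \<Theta>_def \<tau>R(1) eq[symmetric] by (simp only: mult.assoc)
    then show ?thesis unfolding p R_def r_def .
  qed
  have pos: "\<Theta> s t = exp ((s * L0\<^sup>2 / sqrt \<gamma>0 + \<gamma>1\<^sup>2 / (4 * D * \<gamma>0 powr (3/2))) *
                   (arctan ((a * t + b) / sqrt \<gamma>0) - arctan (b / sqrt \<gamma>0)))"
    if t: "t \<in> J" and n: "\<gamma>0 > 0" for s t
  proof -
    have eq: "(s + \<gamma>1\<^sup>2 / (4 * D * \<gamma>0 * L0\<^sup>2)) * (L0\<^sup>2 / sqrt \<gamma>0) = s * L0\<^sup>2 / sqrt \<gamma>0 + \<gamma>1\<^sup>2 / (4 * D * (\<gamma>0 * sqrt \<gamma>0))"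
      using n L0 D by (simp add: distrib_right add_divide_distrib)
    show ?thesis
      unfolding \<Theta>_def \<tau>_positive_discriminant[OF a n t] powr_three_halves[OF n] eq[symmetric]
      by (simp only: mult.assoc)
  qed
  have mode: "mode D f0 L0 L L' A' s h \<xi> t = \<Theta> s t * h \<xi> *
           (L0\<^sup>2 / (a * t\<^sup>2 + 2 * b * t + L0\<^sup>2)) powr (1/4) *
           exp (f0 * t - 1 / (4 * D) * (\<gamma>1\<^sup>2 * a / (- \<gamma>0)\<^sup>2 + c\<^sup>2) * t + c * \<gamma>1 / (2 * D * (- \<gamma>0)) * (L t - L0)) *
           exp (- (\<xi>\<^sup>2 * (a * t + b) / (4 * D * L0\<^sup>2)) + \<xi> * \<gamma>1 * (a * t + b) / (2 * D * L0 * (- \<gamma>0))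
             - \<xi> * c / (2 * D * L0) * L t)" if t: "t \<in> J" for s h \<xi> t
  proof -
    have "L0\<^sup>2 / (a * t\<^sup>2 + 2 * b * t + L0\<^sup>2) = (L0 / L t) powr 2"
      using L[OF t] L0 by (simp add: powr_numeral power_divide)
    then have "(L0\<^sup>2 / (a * t\<^sup>2 + 2 * b * t + L0\<^sup>2)) powr (1/4) = (L0 / L t) powr (2 * (1/4))"
      by (simp only: powr_powr)
    then have P: "(L0 / L t) powr (1/2) = (L0\<^sup>2 / (a * t\<^sup>2 + 2 * b * t + L0\<^sup>2)) powr (1/4)" by simp
    show ?thesis unfolding A(2)[OF t] general_mode_def \<Theta>_def P by simp
  qed
  have A1: "A t = - (\<gamma>1 / (- \<gamma>0)) * L t + c * t + d" if "t \<in> J" for t using A(1)[OF that] by simp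
  show ?thesis
    unfolding \<gamma>'
    by (rule exI[of _ c], rule exI[of _ d], intro conjI, use A1 in blast, rule exI[of _ "\<lambda>n. \<Theta> (\<sigma> n)"])
       (use neg pos mode in blast)
qed

end

theorem theorem2p1:
  fixes D f0 L0 a b \<gamma>0 \<gamma>1 :: real
    and L L' A A' :: "real \<Rightarrow> real"
    and J :: "real set"
    and \<sigma> :: "nat \<Rightarrow> real"
    and g :: "nat \<Rightarrow> real \<Rightarrow> real"
    and U :: "nat \<Rightarrow> real \<Rightarrow> real \<Rightarrow> real"
  assumes "D > 0" and "f0 > 0" and "L0 > 0"
    and J: "J = time_interval a b L0"
    and L: "\<forall>t\<in>J. L t > 0 \<and> (L t)\<^sup>2 = a * t\<^sup>2 + 2 * b * t + L0\<^sup>2"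
    and L': "\<forall>t\<in>J. (L has_real_derivative L' t) (at t within J)"
    and A': "\<forall>t\<in>J. (A has_real_derivative A' t) (at t within J)"
    and A'': "\<forall>t\<in>J. (A' has_real_derivative
                \<gamma>1 / (a * t\<^sup>2 + 2 * b * t + L0\<^sup>2) powr (3/2)) (at t within J)"
    and \<gamma>0: "\<gamma>0 = a * L0\<^sup>2 - b\<^sup>2"
    and sl: "sl_eigensystem D
               (\<lambda>\<xi>. \<gamma>0 * \<xi>\<^sup>2 / (4 * D * L0^4) + \<gamma>1 * \<xi> / (2 * D * L0^3)) L0 \<sigma> g"
    and U: "\<And>n \<xi> t. U n \<xi> t = mode D f0 L0 L L' A' (\<sigma> n) (g n) \<xi> t"
  shows
    "(\<forall>u0. L2_on {0..L0} u0 \<longrightarrow>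
        (\<exists>p :: nat \<Rightarrow> real.
           (\<exists>u. transformed_solution D f0 L0 J L L' A' u0 u) \<and>
           (\<forall>u. transformed_solution D f0 L0 J L L' A' u0 u \<longrightarrow>
              (\<forall>t\<in>J. L2_tendsto {0..L0} (\<lambda>N \<xi>. \<Sum>n=1..N. p n * U n \<xi> t) (\<lambda>\<xi>. u \<xi> t) sequentially))))
     \<and>
     (a = 0 \<and> b = 0 \<longrightarrow>
        (\<forall>t\<in>J. L t = L0) \<and>
        (\<exists>c d. (\<forall>t\<in>J. A t = \<gamma>1 / (2 * L0^3) * t\<^sup>2 + c * t + d) \<and>
           (\<forall>n\<ge>1. \<forall>\<xi>\<in>{0..L0}. \<forall>t\<in>J.
              U n \<xi> t = exp (\<sigma> n * t) * g n \<xi> *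
                exp (f0 * t
                  - 1 / (4 * D) * (\<gamma>1\<^sup>2 / (3 * L0^6) * t^3 + c * \<gamma>1 / L0^3 * t\<^sup>2 + c\<^sup>2 * t)
                  - \<xi> / (2 * D * L0) * (\<gamma>1 / L0\<^sup>2 * t + c * L0)))))
     \<and>
     (a \<noteq> 0 \<and> a * L0\<^sup>2 - b\<^sup>2 = 0 \<longrightarrow>
        (\<exists>\<alpha>. \<alpha> \<noteq> 0 \<and> (\<forall>t\<in>J. L t = L0 + \<alpha> * t) \<and>
          (\<exists>c d. (\<forall>t\<in>J. A t = \<gamma>1 / (2 * \<alpha>\<^sup>2 * (L0 + \<alpha> * t)) + c * t + d) \<and>
             (\<forall>n\<ge>1. \<forall>\<xi>\<in>{0..L0}. \<forall>t\<in>J.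
                U n \<xi> t = exp (\<sigma> n * L0 * t / (L0 + \<alpha> * t)) * g n \<xi> *
                  (L0 / (L0 + \<alpha> * t)) powr (1/2) * exp (f0 * t) *
                  exp (- (1 / (4 * D)) *
                    (c\<^sup>2 * t - c * \<gamma>1 * t / (\<alpha> * L0 * (L0 + \<alpha> * t))
                     - \<gamma>1\<^sup>2 / (12 * \<alpha>^3) * (1 / (L0 + \<alpha> * t)^3 - 1 / L0^3))) *
                  exp (- (\<xi>\<^sup>2 * \<alpha> * (L0 + \<alpha> * t) / (4 * D * L0\<^sup>2))
                    - \<xi> * c * (L0 + \<alpha> * t) / (2 * D * L0)
                    + \<xi> * \<gamma>1 / (4 * D * L0 * \<alpha> * (L0 + \<alpha> * t)))))))
     \<and>
     (\<forall>\<rho>. a = 0 \<and> b = \<rho> \<and> \<rho> \<noteq> 0 \<longrightarrow>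
        (\<forall>t\<in>J. L t = sqrt (L0\<^sup>2 + 2 * \<rho> * t)) \<and>
        (\<exists>c d. (\<forall>t\<in>J. A t = - (\<gamma>1 / \<rho>\<^sup>2) * sqrt (L0\<^sup>2 + 2 * \<rho> * t) + c * t + d) \<and>
           (\<forall>n\<ge>1. \<forall>\<xi>\<in>{0..L0}. \<forall>t\<in>J.
              U n \<xi> t = ((L0\<^sup>2 + 2 * \<rho> * t) / L0\<^sup>2) powr
                  (\<sigma> n * L0\<^sup>2 / (2 * \<rho>) - 1/4 - \<gamma>1\<^sup>2 / (8 * \<rho>^3 * D)) * g n \<xi> *
                exp (f0 * t - c\<^sup>2 / (4 * D) * t
                  + c * \<gamma>1 / (2 * \<rho>\<^sup>2 * D) * (sqrt (L0\<^sup>2 + 2 * \<rho> * t) - L0)) *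
                exp (- (\<xi>\<^sup>2 * \<rho> / (4 * D * L0\<^sup>2)) + \<xi> * \<gamma>1 / (2 * D * L0 * \<rho>)
                  - \<xi> * c * sqrt (L0\<^sup>2 + 2 * \<rho> * t) / (2 * D * L0)))))
     \<and>
     (a \<noteq> 0 \<and> a * L0\<^sup>2 - b\<^sup>2 \<noteq> 0 \<longrightarrow>
        (\<forall>t\<in>J. L t = sqrt (a * t\<^sup>2 + 2 * b * t + L0\<^sup>2)) \<and>
        (\<exists>c d. (\<forall>t\<in>J. A t = - (\<gamma>1 / (b\<^sup>2 - a * L0\<^sup>2)) * L t + c * t + d) \<and>
           (\<exists>\<Theta> :: nat \<Rightarrow> real \<Rightarrow> real.
              (\<forall>n\<ge>1. \<forall>t\<in>J.
                 (a * L0\<^sup>2 - b\<^sup>2 < 0 \<longrightarrow>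
                    \<Theta> n t =
                      (((a * t + b - sqrt (b\<^sup>2 - a * L0\<^sup>2)) * (b + sqrt (b\<^sup>2 - a * L0\<^sup>2))) /
                       ((b - sqrt (b\<^sup>2 - a * L0\<^sup>2)) * (a * t + b + sqrt (b\<^sup>2 - a * L0\<^sup>2)))) powr
                      (\<sigma> n * L0\<^sup>2 / (2 * sqrt (b\<^sup>2 - a * L0\<^sup>2))
                       - \<gamma>1\<^sup>2 / (8 * D * (b\<^sup>2 - a * L0\<^sup>2) powr (3/2)))) \<and>
                 (a * L0\<^sup>2 - b\<^sup>2 > 0 \<longrightarrow>
                    \<Theta> n t =
                      exp ((\<sigma> n * L0\<^sup>2 / sqrt (a * L0\<^sup>2 - b\<^sup>2)
                            + \<gamma>1\<^sup>2 / (4 * D * (a * L0\<^sup>2 - b\<^sup>2) powr (3/2))) *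
                           (arctan ((a * t + b) / sqrt (a * L0\<^sup>2 - b\<^sup>2))
                            - arctan (b / sqrt (a * L0\<^sup>2 - b\<^sup>2)))))) \<and>
              (\<forall>n\<ge>1. \<forall>\<xi>\<in>{0..L0}. \<forall>t\<in>J.
                 U n \<xi> t = \<Theta> n t * g n \<xi> *
                   (L0\<^sup>2 / (a * t\<^sup>2 + 2 * b * t + L0\<^sup>2)) powr (1/4) *
                   exp (f0 * t
                     - 1 / (4 * D) * (\<gamma>1\<^sup>2 * a / (b\<^sup>2 - a * L0\<^sup>2)\<^sup>2 + c\<^sup>2) * t
                     + c * \<gamma>1 / (2 * D * (b\<^sup>2 - a * L0\<^sup>2)) * (L t - L0)) *
                   exp (- (\<xi>\<^sup>2 * (a * t + b) / (4 * D * L0\<^sup>2))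
                     + \<xi> * \<gamma>1 * (a * t + b) / (2 * D * L0 * (b\<^sup>2 - a * L0\<^sup>2))
                     - \<xi> * c / (2 * D * L0) * L t)))))"
proof -
  interpret moving_interval D f0 L0 a b \<gamma>0 \<gamma>1 L L' A A' J
    using assms by unfold_locales auto
  interpret moving_eigen D f0 L0 a b \<gamma>0 \<gamma>1 L L' A A' J \<sigma> g
    using sl by unfold_locales (simp add: q_def[abs_def])
  have \<gamma>0': "a * L0\<^sup>2 - b\<^sup>2 = \<gamma>0" by (simp add: \<gamma>0)
  show ?thesis
    unfolding U
  proof (intro conjI, goal_cases)
    case 1
    show ?case
    proof (intro allI impI)
      fix u0 assume u0: "L2_on {0..L0} u0"
      \<comment> \<open>The coefficients are those of the gauged datum, rescaled from
        \<open>e n\<close> to \<open>g n\<close>; they depend on \<open>u0\<close> alone and serve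
        every solution \<open>u\<close> at every time.\<close>
      show "\<exists>p. (\<exists>u. transformed_solution D f0 L0 J L L' A' u0 u) \<and>
        (\<forall>u. transformed_solution D f0 L0 J L L' A' u0 u \<longrightarrow>
          (\<forall>t\<in>J. L2_tendsto {0..L0}
            (\<lambda>N \<xi>. \<Sum>n=1..N. p n * mode D f0 L0 L L' A' (\<sigma> n) (g n) \<xi> t) (\<lambda>\<xi>. u \<xi> t) sequentially))"
        using exists_solution[OF u0] solution_expansion[OF u0]
        by (intro exI[of _ "\<lambda>n. sl.coef (v0 u0) n / sl.nrm n"]) blast
    qed
  next
    case 2
    show ?case using constant_length constant_length_eq by blast
  next
    case 3
    show ?case using linear_length unfolding \<gamma>0' by blast
  next
    case 4
    show ?case using sqrt_length sqrt_length_eq by blast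
  next
    case 5
    have "\<forall>t\<in>J. L t = sqrt (a * t\<^sup>2 + 2 * b * t + L0\<^sup>2)" using L_eq by blast
    then show ?case unfolding \<gamma>0'
      by (intro impI conjI) (assumption, elim conjE, rule general_length[unfolded \<gamma>0'])
  qed
qed

end
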